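(* Let $W$ satisfy Assumption (W) (stated in the context), let $A$ be the generalised Airy operator in $L^2(\mathbb{R})$ $$A = -\partial_x + W(x), \qquad \mathrm{Dom}(A) = W^{1,2}(\mathbb{R}) \cap \mathrm{Dom}(W),$$ and let $\lambda > 0$. Then $$\| (A - \lambda)^{-1} \| = \sqrt{\pi}\, (W'(x_{\lambda}))^{-\frac12} \exp \left(2 f_{\lambda}(x_{\lambda})\right) (1 + o(1)), \qquad \lambda \to +\infty,$$ where, for all sufficiently large $\lambda$, $x_\lambda>0$ is the unique positive solution of $W(x_\lambda)=\lambda$, and $f_{\lambda}(x) = \int_{0}^{x} (\lambda - W(t))\, dt$, $x \in \mathbb{R}$.
   Context: Assumption (W): $W:\mathbb{R}\to\mathbb{R}$ belongs to $L^\infty_{\mathrm{loc}}(\mathbb{R}) \cap C^2(\mathbb{R}\setminus[-x_0,x_0])$ for some $x_0>0$, $W\ge 0$ a.e., and: (i) $W$ is even: $W(-x)=W(x)$ for $x\in\mathbb{R}$; (ii) $\lim_{x\to+\infty}W(x)=+\infty$ and $W'(x)>0$ for $x>x_0$; (iii) there exist $\nu\in[-1,+\infty)$ and a constant $C>0$ such that $W'(x)\le C\,W(x)x^\nu$ and $|W''(x)|\le C\,W'(x)x^\nu$ for all $x>x_0$; (iv) with this $\nu$, $\Upsilon_1(x):=|x|^\nu|W'(x)|^{-1/2}\to 0$ as $|x|\to+\infty$. $\mathrm{Dom}(W)=\{u\in L^2(\mathbb{R}): Wu\in L^2(\mathbb{R})\}$ and $W^{1,2}(\mathbb{R})$ is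 the Sobolev space. It is known that, under Assumption (W), $A$ is closed and densely defined and its spectrum is empty, so $(A-\lambda)^{-1}$ is a bounded operator on $L^2(\mathbb{R})$ for every $\lambda$. The norm is the operator norm on $L^2(\mathbb{R})$. By (ii), for all sufficiently large $\lambda$ the equation $W(x)=\lambda$ has a unique solution $x_\lambda$ in $(0,+\infty)$ (values of $W$ on $[-x_0,x_0]$ being understood up to null sets), and $x_\lambda\to+\infty$ as $\lambda\to+\infty$. *)

theory Defs
  imports "HOL-Analysis.Analysis" "HOL-Library.Landau_Symbols"
begin

section \<open>The Hilbert space of square integrable functions on the real line\<close>

definition square_integrable :: "(real \<Rightarrow> complex) \<Rightarrow> bool" where
  "square_integrable f \<longleftrightarrow>
     f \<in> borel_measurable lebesgue \<and> integrable lebesgue (\<lambda>x. (norm (f x))\<^sup>2)"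

definition l2_eq :: "(real \<Rightarrow> complex) \<Rightarrow> (real \<Rightarrow> complex) \<Rightarrow> bool" where
  "l2_eq f g \<longleftrightarrow>
     square_integrable f \<and> square_integrable g \<and> (AE x in lebesgue. f x = g x)"

lemma square_integrable_zero: "square_integrable (\<lambda>_. 0)"
  by (simp add: square_integrable_def)

lemma square_integrable_scaleR:
  "square_integrable f \<Longrightarrow> square_integrable (\<lambda>x. c *\<^sub>R f x)"
  by (auto simp: square_integrable_def power_mult_distrib)

lemma square_integrable_add:
  assumes "square_integrable f" "square_integrable g"
  shows "square_integrable (\<lambda>x. f x + g x)"
proof -
  have *: "(norm (a + b))\<^sup>2 \<le> 2 * (norm a)\<^sup>2 + 2 * (norm b)\<^sup>2" for a b :: complex
  proof -
    have "(norm (a + b))\<^sup>2 \<le> (norm a + norm b)\<^sup>2"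
      by (intro power_mono norm_triangle_ineq norm_ge_zero)
    also have "\<dots> \<le> 2 * (norm a)\<^sup>2 + 2 * (norm b)\<^sup>2"
      using sum_squares_bound[of "norm a" "norm b"] by (simp add: power2_sum)
    finally show ?thesis .
  qed
  have "integrable lebesgue (\<lambda>x. 2 * (norm (f x))\<^sup>2 + 2 * (norm (g x))\<^sup>2)"
    using assms by (auto simp: square_integrable_def)
  then have "integrable lebesgue (\<lambda>x. (norm (f x + g x))\<^sup>2)"
    by (rule Bochner_Integration.integrable_bound)
      (use assms * in \<open>auto simp: square_integrable_def intro!: AE_I2\<close>)
  then show ?thesis
    using assms by (auto simp: square_integrable_def)
qed

lemma square_integrable_inner:
  assumes "square_integrable f" "square_integrable g"
  shows "integrable lebesgue (\<lambda>x. f x \<bullet> g x)"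
proof -
  have *: "\<bar>a \<bullet> b\<bar> \<le> (norm a)\<^sup>2 + (norm b)\<^sup>2" for a b :: complex
  proof -
    have "\<bar>a \<bullet> b\<bar> \<le> norm a * norm b"
      by (rule Cauchy_Schwarz_ineq2)
    also have "\<dots> \<le> (norm a)\<^sup>2 + (norm b)\<^sup>2"
      using sum_squares_bound[of "norm a" "norm b"]
        mult_nonneg_nonneg[OF norm_ge_zero[of a] norm_ge_zero[of b]]
      unfolding mult.assoc by linarith
    finally show ?thesis .
  qed
  have "integrable lebesgue (\<lambda>x. (norm (f x))\<^sup>2 + (norm (g x))\<^sup>2)"
    using assms by (auto simp: square_integrable_def)
  then show ?thesis
    by (rule Bochner_Integration.integrable_bound)
      (use assms * in \<open>auto simp: square_integrable_def intro!: AE_I2\<close>)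
qed

quotient_type l2 = "real \<Rightarrow> complex" / partial: l2_eq
  morphisms rep_l2 abs_l2
proof (rule part_equivpI)
  show "\<exists>f. l2_eq f f"
    using square_integrable_zero by (auto simp: l2_eq_def)
  show "symp l2_eq"
    by (auto simp: symp_def l2_eq_def eq_commute)
  show "transp l2_eq"
    by (auto simp: transp_def l2_eq_def)
qed

text \<open>
  Only the underlying real vector space structure is recorded for the space of complex-valued
  functions: the spectral parameter below is real, and the norm of an operator does not depend
  on the scalar field.
\<close>

instantiation l2 :: real_inner
begin

lift_definition zero_l2 :: l2 is "\<lambda>_. 0"
  by (simp add: l2_eq_def square_integrable_zero)

lift_definition plus_l2 :: "l2 \<Rightarrow> l2 \<Rightarrow> l2" is "\<lambda>f g x. f x + g x"
  by (auto simp: l2_eq_def square_integrable_add)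

lift_definition uminus_l2 :: "l2 \<Rightarrow> l2" is "\<lambda>f x. - f x"
  using square_integrable_scaleR[where c = "-1"] by (auto simp: l2_eq_def)

lift_definition scaleR_l2 :: "real \<Rightarrow> l2 \<Rightarrow> l2" is "\<lambda>c f x. c *\<^sub>R f x"
  by (auto simp: l2_eq_def square_integrable_scaleR)

lift_definition inner_l2 :: "l2 \<Rightarrow> l2 \<Rightarrow> real" is "\<lambda>f g. \<integral>x. f x \<bullet> g x \<partial>lebesgue"
proof -
  fix f f' g g' assume "l2_eq f f'" "l2_eq g g'"
  then show "(\<integral>x. f x \<bullet> g x \<partial>lebesgue) = (\<integral>x. f' x \<bullet> g' x \<partial>lebesgue)"
    by (intro integral_cong_AE) (auto simp: l2_eq_def square_integrable_def)
qed

lift_definition norm_l2 :: "l2 \<Rightarrow> real" is "\<lambda>f. sqrt (\<integral>x. (norm (f x))\<^sup>2 \<partial>lebesgue)"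
proof -
  fix f g assume "l2_eq f g"
  then have "(\<integral>x. (norm (f x))\<^sup>2 \<partial>lebesgue) = (\<integral>x. (norm (g x))\<^sup>2 \<partial>lebesgue)"
    by (intro integral_cong_AE) (auto simp: l2_eq_def square_integrable_def)
  then show "sqrt (\<integral>x. (norm (f x))\<^sup>2 \<partial>lebesgue) = sqrt (\<integral>x. (norm (g x))\<^sup>2 \<partial>lebesgue)"
    by simp
qed

definition minus_l2 :: "l2 \<Rightarrow> l2 \<Rightarrow> l2" where
  "minus_l2 u v = u + - v"

definition sgn_l2 :: "l2 \<Rightarrow> l2" where
  "sgn_l2 u = inverse (norm u) *\<^sub>R u"

definition dist_l2 :: "l2 \<Rightarrow> l2 \<Rightarrow> real" where
  "dist_l2 u v = norm (u - v)"

definition uniformity_l2 :: "(l2 \<times> l2) filter" where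
  "uniformity_l2 = (INF e\<in>{0<..}. principal {(u, v). dist u v < e})"

definition open_l2 :: "l2 set \<Rightarrow> bool" where
  "open_l2 U = (\<forall>x\<in>U. eventually (\<lambda>(x', y). x' = x \<longrightarrow> y \<in> U) uniformity)"

instance
proof
  fix u v w :: l2 and a b :: real and U :: "l2 set"
  show "u + v + w = u + (v + w)"
    by transfer (auto simp: l2_eq_def add.assoc intro!: square_integrable_add)
  show "u + v = v + u"
    by transfer (auto simp: l2_eq_def add.commute intro!: square_integrable_add)
  show "0 + u = u"
    by transfer (auto simp: l2_eq_def)
  show "- u + u = 0"
    by transfer (auto simp: l2_eq_def square_integrable_zero)
  show "u - v = u + - v"
    by (rule minus_l2_def)
  show "a *\<^sub>R (u + v) = a *\<^sub>R u + a *\<^sub>R v"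
    by transfer (auto simp: l2_eq_def scaleR_add_right
        simp del: scaleR_conv_of_real intro!: square_integrable_add square_integrable_scaleR)
  show "(a + b) *\<^sub>R u = a *\<^sub>R u + b *\<^sub>R u"
    by transfer (auto simp: l2_eq_def scaleR_add_left
        intro!: square_integrable_add square_integrable_scaleR)
  show "a *\<^sub>R b *\<^sub>R u = (a * b) *\<^sub>R u"
    by transfer (auto simp: l2_eq_def intro!: square_integrable_scaleR)
  show "1 *\<^sub>R u = u"
    by transfer (auto simp: l2_eq_def)
  show "dist u v = norm (u - v)"
    by (rule dist_l2_def)
  show "sgn u = inverse (norm u) *\<^sub>R u"
    by (rule sgn_l2_def)
  show "(uniformity :: (l2 \<times> l2) filter) = (INF e\<in>{0<..}. principal {(u, v). dist u v < e})"
    by (rule uniformity_l2_def)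
  show "open U = (\<forall>x\<in>U. eventually (\<lambda>(x', y). x' = x \<longrightarrow> y \<in> U) uniformity)"
    by (rule open_l2_def)
  show "u \<bullet> v = v \<bullet> u"
    by transfer (simp add: inner_commute)
  show "(u + v) \<bullet> w = u \<bullet> w + v \<bullet> w"
    by transfer (auto simp: l2_eq_def inner_add_left square_integrable_inner)
  show "(a *\<^sub>R u) \<bullet> v = a * (u \<bullet> v)"
    by transfer (simp add: inner_scaleR_left)
  show "0 \<le> u \<bullet> u"
    by transfer simp
  show "(u \<bullet> u = 0) = (u = 0)"
  proof transfer
    fix f assume f: "l2_eq f f"
    have "(\<integral>x. f x \<bullet> f x \<partial>lebesgue) = 0 \<longleftrightarrow> (AE x in lebesgue. f x \<bullet> f x = 0)"
      using f by (intro integral_nonneg_eq_0_iff_AE)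
        (auto simp: l2_eq_def intro!: square_integrable_inner)
    then show "((\<integral>x. f x \<bullet> f x \<partial>lebesgue) = 0) = l2_eq f (\<lambda>_. 0)"
      using f by (simp add: l2_eq_def square_integrable_zero)
  qed
  show "norm u = sqrt (u \<bullet> u)"
    by transfer (simp add: power2_norm_eq_inner)
qed

end

section \<open>The generalised Airy operator\<close>

definition test_function :: "(real \<Rightarrow> real) \<Rightarrow> bool" where
  "test_function \<phi> \<longleftrightarrow>
     (\<forall>n x. (deriv ^^ n) \<phi> differentiable (at x)) \<and> (\<exists>K. compact K \<and> (\<forall>x. x \<notin> K \<longrightarrow> \<phi> x = 0))"

definition weak_deriv :: "l2 \<Rightarrow> l2 \<Rightarrow> bool" where
  "weak_deriv u v \<longleftrightarrow> (\<forall>\<phi>. test_function \<phi> \<longrightarrow>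
     (\<integral>x. deriv \<phi> x *\<^sub>R rep_l2 u x \<partial>lebesgue) = - (\<integral>x. \<phi> x *\<^sub>R rep_l2 v x \<partial>lebesgue))"

definition sobolev_W12 :: "l2 set" where
  "sobolev_W12 = {u. \<exists>v. weak_deriv u v}"

definition Dx :: "l2 \<Rightarrow> l2" where
  "Dx u = (THE v. weak_deriv u v)"

definition mult_dom :: "(real \<Rightarrow> real) \<Rightarrow> l2 set" where
  "mult_dom W = {u. square_integrable (\<lambda>x. W x *\<^sub>R rep_l2 u x)}"

definition mult_op :: "(real \<Rightarrow> real) \<Rightarrow> l2 \<Rightarrow> l2" where
  "mult_op W u = abs_l2 (\<lambda>x. W x *\<^sub>R rep_l2 u x)"

definition airy_dom :: "(real \<Rightarrow> real) \<Rightarrow> l2 set" where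
  "airy_dom W = sobolev_W12 \<inter> mult_dom W"

text \<open>Only the values of \<^term>\<open>airy_op W\<close> on \<^term>\<open>airy_dom W\<close> are meaningful.\<close>

definition airy_op :: "(real \<Rightarrow> real) \<Rightarrow> l2 \<Rightarrow> l2" where
  "airy_op W u = - Dx u + mult_op W u"

text \<open>
  \<open>resolvent D T lam\<close> is \<open>(T - lam)\<^sup>-\<^sup>1\<close> for the unbounded operator \<open>T\<close> with domain \<open>D\<close>.
\<close>

definition resolvent :: "l2 set \<Rightarrow> (l2 \<Rightarrow> l2) \<Rightarrow> real \<Rightarrow> l2 \<Rightarrow> l2" where
  "resolvent D T lam = inv_into D (\<lambda>u. T u - lam *\<^sub>R u)"

section \<open>The potential\<close>

definition Linf_loc :: "(real \<Rightarrow> real) \<Rightarrow> bool" where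
  "Linf_loc W \<longleftrightarrow> W \<in> borel_measurable lebesgue \<and>
     (\<forall>K. compact K \<longrightarrow> (\<exists>M. AE x in lebesgue. x \<in> K \<longrightarrow> \<bar>W x\<bar> \<le> M))"

definition assumption_W :: "(real \<Rightarrow> real) \<Rightarrow> real \<Rightarrow> bool" where
  "assumption_W W x0 \<longleftrightarrow>
     x0 > 0 \<and>
     Linf_loc W \<and>
     W C1_differentiable_on (- {-x0..x0}) \<and> deriv W C1_differentiable_on (- {-x0..x0}) \<and>
     (AE x in lebesgue. W x \<ge> 0) \<and>
     (\<forall>x. W (- x) = W x) \<and>
     filterlim W at_top at_top \<and>
     (\<forall>x>x0. deriv W x > 0) \<and>
     (\<exists>\<nu>\<ge>-1.
        (\<exists>C>0. \<forall>x>x0. deriv W x \<le> C * W x * x powr \<nu> \<and>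
                       \<bar>deriv (deriv W) x\<bar> \<le> C * deriv W x * x powr \<nu>) \<and>
        ((\<lambda>x. \<bar>x\<bar> powr \<nu> * \<bar>deriv W x\<bar> powr (-1/2)) \<longlongrightarrow> 0) at_infinity)"

text \<open>
  The solution of \<open>W x = lam\<close> is sought beyond \<open>x0\<close>: on \<open>[-x0, x0]\<close> the function \<open>W\<close> is
  determined only up to null sets, and for large \<open>lam\<close> the equation has no solution there
  after discarding a null set.
\<close>

definition turning_point :: "(real \<Rightarrow> real) \<Rightarrow> real \<Rightarrow> real \<Rightarrow> real" where
  "turning_point W x0 lam = (THE x. x > x0 \<and> W x = lam)"

text \<open>
  The measure is \<^term>\<open>lebesgue\<close> rather than \<^term>\<open>lborel\<close> because \<open>W\<close> is only assumed
  Lebesgue measurable.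
\<close>

definition phase :: "(real \<Rightarrow> real) \<Rightarrow> real \<Rightarrow> real \<Rightarrow> real" where
  "phase W lam x = (LINT t=0..ereal x|lebesgue. (lam - W t))"

end

theory Submission
  imports Defs "HOL-Probability.Distributions"
begin

text \<open>
  Put \<open>V = W - lam\<close> and \<open>F x = (lam - W)\<close> integrated from \<open>0\<close> to \<open>x\<close>. The equation
  \<open>- u' + V u = g\<close> is of first order: multiplied by \<open>exp F\<close> it reads \<open>(exp F * u)' = - exp F * g\<close>.
  Since \<open>F\<close> tends to \<open>-\<infinity>\<close> at \<open>+\<infinity>\<close>, the only square integrable candidate is
  \<open>u x = exp (- F x)\<close> times the integral of \<open>exp (F t) * g t\<close> over \<open>t > x\<close>. The resolvent is thus
  the integral operator with the positive kernel \<open>exp (F t - F x)\<close> on \<open>x < t\<close>.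

  The potential is even, so \<open>F\<close> is odd; it has its maximum at the turning point and its minimum at
  the mirror image of that point. The kernel is therefore concentrated on the quadrant
  \<open>x < 0 < t\<close>, where it is the product of \<open>exp (- F x)\<close> and \<open>exp (F t)\<close>: an operator of rank one,
  whose norm is exactly \<open>I\<close>, the integral of \<open>exp (2 * F)\<close> over the half line. Applied to
  \<open>exp F\<close> cut off to \<open>t > 0\<close> the resolvent gives the lower bound \<open>I\<close>. The two remaining pieces,
  \<open>0 \<le> x < t\<close> and its mirror image, carry only one factor \<open>exp F\<close> instead of two; Schur's test
  bounds them by some \<open>\<sigma>\<close> with \<open>\<sigma> = o(I)\<close> (\<open>forward_kernel_schur_bound\<close>), and the three pieces
  together have norm at most \<open>sqrt (I\<^sup>2 + I * \<sigma> + \<sigma>\<^sup>2)\<close> (\<open>resolvent_majorant_L2_bound\<close>).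

  What is left of the asymptotics is Laplace's method for \<open>I\<close> (\<open>peak_integral_tendsto\<close>). The bound
  on the second derivative says that \<open>ln W'\<close> varies little on a window of half width
  \<open>\<theta> * x powr (- \<nu>)\<close> around the turning point \<open>x\<close>, so that \<open>F\<close> is a parabola there up to a factor
  close to one; the condition on \<open>\<Upsilon>\<^sub>1\<close> says that this window is wide in comparison with the
  width \<open>W' powr (-1/2)\<close> of the resulting Gaussian.

  It also has to be shown that the integral operator inverts the given operator on the given
  domain. That \<open>W u\<close> is square integrable is again Schur's test, with a weight, and rests on
  \<open>W' = o(W\<^sup>2)\<close> (\<open>weighted_resolvent_finite\<close>). Near the origin \<open>W\<close> is only bounded and measurable,
  so the differential equation is understood through indefinite integrals, for which the product
  rule and the chain rule for \<open>exp\<close> are proved first. Injectivity follows from the lemma of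
  du Bois-Reymond: a weak solution of \<open>u' = V u\<close> is a multiple of \<open>exp (- F)\<close>, which grows at
  \<open>+\<infinity>\<close>.
\<close>

section \<open>Indefinite integrals of locally integrable functions\<close>

text \<open>
  Absolute continuity in integrated form. It serves as the meaning of \<open>A' = a\<close> when \<open>a\<close> has no
  continuity at all, as is the case for the potential near the origin.
\<close>

definition has_primitive :: "(real \<Rightarrow> 'b::euclidean_space) \<Rightarrow> (real \<Rightarrow> 'b) \<Rightarrow> bool" where
  "has_primitive a A \<longleftrightarrow>
     (\<forall>x y. x \<le> y \<longrightarrow> a absolutely_integrable_on {x..y} \<and> A y - A x = integral {x..y} a)"

definition locally_bounded :: "(real \<Rightarrow> 'b::real_normed_vector) \<Rightarrow> bool" where
  "locally_bounded a \<longleftrightarrow> (\<forall>R. \<exists>M. \<forall>x. \<bar>x\<bar> \<le> R \<longrightarrow> norm (a x) \<le> M)"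

lemma has_primitiveD:
  assumes "has_primitive a A" "x \<le> y"
  shows "a absolutely_integrable_on {x..y}" "a integrable_on {x..y}"
    "A y - A x = integral {x..y} a" "(a has_integral (A y - A x)) {x..y}"
  using assms unfolding has_primitive_def
  by (auto simp: absolutely_integrable_on_def integrable_integral)

lemma has_primitive_continuous:
  assumes "has_primitive a A"
  shows "continuous_on S A"
proof -
  have "isCont A x" for x
  proof -
    have "continuous_on {x-1..x+1} (\<lambda>y. A (x-1) + integral {x-1..y} a)"
      by (intro continuous_intros indefinite_integral_continuous_1 has_primitiveD[OF assms]) auto
    then have "continuous_on {x-1..x+1} A"
      by (rule continuous_on_eq) (simp add: has_primitiveD(3)[OF assms, symmetric])
    then show "isCont A x"
      by (rule continuous_on_interior) auto
  qed
  then show ?thesis by (simp add: continuous_at_imp_continuous_on)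
qed

text \<open>
  A function whose increments are \<open>o\<close> of the length of the interval, locally uniformly, has
  derivative zero everywhere and is constant. Hence an integral formula needs to be checked only
  to first order on short intervals. The control is required for all subintervals near \<open>z\<close>, so
  that left and right derivatives are covered at once.
\<close>

lemma has_primitiveI_local:
  fixes P :: "real \<Rightarrow> 'b::euclidean_space"
  assumes abs: "\<And>x y. x \<le> y \<Longrightarrow> f absolutely_integrable_on {x..y}"
    and small: "\<And>z e. e > 0 \<Longrightarrow> \<exists>d>0. \<forall>u v. z - d \<le> u \<and> u \<le> v \<and> v \<le> z + d \<longrightarrow>
             norm (P v - P u - integral {u..v} f) \<le> e * (v - u)"
  shows "has_primitive f P"
  unfolding has_primitive_def
proof (intro allI impI conjI abs)
  fix x y :: real assume xy: "x \<le> y"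
  note int = abs[THEN absolutely_integrable_on_def[THEN iffD1, THEN conjunct1]]
  define D where "D = (\<lambda>t. P t - (integral {x..t} f - integral {t..x} f))"
  have incr: "D v - D u = P v - P u - integral {u..v} f" if "u \<le> v" for u v
  proof -
    consider "x \<le> u" | "u < x" "x \<le> v" | "v < x" by linarith
    then show ?thesis
    proof cases
      case 1
      have "integral {x..u} f + integral {u..v} f = integral {x..v} f"
        using 1 that int[of x v] by (intro Henstock_Kurzweil_Integration.integral_combine) auto
      then show ?thesis using that 1
        by (cases "u = x"; cases "v = x") (auto simp: D_def algebra_simps)
    next
      case 2
      have "integral {u..x} f + integral {x..v} f = integral {u..v} f"
        using 2 that int[of u v] by (intro Henstock_Kurzweil_Integration.integral_combine) auto
      then show ?thesis using 2
        by (cases "v = x") (auto simp: D_def algebra_simps)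
    next
      case 3
      have "integral {u..v} f + integral {v..x} f = integral {u..x} f"
        using 3 that int[of u x] by (intro Henstock_Kurzweil_Integration.integral_combine) auto
      then show ?thesis using that 3
        by (auto simp: D_def algebra_simps)
    qed
  qed
  have "(D has_derivative (\<lambda>h. 0)) (at z within UNIV)" for z
    unfolding has_derivative_within_alt
  proof (intro conjI allI impI)
    fix e :: real assume "e > 0"
    from small[OF this, of z] obtain d where d: "d > 0"
      "\<And>u v. z - d \<le> u \<Longrightarrow> u \<le> v \<Longrightarrow> v \<le> z + d \<Longrightarrow> norm (D v - D u) \<le> e * (v - u)"
      using incr by metis
    show "\<exists>d>0. \<forall>y\<in>UNIV. norm (y - z) < d \<longrightarrow> norm (D y - D z - 0) \<le> e * norm (y - z)"
    proof (intro exI[of _ d] conjI ballI impI)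
      fix y assume "norm (y - z) < d"
      then show "norm (D y - D z - 0) \<le> e * norm (y - z)"
        using d(2)[of z y] d(2)[of y z] \<open>d > 0\<close>
        by (cases "z \<le> y") (auto simp: norm_minus_commute abs_if)
    qed (fact d(1))
  qed simp
  then have "D y = D x"
    using has_derivative_zero_constant[of UNIV D] by (metis UNIV_I convex_UNIV)
  then show "P y - P x = integral {x..y} f"
    using incr[OF xy] by simp
qed

lemma absolutely_integrable_scaleR_continuous:
  fixes B :: "real \<Rightarrow> 'b::euclidean_space" and a :: "real \<Rightarrow> real"
  assumes "a absolutely_integrable_on {x..y}" "continuous_on {x..y} B"
  shows "(\<lambda>t. a t *\<^sub>R B t) absolutely_integrable_on {x..y}"
proof (rule absolutely_integrable_bounded_measurable_product[where h = "\<lambda>B a. a *\<^sub>R B"])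
  show "bilinear (\<lambda>B a. a *\<^sub>R B)"
    by (auto simp: bilinear_def algebra_simps intro!: linearI)
  show "B \<in> borel_measurable (lebesgue_on {x..y})"
    by (rule continuous_imp_measurable_on_sets_lebesgue) (use assms in auto)
  show "bounded (B ` {x..y})"
    by (intro compact_imp_bounded compact_continuous_image assms) auto
qed (use assms in auto)

lemma absolutely_integrable_continuous_scaleR:
  fixes b :: "real \<Rightarrow> 'b::euclidean_space" and A :: "real \<Rightarrow> real"
  assumes "continuous_on {x..y} A" "b absolutely_integrable_on {x..y}"
  shows "(\<lambda>t. A t *\<^sub>R b t) absolutely_integrable_on {x..y}"
proof (rule absolutely_integrable_bounded_measurable_product[where h = "\<lambda>A b. A *\<^sub>R b"])
  show "bilinear (\<lambda>A b. A *\<^sub>R b)"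
    by (auto simp: bilinear_def algebra_simps intro!: linearI)
  show "A \<in> borel_measurable (lebesgue_on {x..y})"
    by (rule continuous_imp_measurable_on_sets_lebesgue) (use assms in auto)
  show "bounded (A ` {x..y})"
    by (intro compact_imp_bounded compact_continuous_image assms) auto
qed (use assms in auto)

lemma locally_boundedD:
  assumes "locally_bounded a"
  obtains M where "M > 0" "\<And>t. \<bar>t\<bar> \<le> R \<Longrightarrow> norm (a t) \<le> M"
proof -
  obtain M where "\<And>t. \<bar>t\<bar> \<le> R \<Longrightarrow> norm (a t) \<le> M"
    using assms unfolding locally_bounded_def by blast
  then show ?thesis by (intro that[of "max M 1"]) (auto intro: max.coboundedI1)
qed

lemma has_primitive_lipschitz:
  assumes "has_primitive a A" "u \<le> v" "\<And>t. u \<le> t \<Longrightarrow> t \<le> v \<Longrightarrow> norm (a t) \<le> M"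
  shows "norm (A v - A u) \<le> M * (v - u)"
proof -
  have "norm (integral {u..v} a) \<le> integral {u..v} (\<lambda>_. M)"
    by (rule integral_norm_bound_integral) (use assms has_primitiveD in auto)
  then show ?thesis using assms(2) by (simp add: has_primitiveD[OF assms(1,2)] mult.commute)
qed

text \<open>
  The product rule. One of the two densities is locally bounded, so that its primitive is
  Lipschitz: the defect of the formula on a short interval is then the length of the interval
  times an oscillation of \<open>B\<close> or an integral of \<open>norm b\<close>, both of which tend to zero. The other
  density may be unbounded, as it is for a right-hand side that is merely square integrable.
\<close>

lemma has_primitive_scaleR:
  fixes A :: "real \<Rightarrow> real" and B :: "real \<Rightarrow> 'b::euclidean_space"
  assumes A: "has_primitive a A" and bd: "locally_bounded a" and B: "has_primitive b B"
  shows "has_primitive (\<lambda>t. a t *\<^sub>R B t + A t *\<^sub>R b t) (\<lambda>t. A t *\<^sub>R B t)"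
proof -
  note cA = has_primitive_continuous[OF A] and cB = has_primitive_continuous[OF B]
  let ?f = "\<lambda>t. a t *\<^sub>R B t + A t *\<^sub>R b t" and ?P = "\<lambda>t. A t *\<^sub>R B t"
  have aB: "(\<lambda>t. a t *\<^sub>R B t) absolutely_integrable_on {x..y}"
    and Ab: "(\<lambda>t. A t *\<^sub>R b t) absolutely_integrable_on {x..y}" if "x \<le> y" for x y
    using has_primitiveD[OF A that] has_primitiveD[OF B that] cA cB
    by (auto intro: absolutely_integrable_scaleR_continuous absolutely_integrable_continuous_scaleR)
  have abs: "?f absolutely_integrable_on {x..y}" if "x \<le> y" for x y
    by (intro set_integral_add aB Ab that)
  note int = abs[THEN absolutely_integrable_on_def[THEN iffD1, THEN conjunct1]]
  show ?thesis
  proof (rule has_primitiveI_local[OF abs])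
      fix z e :: real assume e: "e > 0"
      obtain M where M: "M > 0" "\<And>t. \<bar>t\<bar> \<le> \<bar>z\<bar> + 1 \<Longrightarrow> norm (a t) \<le> M"
        using locally_boundedD[OF bd] by blast
      let ?\<beta> = "\<lambda>t. norm (b t)"
      have nb: "?\<beta> integrable_on {u..v}" if "u \<le> v" for u v
        using has_primitiveD(1)[OF B that] by (simp add: absolutely_integrable_on_def)
      have "continuous_on {z-1..z+1} (\<lambda>t. integral {z-1..t} ?\<beta>)"
        by (rule indefinite_integral_continuous_1) (auto intro: nb)
      then have "isCont (\<lambda>t. integral {z-1..t} ?\<beta>) z"
        by (rule continuous_on_interior) auto
      then obtain d1 where d1: "d1 > 0" "\<And>t. \<bar>t - z\<bar> < d1 \<Longrightarrow>
           \<bar>integral {z-1..t} ?\<beta> - integral {z-1..z} ?\<beta>\<bar> < e / (4 * M)"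
        using e M(1) unfolding continuous_at_eps_delta
        by (auto simp: dist_real_def) (metis (no_types, lifting) divide_pos_pos mult_pos_pos zero_less_numeral)
      have "isCont B z"
        using cB[of UNIV] by (simp add: continuous_on_eq_continuous_at)
      then obtain d2 where d2: "d2 > 0" "\<And>t. \<bar>t - z\<bar> < d2 \<Longrightarrow> norm (B t - B z) < e / (4 * M)"
        using e M(1) unfolding continuous_at_eps_delta dist_norm real_norm_def
        by (metis (no_types, lifting) divide_pos_pos mult_pos_pos zero_less_numeral)
      define d where "d = min 1 (min d1 d2) / 2"
      have d: "d > 0" "d < 1" "d < d1" "d < d2" using d1(1) d2(1) by (auto simp: d_def)
      show "\<exists>d>0. \<forall>u v. z - d \<le> u \<and> u \<le> v \<and> v \<le> z + d \<longrightarrow> norm (?P v - ?P u - integral {u..v} ?f) \<le> e * (v - u)"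
      proof (intro exI[of _ d] conjI allI impI)
        fix u v assume "z - d \<le> u \<and> u \<le> v \<and> v \<le> z + d"
        then have uv: "z - d \<le> u" "u \<le> v" "v \<le> z + d" by auto
        have near: "\<bar>t - z\<bar> < d1" "\<bar>t - z\<bar> < d2" "\<bar>t\<bar> \<le> \<bar>z\<bar> + 1" if "u \<le> t" "t \<le> v" for t
          using that uv d by auto
        have \<beta>: "integral {u..v} ?\<beta> \<le> e / (2 * M)"
        proof -
          have "integral {u..v} ?\<beta> = integral {z-1..v} ?\<beta> - integral {z-1..u} ?\<beta>"
            using Henstock_Kurzweil_Integration.integral_combine[where f = ?\<beta> and a = "z-1" and c = u and b = v] nb[of "z-1" v] uv d by auto
          also have "\<dots> \<le> e / (4*M) + e / (4*M)"
            using d1(2)[of u] d1(2)[of v] near[of u] near[of v] uv by (auto simp: abs_le_iff)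
          finally show ?thesis by simp
        qed
        have osc: "norm (B u - B t) \<le> e / (2 * M)" if "u \<le> t" "t \<le> v" for t
        proof -
          have "norm (B u - B t) \<le> norm (B u - B z) + norm (B t - B z)"
            by (metis norm_triangle_ineq4 diff_diff_eq2 add_diff_cancel_right' diff_add_cancel)
          also have "\<dots> \<le> e / (4*M) + e / (4*M)"
            using d2(2)[of u] d2(2)[of t] near[of u] near[of t] uv that by auto
          finally show ?thesis by simp
        qed
        have Abi: "(\<lambda>t. (A v - A t) *\<^sub>R b t) integrable_on {u..v}"
          using absolutely_integrable_continuous_scaleR[OF _ has_primitiveD(1)[OF B uv(2)],
              OF continuous_on_diff[OF continuous_on_const cA]]
          by (auto simp: absolutely_integrable_on_def)
        have aBi: "(\<lambda>t. a t *\<^sub>R (B u - B t)) integrable_on {u..v}"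
          using absolutely_integrable_scaleR_continuous[OF has_primitiveD(1)[OF A uv(2)],
              OF continuous_on_diff[OF continuous_on_const cB]]
          by (auto simp: absolutely_integrable_on_def)
        \<comment> \<open>Write the increment of the product with \<open>B u\<close> and \<open>A v\<close> held fixed; the defect then consists of deviations only.\<close>
        have "?P v - ?P u - integral {u..v} ?f = integral {u..v} (\<lambda>t. a t *\<^sub>R (B u - B t)) + integral {u..v} (\<lambda>t. (A v - A t) *\<^sub>R b t)"
        proof -
          have "((\<lambda>t. a t *\<^sub>R B u + A v *\<^sub>R b t - ?f t) has_integral
             ((A v - A u) *\<^sub>R B u + A v *\<^sub>R (B v - B u) - integral {u..v} ?f)) {u..v}"
            by (intro has_integral_diff has_integral_add has_integral_scaleR_left has_integral_cmul
                has_primitiveD(4)[OF A uv(2)] has_primitiveD(4)[OF B uv(2)] integrable_integral int uv(2))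
          moreover have "((\<lambda>t. a t *\<^sub>R (B u - B t) + (A v - A t) *\<^sub>R b t) has_integral
            integral {u..v} (\<lambda>t. a t *\<^sub>R (B u - B t)) + integral {u..v} (\<lambda>t. (A v - A t) *\<^sub>R b t)) {u..v}"
            by (intro has_integral_add integrable_integral Abi aBi)
          moreover have "(\<lambda>t. a t *\<^sub>R B u + A v *\<^sub>R b t - ?f t) = (\<lambda>t. a t *\<^sub>R (B u - B t) + (A v - A t) *\<^sub>R b t)"
            by (auto simp: algebra_simps)
          ultimately have "(A v - A u) *\<^sub>R B u + A v *\<^sub>R (B v - B u) - integral {u..v} ?f =
            integral {u..v} (\<lambda>t. a t *\<^sub>R (B u - B t)) + integral {u..v} (\<lambda>t. (A v - A t) *\<^sub>R b t)"
            by (simp add: has_integral_unique)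
          then show ?thesis by (simp add: algebra_simps)
        qed
        also have "norm \<dots> \<le> (e / 2) * (v - u) + (e / 2) * (v - u)"
        proof (rule norm_triangle_mono)
          have "norm (integral {u..v} (\<lambda>t. a t *\<^sub>R (B u - B t))) \<le> integral {u..v} (\<lambda>t. M * (e / (2*M)))"
          proof (intro integral_norm_bound_integral aBi integrable_const_ivl)
            fix t assume t: "t \<in> {u..v}"
            show "norm (a t *\<^sub>R (B u - B t)) \<le> M * (e / (2*M))"
              unfolding norm_scaleR
              using osc[of t] M(2)[OF near(3)[of t]] t M(1) by (intro mult_mono) auto
          qed
          then show "norm (integral {u..v} (\<lambda>t. a t *\<^sub>R (B u - B t))) \<le> (e / 2) * (v - u)"
            using M(1) uv(2) by (simp add: mult.commute)
        next
          have "norm (integral {u..v} (\<lambda>t. (A v - A t) *\<^sub>R b t)) \<le> integral {u..v} (\<lambda>t. (M * (v - u)) * ?\<beta> t)"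
          proof (intro integral_norm_bound_integral Abi)
            show "(\<lambda>t. (M * (v - u)) * ?\<beta> t) integrable_on {u..v}"
              using integrable_on_cmult_left[OF nb[OF uv(2)], of "M * (v - u)"] by simp
            fix t assume t: "t \<in> {u..v}"
            have "\<bar>A v - A t\<bar> \<le> M * (v - t)"
              using has_primitive_lipschitz[OF A, of t v M] t near(3) M(2) by auto
            also have "\<dots> \<le> M * (v - u)" using t M(1) by auto
            finally show "norm ((A v - A t) *\<^sub>R b t) \<le> (M * (v - u)) * ?\<beta> t"
              by (auto intro!: mult_right_mono)
          qed
          also have "\<dots> = M * (v - u) * integral {u..v} ?\<beta>"
            by simp
          also have "\<dots> \<le> M * (v - u) * (e / (2 * M))"
            using \<beta> uv(2) M(1) by (intro mult_left_mono) auto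
          also have "\<dots> = (e / 2) * (v - u)"
            using M(1) by (simp add: field_simps)
          finally show "norm (integral {u..v} (\<lambda>t. (A v - A t) *\<^sub>R b t)) \<le> (e / 2) * (v - u)" .
        qed
        finally show "norm (?P v - ?P u - integral {u..v} ?f) \<le> e * (v - u)" by (simp add: field_simps)
      qed (fact d(1))
  qed
qed

lemma exp_second_order_bound:
  fixes x :: real
  assumes "\<bar>x\<bar> \<le> 1"
  shows "\<bar>exp x - 1 - x\<bar> \<le> x\<^sup>2"
proof -
  have "1 + x \<le> exp x" by (rule exp_ge_add_one_self)
  moreover have "exp x \<le> 1 + x + x\<^sup>2"
  proof (cases "x \<ge> 0")
    case True then show ?thesis using exp_bound assms by auto
  next
    case False
    have "exp x \<le> 1 / (1 - x)"
      using exp_ge_add_one_self[of "-x"] False by (simp add: exp_minus field_simps)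
    also have "\<dots> \<le> 1 + x + x\<^sup>2"
    proof -
      have "1 - x^3 \<ge> 1" using False by (simp add: power_le_zero_eq)
      then have "1 \<le> (1 + x + x\<^sup>2) * (1 - x)" by (simp add: algebra_simps power2_eq_square power3_eq_cube)
      then show ?thesis using False by (simp add: divide_le_eq)
    qed
    finally show ?thesis .
  qed
  ultimately show ?thesis unfolding abs_le_iff using zero_le_power2[of x] by linarith
qed

text \<open>
  The chain rule for \<open>exp\<close>. Since \<open>A\<close> is locally Lipschitz, the second-order remainder of \<open>exp\<close>
  is quadratic in the length of the interval.
\<close>

lemma has_primitive_exp:
  fixes A :: "real \<Rightarrow> real"
  assumes A: "has_primitive a A" and bd: "locally_bounded a"
  shows "has_primitive (\<lambda>t. a t * exp (A t)) (\<lambda>t. exp (A t))"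
proof -
  note cA = has_primitive_continuous[OF A]
  let ?f = "\<lambda>t. a t * exp (A t)" and ?P = "\<lambda>t. exp (A t)"
  have abs: "?f absolutely_integrable_on {x..y}" if "x \<le> y" for x y
    using absolutely_integrable_scaleR_continuous[OF has_primitiveD(1)[OF A that], of "\<lambda>t. exp (A t)"] cA
    by (auto intro!: continuous_intros)
  note int = abs[THEN absolutely_integrable_on_def[THEN iffD1, THEN conjunct1]]
  show ?thesis
  proof (rule has_primitiveI_local[OF abs])
      fix z e :: real assume e: "e > 0"
      obtain M where M: "M > 0" "\<And>t. \<bar>t\<bar> \<le> \<bar>z\<bar> + 1 \<Longrightarrow> norm (a t) \<le> M"
        using locally_boundedD[OF bd] by blast
      have "bounded ((\<lambda>t. exp (A t)) ` {z-1..z+1})"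
        using cA by (intro compact_imp_bounded compact_continuous_image continuous_intros) auto
      then obtain K where K: "K > 0" "\<And>t. t \<in> {z-1..z+1} \<Longrightarrow> exp (A t) \<le> K"
        unfolding bounded_pos by auto
      \<comment> \<open>Intervals within \<open>d\<close> of \<open>z\<close> have length at most \<open>2 * d\<close>, so \<open>\<bar>A v - A u\<bar> \<le> 1\<close> and \<open>3 * K * M\<^sup>2 * (v - u) \<le> e\<close> there.\<close>
      define d where "d = min (1/2) (min (1 / (2*M)) (e / (6 * K * M\<^sup>2)))"
      have d: "d > 0" "d \<le> 1/2" using M(1) K(1) e by (auto simp: d_def)
      have "d \<le> 1 / (2*M)" by (simp add: d_def)
      then have d3: "d * (2*M) \<le> 1" using M(1) by (simp add: pos_le_divide_eq)
      have "d \<le> e / (6 * K * M\<^sup>2)" by (simp add: d_def)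
      then have d4: "d * (6 * K * M\<^sup>2) \<le> e" using M(1) K(1) by (simp add: pos_le_divide_eq)
      show "\<exists>d>0. \<forall>u v. z - d \<le> u \<and> u \<le> v \<and> v \<le> z + d \<longrightarrow> norm (?P v - ?P u - integral {u..v} ?f) \<le> e * (v - u)"
      proof (intro exI[of _ d] conjI allI impI)
        fix u v assume "z - d \<le> u \<and> u \<le> v \<and> v \<le> z + d"
        then have uv: "z - d \<le> u" "u \<le> v" "v \<le> z + d" by auto
        define h where "h = v - u"
        have h: "0 \<le> h" "h \<le> 2 * d" using uv by (auto simp: h_def)
        have near: "\<bar>t\<bar> \<le> \<bar>z\<bar> + 1" "t \<in> {z-1..z+1}" if "u \<le> t" "t \<le> v" for t
          using that uv d by auto
        have const: "integral {u..v} (\<lambda>t. c) = c * (v - u)" for c :: real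
          using uv(2) by (simp add: mult.commute)
        have Ku: "exp (A u) \<le> K" using K(2)[of u] near[of u] uv by auto
        have lip: "\<bar>A t - A u\<bar> \<le> M * h" if "u \<le> t" "t \<le> v" for t
        proof -
          have "norm (A t - A u) \<le> M * (t - u)"
            by (rule has_primitive_lipschitz[OF A that(1)]) (use that near(1) M(2) in auto)
          also have "\<dots> \<le> M * h" using that M(1) by (auto simp: h_def)
          finally show ?thesis by simp
        qed
        have "M * h \<le> M * (2 * d)" using h(2) M(1) by (intro mult_left_mono) auto
        also have "\<dots> = d * (2 * M)" by simp
        finally have Mh: "M * h \<le> 1" using d3 by linarith
        have rem: "\<bar>exp (A t) - exp (A u) - (A t - A u) * exp (A u)\<bar> \<le> K * (M * h)\<^sup>2" if "u \<le> t" "t \<le> v" for t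
        proof -
          have l1: "\<bar>A t - A u\<bar> \<le> 1" using lip[OF that] Mh by linarith
          have eq: "exp (A t) - exp (A u) - (A t - A u) * exp (A u)
              = exp (A u) * (exp (A t - A u) - 1 - (A t - A u))"
            by (simp add: algebra_simps flip: exp_add)
          show ?thesis
            unfolding eq abs_mult
            using exp_second_order_bound[OF l1] Ku power_mono[OF lip[OF that], of 2] M(1) K(1)
            by (intro mult_mono) auto
        qed
        have osc: "\<bar>exp (A u) - exp (A t)\<bar> \<le> 2 * (K * (M * h))" if "u \<le> t" "t \<le> v" for t
        proof -
          have "\<bar>exp (A u) - exp (A t)\<bar> \<le> \<bar>A t - A u\<bar> * exp (A u) + K * (M * h)\<^sup>2"
            using rem[OF that] abs_mult[of "A t - A u" "exp (A u)"] unfolding abs_exp_cancel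
            by linarith
          also have "\<dots> \<le> (M * h) * K + K * ((M * h) * 1)"
            unfolding power2_eq_square using lip[OF that] Ku Mh M(1) h(1) K(1)
            by (intro add_mono mult_mono mult_left_mono) auto
          finally show ?thesis by (simp add: algebra_simps)
        qed
        have aBi: "(\<lambda>t. a t * (exp (A u) - exp (A t))) integrable_on {u..v}"
          using absolutely_integrable_scaleR_continuous[OF has_primitiveD(1)[OF A uv(2)],
              OF continuous_on_diff[OF continuous_on_const continuous_on_exp[OF cA]]]
          by (auto simp: absolutely_integrable_on_def)
        have "?P v - ?P u - integral {u..v} ?f = (exp (A v) - exp (A u) - (A v - A u) * exp (A u))
            + integral {u..v} (\<lambda>t. a t * (exp (A u) - exp (A t)))"
        proof -
          have "((\<lambda>t. a t * exp (A u) - ?f t) has_integral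
             ((A v - A u) * exp (A u) - integral {u..v} ?f)) {u..v}"
            by (intro has_integral_diff has_integral_mult_left
                has_primitiveD(4)[OF A uv(2)] integrable_integral int uv(2))
          moreover have "((\<lambda>t. a t * (exp (A u) - exp (A t))) has_integral
             integral {u..v} (\<lambda>t. a t * (exp (A u) - exp (A t)))) {u..v}"
            by (intro integrable_integral aBi)
          moreover have "(\<lambda>t. a t * exp (A u) - ?f t) = (\<lambda>t. a t * (exp (A u) - exp (A t)))"
            by (auto simp: algebra_simps)
          ultimately have "(A v - A u) * exp (A u) - integral {u..v} ?f = integral {u..v} (\<lambda>t. a t * (exp (A u) - exp (A t)))"
            by (simp add: has_integral_unique)
          then show ?thesis
            by simp
        qed
        also have "norm \<dots> \<le> K * (M * h)\<^sup>2 + M * (2 * (K * (M * h))) * h"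
        proof (rule norm_triangle_mono)
          show "norm (exp (A v) - exp (A u) - (A v - A u) * exp (A u)) \<le> K * (M * h)\<^sup>2"
            using rem[of v] uv by auto
          have "norm (integral {u..v} (\<lambda>t. a t * (exp (A u) - exp (A t)))) \<le> integral {u..v} (\<lambda>t. M * (2 * (K * (M * h))))"
          proof (intro integral_norm_bound_integral aBi integrable_const_ivl)
            fix t assume t: "t \<in> {u..v}"
            show "norm (a t * (exp (A u) - exp (A t))) \<le> M * (2 * (K * (M * h)))"
              unfolding norm_mult
              using osc[of t] M(2)[OF near(1)[of t]] t M(1) by (intro mult_mono) auto
          qed
          then show "norm (integral {u..v} (\<lambda>t. a t * (exp (A u) - exp (A t)))) \<le> M * (2 * (K * (M * h))) * h"
            using uv(2) unfolding h_def by (simp only: const)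
        qed
        also have "\<dots> = (3 * K * M\<^sup>2 * h) * h" by (simp add: power2_eq_square algebra_simps)
        also have "\<dots> \<le> e * h"
        proof (rule mult_right_mono)
          have "3 * K * M\<^sup>2 * h \<le> 3 * K * M\<^sup>2 * (2 * d)" using h K(1) by (intro mult_left_mono) auto
          then show "3 * K * M\<^sup>2 * h \<le> e" using d4 by (simp add: algebra_simps)
        qed (fact h(1))
        finally show "norm (?P v - ?P u - integral {u..v} ?f) \<le> e * (v - u)" by (simp add: h_def)
      qed (fact d(1))
  qed
qed

section \<open>Test functions and the lemma of du Bois-Reymond\<close>

definition locally_integrable :: "(real \<Rightarrow> 'b::euclidean_space) \<Rightarrow> bool" where
  "locally_integrable f \<longleftrightarrow> (\<forall>x y. f absolutely_integrable_on {x..y})"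

definition indefinite_integral :: "(real \<Rightarrow> 'b::euclidean_space) \<Rightarrow> real \<Rightarrow> 'b" where
  "indefinite_integral f x = integral {0..x} f - integral {x..0} f"

lemma has_primitive_indefinite_integral:
  assumes "locally_integrable f"
  shows "has_primitive f (indefinite_integral f)"
  unfolding has_primitive_def
proof (intro allI impI conjI)
  fix x y :: real assume xy: "x \<le> y"
  show "f absolutely_integrable_on {x..y}" using assms by (simp add: locally_integrable_def)
  have int: "f integrable_on {a..b}" for a b
    using assms by (auto simp: locally_integrable_def absolutely_integrable_on_def)
  have comb: "integral {a..b} f + integral {b..c} f = integral {a..c} f" if "a \<le> b" "b \<le> c" for a b c
    using that int by (intro Henstock_Kurzweil_Integration.integral_combine)
  consider "0 \<le> x" | "x < 0" "0 \<le> y" | "y < 0" by linarith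
  then show "indefinite_integral f y - indefinite_integral f x = integral {x..y} f"
  proof cases
    case 1 then show ?thesis using comb[of 0 x y] xy
      by (cases "x = 0"; cases "y = 0") (auto simp: indefinite_integral_def algebra_simps)
  next
    case 2 then show ?thesis using comb[of x 0 y] xy
      by (cases "y = 0") (auto simp: indefinite_integral_def algebra_simps)
  next
    case 3 then show ?thesis using comb[of x y 0] xy
      by (auto simp: indefinite_integral_def algebra_simps)
  qed
qed

lemma has_primitive_locally_integrable: "has_primitive a A \<Longrightarrow> locally_integrable a"
  unfolding locally_integrable_def
proof (intro allI)
  fix x y :: real assume "has_primitive a A"
  then show "a absolutely_integrable_on {x..y}"
    by (cases "x \<le> y") (auto dest: has_primitiveD(1))
qed

lemma has_primitive_shift:
  "has_primitive a A \<Longrightarrow> has_primitive a (\<lambda>x. c + A x)"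
  by (simp add: has_primitive_def)

text \<open>
  Peeling off the derivatives from the inside makes the closure properties below simple
  inductions on the order.
\<close>

primrec differentiable_times :: "nat \<Rightarrow> (real \<Rightarrow> real) \<Rightarrow> bool" where
  "differentiable_times 0 f = True"
| "differentiable_times (Suc n) f = ((\<forall>x. f differentiable at x) \<and> differentiable_times n (deriv f))"

lemma differentiable_times_iff:
  "differentiable_times n f \<longleftrightarrow> (\<forall>k<n. \<forall>x. (deriv ^^ k) f differentiable at x)"
proof (induction n arbitrary: f)
  case (Suc n)
  have "(\<forall>k<Suc n. \<forall>x. (deriv ^^ k) f differentiable at x) \<longleftrightarrow>
     (\<forall>x. f differentiable at x) \<and> (\<forall>k<n. \<forall>x. (deriv ^^ Suc k) f differentiable at x)"
    by (subst All_less_Suc2) simp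
  then show ?case by (simp add: Suc funpow_Suc_right del: funpow.simps)
qed simp

lemma test_function_iff:
  "test_function \<phi> \<longleftrightarrow> (\<forall>n. differentiable_times n \<phi>) \<and> (\<exists>R. \<forall>x. \<bar>x\<bar> \<ge> R \<longrightarrow> \<phi> x = 0)"
proof -
  have 1: "(\<forall>n x. (deriv ^^ n) \<phi> differentiable at x) \<longleftrightarrow> (\<forall>n. differentiable_times n \<phi>)"
    unfolding differentiable_times_iff by blast
  have 2: "(\<exists>K. compact K \<and> (\<forall>x. x \<notin> K \<longrightarrow> \<phi> x = 0)) \<longleftrightarrow> (\<exists>R. \<forall>x. \<bar>x\<bar> \<ge> R \<longrightarrow> \<phi> x = 0)"
  proof safe
    fix K assume K: "compact K" "\<forall>x. x \<notin> K \<longrightarrow> \<phi> x = 0"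
    then obtain B where "\<And>x. x \<in> K \<Longrightarrow> \<bar>x\<bar> \<le> B"
      using compact_imp_bounded[OF K(1)] unfolding bounded_iff by auto
    then show "\<exists>R. \<forall>x. \<bar>x\<bar> \<ge> R \<longrightarrow> \<phi> x = 0"
      using K by (intro exI[of _ "B + 1"]) force
  next
    fix R :: real assume R: "\<forall>x. \<bar>x\<bar> \<ge> R \<longrightarrow> \<phi> x = 0"
    show "\<exists>K. compact K \<and> (\<forall>x. x \<notin> K \<longrightarrow> \<phi> x = 0)"
      using R by (intro exI[of _ "{-R..R}"]) (auto simp: abs_le_iff not_le)
  qed
  show ?thesis unfolding test_function_def 1 2 ..
qed

lemma differentiable_times_pred: "differentiable_times (Suc n) f \<Longrightarrow> differentiable_times n f"
  unfolding differentiable_times_iff by auto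

lemma DERIV_deriv_of_differentiable: "f differentiable at x \<Longrightarrow> DERIV f x :> deriv f x" for f :: "real \<Rightarrow> real"
  by (metis DERIV_imp_deriv real_differentiableE)

lemma differentiable_times_add:
  "differentiable_times n f \<Longrightarrow> differentiable_times n g \<Longrightarrow> differentiable_times n (\<lambda>x. f x + g x)"
proof (induction n arbitrary: f g)
  case (Suc n)
  have "deriv (\<lambda>x. f x + g x) = (\<lambda>x. deriv f x + deriv g x)"
    using Suc.prems by (intro ext DERIV_imp_deriv) (auto intro!: derivative_intros DERIV_deriv_of_differentiable)
  then show ?case using Suc by auto
qed simp

lemma differentiable_times_mult:
  "differentiable_times n f \<Longrightarrow> differentiable_times n g \<Longrightarrow> differentiable_times n (\<lambda>x. f x * g x)"
proof (induction n arbitrary: f g)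
  case (Suc n)
  have "deriv (\<lambda>x. f x * g x) = (\<lambda>x. deriv f x * g x + deriv g x * f x)"
    using Suc.prems by (intro ext DERIV_imp_deriv) (auto intro!: DERIV_mult DERIV_deriv_of_differentiable)
  then show ?case using Suc differentiable_times_pred[OF Suc.prems(1)] differentiable_times_pred[OF Suc.prems(2)]
    by (auto intro!: differentiable_times_add)
qed simp

lemma differentiable_times_const: "differentiable_times n (\<lambda>x. c)"
proof (induction n arbitrary: c)
  case (Suc n)
  have "deriv (\<lambda>x. c) = (\<lambda>x. 0)" by (intro ext DERIV_imp_deriv) auto
  then show ?case using Suc by auto
qed simp

lemma differentiable_times_affine:
  "differentiable_times n f \<Longrightarrow> differentiable_times n (\<lambda>x. f (a * x + b))"
proof (induction n arbitrary: f)
  case (Suc n)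
  have D: "DERIV (\<lambda>x. f (a * x + b)) x :> deriv f (a * x + b) * a" for x
    using Suc.prems by (intro DERIV_chain2[where g = "\<lambda>x. a * x + b"])
       (auto intro!: derivative_eq_intros DERIV_deriv_of_differentiable)
  then have "deriv (\<lambda>x. f (a * x + b)) = (\<lambda>x. deriv f (a * x + b) * a)"
    by (intro ext DERIV_imp_deriv)
  then show ?case using Suc D
    by (auto intro!: differentiable_times_mult differentiable_times_const simp: real_differentiable_def)
qed simp

text \<open>
  The family is closed under differentiation, which makes its members smooth, in particular at
  \<open>0\<close>.
\<close>

definition flat_exp :: "real poly \<Rightarrow> real \<Rightarrow> real" where
  "flat_exp p x = (if x > 0 then poly p (1 / x) * exp (- 1 / x) else 0)"

lemma poly_times_exp_minus_tendsto_0: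
  fixes p :: "real poly"
  shows "((\<lambda>y. poly p y * exp (- y)) \<longlongrightarrow> 0) at_top"
proof -
  have "((\<lambda>y. \<Sum>i\<le>degree p. coeff p i * (y ^ i / exp y)) \<longlongrightarrow> (\<Sum>i\<le>degree p. coeff p i * 0)) at_top"
    by (intro tendsto_sum tendsto_mult tendsto_const tendsto_power_div_exp_0)
  moreover have "poly p y * exp (- y) = (\<Sum>i\<le>degree p. coeff p i * (y ^ i / exp y))" for y
    by (simp add: poly_altdef sum_distrib_right exp_minus divide_inverse mult.assoc)
  ultimately show ?thesis by simp
qed

text \<open>
  With \<open>y = 1 / x\<close> the derivative of \<open>p y * exp (- y)\<close> with respect to \<open>x\<close> is
  \<open>y\<^sup>2 * (p y - p' y) * exp (- y)\<close>.
\<close>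

lemma DERIV_flat_exp: "DERIV (flat_exp p) x :> flat_exp ([:0,0,1:] * (p - pderiv p)) x"
proof -
  consider "x > 0" | "x < 0" | "x = 0" by linarith
  then show ?thesis
  proof cases
    case 1
    have "DERIV (\<lambda>x. poly p (1 / x) * exp (- 1 / x)) x :> flat_exp ([:0,0,1:] * (p - pderiv p)) x"
      using 1 by (auto simp: flat_exp_def power2_eq_square field_simps
          intro!: derivative_eq_intros DERIV_chain2[OF poly_DERIV])
    moreover have "\<forall>\<^sub>F y in nhds x. flat_exp p y = poly p (1 / y) * exp (- 1 / y)"
      using eventually_nhds_in_open[of "{0<..}" x] 1 by (auto elim!: eventually_mono simp: flat_exp_def)
    ultimately show ?thesis by (subst DERIV_cong_ev[OF refl _ refl]) auto
  next
    case 2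
    have "\<forall>\<^sub>F y in nhds x. flat_exp p y = 0"
      using eventually_nhds_in_open[of "{..<0}" x] 2 by (auto elim!: eventually_mono simp: flat_exp_def)
    then show ?thesis using 2 by (subst DERIV_cong_ev[OF refl _ refl]) (auto simp: flat_exp_def)
  next
    case 3
    have "((\<lambda>h. flat_exp p h / h) \<longlongrightarrow> 0) (at 0)"
    proof (rule filterlim_split_at)
      have "((\<lambda>y. poly (pCons 0 p) y * exp (- y)) \<longlongrightarrow> 0) at_top"
        by (rule poly_times_exp_minus_tendsto_0)
      from filterlim_compose[OF this filterlim_inverse_at_top_right]
      have "((\<lambda>h. poly (pCons 0 p) (inverse h) * exp (- inverse h)) \<longlongrightarrow> 0) (at_right 0)" .
      moreover have "\<forall>\<^sub>F h in at_right 0. poly (pCons 0 p) (inverse h) * exp (- inverse h) = flat_exp p h / h"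
        unfolding eventually_at_right_field by (intro exI[of _ 1]) (auto simp: flat_exp_def field_simps)
      ultimately show "((\<lambda>h. flat_exp p h / h) \<longlongrightarrow> 0) (at_right 0)"
        by (rule Lim_transform_eventually)
      have "\<forall>\<^sub>F h in at_left 0. 0 = flat_exp p h / h"
        unfolding eventually_at_left_field by (intro exI[of _ "-1"]) (auto simp: flat_exp_def)
      then show "((\<lambda>h. flat_exp p h / h) \<longlongrightarrow> 0) (at_left 0)"
        by (rule Lim_transform_eventually[OF tendsto_const])
    qed
    then show ?thesis using 3 by (simp add: DERIV_def flat_exp_def)
  qed
qed

lemma differentiable_times_flat_exp: "differentiable_times n (flat_exp p)"
proof (induction n arbitrary: p)
  case (Suc n)
  have "deriv (flat_exp p) = flat_exp ([:0,0,1:] * (p - pderiv p))"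
    by (intro ext DERIV_imp_deriv DERIV_flat_exp)
  then show ?case using Suc DERIV_flat_exp by (auto simp: real_differentiable_def)
qed simp

text \<open>
  The arguments are written as affine functions of \<open>x\<close>, for which smoothness is inherited; they
  are \<open>n * (x - a)\<close> and \<open>n * (b - x)\<close>.
\<close>

definition bump :: "real \<Rightarrow> real \<Rightarrow> nat \<Rightarrow> real \<Rightarrow> real" where
  "bump a b n x = flat_exp 1 (real n * x + - real n * a) * flat_exp 1 (- real n * x + real n * b)"

lemma flat_exp_1_bounds: "0 \<le> flat_exp 1 x" "flat_exp 1 x \<le> 1"
  by (auto simp: flat_exp_def)

lemma bump_bounds: "0 \<le> bump a b n x" "bump a b n x \<le> 1"
  unfolding bump_def by (auto intro!: mult_nonneg_nonneg mult_le_one flat_exp_1_bounds)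

lemma bump_eq_0: "x \<notin> {a<..<b} \<Longrightarrow> bump a b n x = 0"
proof -
  assume "x \<notin> {a<..<b}"
  then have "real n * (x - a) \<le> 0 \<or> real n * (b - x) \<le> 0"
    by (auto simp: mult_le_0_iff)
  then show ?thesis by (auto simp: bump_def flat_exp_def algebra_simps)
qed

lemma test_function_bump: "test_function (bump a b n)"
  unfolding test_function_iff
proof (intro conjI allI exI[of _ "max \<bar>a\<bar> \<bar>b\<bar>"] impI)
  show "differentiable_times k (bump a b n)" for k
    unfolding bump_def[abs_def]
    by (intro differentiable_times_mult differentiable_times_affine differentiable_times_flat_exp)
qed (auto intro!: bump_eq_0)

text \<open>
  For \<open>d > 0\<close> the value of \<open>flat_exp 1\<close> at \<open>n * d\<close> is \<open>exp (- 1 / (n * d))\<close>, which tends to \<open>1\<close>.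
  Smooth functions thus reach indicator functions of intervals without any normalisation.
\<close>

lemma bump_tendsto_indicator: "(\<lambda>n. bump a b n x) \<longlonglongrightarrow> indicator {a<..<b} x"
proof (cases "x \<in> {a<..<b}")
  case True
  have *: "(\<lambda>n. flat_exp 1 (real n * d)) \<longlonglongrightarrow> 1" if "d > 0" for d
  proof -
    have "(\<lambda>n. exp (- (1 / d) * inverse (real n))) \<longlonglongrightarrow> exp (- (1 / d) * 0)"
      by (intro tendsto_intros lim_inverse_n)
    moreover have "\<forall>\<^sub>F n in sequentially. exp (- (1 / d) * inverse (real n)) = flat_exp 1 (real n * d)"
      using eventually_gt_at_top[of 0] by eventually_elim (auto simp: flat_exp_def that field_simps)
    ultimately show ?thesis by (auto intro: Lim_transform_eventually)
  qed
  have "(\<lambda>n. flat_exp 1 (real n * (x - a)) * flat_exp 1 (real n * (b - x))) \<longlonglongrightarrow> 1 * 1"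
    using True by (intro tendsto_mult *) auto
  then show ?thesis using True by (simp add: bump_def algebra_simps)
qed (simp add: bump_eq_0)

lemma test_functionD:
  assumes "test_function \<phi>"
  obtains R where "R > 0" "\<And>x. \<bar>x\<bar> \<ge> R \<Longrightarrow> \<phi> x = 0" "\<And>x. \<bar>x\<bar> \<ge> R \<Longrightarrow> deriv \<phi> x = 0"
proof -
  obtain R where R: "\<And>x. \<bar>x\<bar> \<ge> R \<Longrightarrow> \<phi> x = 0"
    using assms test_function_iff by metis
  have d: "deriv \<phi> x = 0" if "\<bar>x\<bar> > R" for x
  proof (rule DERIV_imp_deriv)
    have "\<forall>\<^sub>F y in nhds x. \<phi> y = 0"
    proof (rule eventually_mono)
      have "open {y::real. \<bar>y\<bar> > R}" by (intro open_Collect_less continuous_intros)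
      from eventually_nhds_in_open[OF this, of x] that
      show "\<forall>\<^sub>F y in nhds x. y \<in> {y. \<bar>y\<bar> > R}" by simp
    qed (use R in auto)
    then show "DERIV \<phi> x :> 0" by (subst DERIV_cong_ev[OF refl _ refl]) auto
  qed
  show ?thesis by (rule that[of "max 1 (R + 1)"]) (auto intro!: R d)
qed

lemma test_function_DERIV: "test_function \<phi> \<Longrightarrow> DERIV \<phi> x :> deriv \<phi> x"
  using DERIV_deriv_of_differentiable[of \<phi> x] unfolding test_function_def
  by (metis funpow_0)

lemma test_function_deriv: "test_function \<phi> \<Longrightarrow> test_function (deriv \<phi>)"
proof -
  assume \<phi>: "test_function \<phi>"
  obtain R where "\<And>x. \<bar>x\<bar> \<ge> R \<Longrightarrow> deriv \<phi> x = 0" using test_functionD[OF \<phi>] by metis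
  moreover have "differentiable_times n (deriv \<phi>)" for n
    using \<phi> unfolding test_function_iff by (metis differentiable_times.simps(2))
  ultimately show ?thesis unfolding test_function_iff by blast
qed

lemma test_function_continuous: "test_function \<phi> \<Longrightarrow> continuous_on S \<phi>"
  by (meson DERIV_continuous_on has_field_derivative_at_within test_function_DERIV)

lemma test_function_locally_bounded:
  assumes "test_function \<phi>" shows "locally_bounded \<phi>"
  unfolding locally_bounded_def
proof
  fix R :: real
  have "bounded (\<phi> ` {-R..R})"
    using assms by (intro compact_imp_bounded compact_continuous_image test_function_continuous) auto
  then show "\<exists>M. \<forall>x. \<bar>x\<bar> \<le> R \<longrightarrow> norm (\<phi> x) \<le> M"
    unfolding bounded_iff by (metis abs_le_iff atLeastAtMost_iff image_eqI minus_le_iff)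
qed

lemma has_primitive_of_DERIV:
  fixes f :: "real \<Rightarrow> real"
  assumes "\<And>x. DERIV f x :> f' x" "continuous_on UNIV f'"
  shows "has_primitive f' f"
  unfolding has_primitive_def
proof (intro allI impI conjI)
  fix x y :: real assume "x \<le> y"
  have "(f' has_integral f y - f x) {x..y}"
    using assms \<open>x \<le> y\<close>
    by (intro fundamental_theorem_of_calculus)
       (auto simp: has_real_derivative_iff_has_vector_derivative[symmetric] intro: has_field_derivative_at_within)
  then show "f y - f x = integral {x..y} f'" by (simp add: integral_unique)
  show "f' absolutely_integrable_on {x..y}"
    using assms(2) by (metis absolutely_integrable_continuous_real continuous_on_subset top_greatest)
qed

lemma test_function_has_primitive: "test_function \<phi> \<Longrightarrow> has_primitive (deriv \<phi>) \<phi>"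
  by (intro has_primitive_of_DERIV test_function_DERIV test_function_continuous test_function_deriv)

lemma lebesgue_integral_compact_support:
  fixes f :: "real \<Rightarrow> 'b::euclidean_space"
  assumes "f absolutely_integrable_on {a..b}" "\<And>x. x \<notin> {a..b} \<Longrightarrow> f x = 0"
  shows "integrable lebesgue f" "(\<integral>x. f x \<partial>lebesgue) = integral {a..b} f"
proof -
  have eq: "(\<lambda>x. indicator {a..b} x *\<^sub>R f x) = f"
    using assms(2) by (auto simp: indicator_def fun_eq_iff)
  show "integrable lebesgue f"
    using assms(1) by (simp add: set_integrable_def eq)
  show "(\<integral>x. f x \<partial>lebesgue) = integral {a..b} f"
    using set_lebesgue_integral_eq_integral(2)[OF assms(1)] by (simp add: set_lebesgue_integral_def eq)
qed

lemma test_function_integrable: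
  assumes \<phi>: "test_function \<phi>" and f: "locally_integrable (f :: real \<Rightarrow> 'b::euclidean_space)"
  shows "integrable lebesgue (\<lambda>x. \<phi> x *\<^sub>R f x)"
proof -
  obtain R where R: "\<And>x. \<bar>x\<bar> \<ge> R \<Longrightarrow> \<phi> x = 0" using test_functionD[OF \<phi>] by metis
  show ?thesis
    by (rule lebesgue_integral_compact_support[where a = "-R" and b = R])
       (use f R in \<open>auto simp: locally_integrable_def abs_le_iff not_le
          intro!: absolutely_integrable_continuous_scaleR test_function_continuous[OF \<phi>]\<close>)
qed

lemma test_function_integration_by_parts:
  fixes B :: "real \<Rightarrow> 'b::euclidean_space"
  assumes \<phi>: "test_function \<phi>" and B: "has_primitive b B"
  shows "(\<integral>x. deriv \<phi> x *\<^sub>R B x \<partial>lebesgue) = - (\<integral>x. \<phi> x *\<^sub>R b x \<partial>lebesgue)"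
proof -
  obtain R where R: "R > 0" "\<And>x. \<bar>x\<bar> \<ge> R \<Longrightarrow> \<phi> x = 0" "\<And>x. \<bar>x\<bar> \<ge> R \<Longrightarrow> deriv \<phi> x = 0"
    using test_functionD[OF \<phi>] by metis
  let ?f = "\<lambda>t. deriv \<phi> t *\<^sub>R B t + \<phi> t *\<^sub>R b t"
  have prim: "has_primitive ?f (\<lambda>t. \<phi> t *\<^sub>R B t)"
    by (intro has_primitive_scaleR test_function_has_primitive \<phi> B test_function_locally_bounded test_function_deriv)
  have "locally_integrable B"
    unfolding locally_integrable_def
    using has_primitive_continuous[OF B] absolutely_integrable_continuous_real by blast
  then have i1: "integrable lebesgue (\<lambda>t. deriv \<phi> t *\<^sub>R B t)"
    by (intro test_function_integrable test_function_deriv \<phi>)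
  have i2: "integrable lebesgue (\<lambda>t. \<phi> t *\<^sub>R b t)"
    by (intro test_function_integrable \<phi> has_primitive_locally_integrable[OF B])
  have "(\<integral>t. ?f t \<partial>lebesgue) = integral {-R..R} ?f"
    using R has_primitiveD(1)[OF prim, of "-R" R]
    by (intro lebesgue_integral_compact_support) (auto simp: abs_le_iff not_le)
  also have "\<dots> = 0"
    using has_primitiveD(3)[OF prim, of "-R" R] R by simp
  finally show ?thesis
    using Bochner_Integration.integral_add[OF i1 i2] by (simp add: eq_neg_iff_add_eq_0)
qed

text \<open>
  The bumps show that the integral over every interval vanishes, and almost every point is a
  limit of means over intervals.
\<close>

lemma AE_0_if_test_integrals_0:
  fixes f :: "real \<Rightarrow> 'b::euclidean_space"
  assumes f: "locally_integrable f"
    and 0: "\<And>\<psi>. test_function \<psi> \<Longrightarrow> (\<integral>x. \<psi> x *\<^sub>R f x \<partial>lebesgue) = 0"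
  shows "AE x in lebesgue. f x = 0"
proof -
  have z: "integral {a..b} f = 0" for a b
  proof -
    have abs: "f absolutely_integrable_on {a..b}" using f by (simp add: locally_integrable_def)
    have abs': "f absolutely_integrable_on {a<..<b}"
      by (rule set_integrable_subset[OF abs]) auto
    have "(\<lambda>n. \<integral>x. bump a b n x *\<^sub>R f x \<partial>lebesgue) \<longlonglongrightarrow> (\<integral>x. indicator {a<..<b} x *\<^sub>R f x \<partial>lebesgue)"
    proof (rule integral_dominated_convergence[where w = "\<lambda>x. norm (indicator {a..b} x *\<^sub>R f x)"])
      show "(\<lambda>x. indicator {a<..<b} x *\<^sub>R f x) \<in> borel_measurable lebesgue"
        using abs' by (auto simp: set_integrable_def)
      show "(\<lambda>x. bump a b n x *\<^sub>R f x) \<in> borel_measurable lebesgue" for n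
        by (rule borel_measurable_integrable[OF test_function_integrable[OF test_function_bump f]])
      show "integrable lebesgue (\<lambda>x. norm (indicator {a..b} x *\<^sub>R f x))"
        using abs unfolding set_integrable_def by (rule integrable_norm)
      show "AE x in lebesgue. norm (bump a b n x *\<^sub>R f x) \<le> norm (indicator {a..b} x *\<^sub>R f x)" for n
      proof (rule AE_I2)
        fix x
        show "norm (bump a b n x *\<^sub>R f x) \<le> norm (indicator {a..b} x *\<^sub>R f x)"
          using bump_eq_0[of x a b n] bump_bounds[of a b n x]
          by (cases "x \<in> {a<..<b}") (auto intro: mult_left_le_one_le)
      qed
    qed (auto intro!: tendsto_scaleR bump_tendsto_indicator)
    then have "(\<integral>x. indicator {a<..<b} x *\<^sub>R f x \<partial>lebesgue) = 0"
      by (simp add: 0[OF test_function_bump] LIMSEQ_const_iff)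
    then have "integral {a<..<b} f = 0"
      using set_lebesgue_integral_eq_integral(2)[OF abs'] by (simp add: set_lebesgue_integral_def)
    then show ?thesis by (simp add: integral_open_interval_real)
  qed
  have "\<And>a b. f integrable_on cbox a b"
    using f by (auto simp: locally_integrable_def absolutely_integrable_on_def)
  then obtain N where N: "negligible N" "\<And>x e. \<lbrakk>x \<notin> N; 0 < e\<rbrakk> \<Longrightarrow>
               \<exists>d>0. \<forall>h. 0 < h \<and> h < d \<longrightarrow>
                         norm(integral (cbox x (x + h *\<^sub>R One)) f /\<^sub>R h ^ DIM(real) - f x) < e"
    using integrable_ccontinuous_explicit by blast
  have "f x = 0" if xN: "x \<notin> N" for x
  proof (rule ccontr)
    assume "f x \<noteq> 0"
    then obtain d where d: "d > 0" "\<forall>h. 0 < h \<and> h < d \<longrightarrow>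
                         norm(integral (cbox x (x + h *\<^sub>R One)) f /\<^sub>R h ^ DIM(real) - f x) < norm (f x)"
      using N(2)[OF xN, of "norm (f x)"] by (metis zero_less_norm_iff)
    then show False using d(2)[rule_format, of "d/2"] by (auto simp: z)
  qed
  then show ?thesis
    using N(1) by (intro AE_I'[of N]) (auto simp: negligible_iff_null_sets)
qed

text \<open>
  The vanishing total integral is what makes the primitive vanish to the right of the support.
\<close>

lemma test_function_primitive:
  assumes \<psi>: "test_function \<psi>" and 0: "(\<integral>x. \<psi> x \<partial>lebesgue) = 0"
  obtains \<phi> where "test_function \<phi>" "deriv \<phi> = \<psi>"
proof -
  have li: "locally_integrable \<psi>"
    unfolding locally_integrable_def
    using test_function_continuous[OF \<psi>] absolutely_integrable_continuous_real by blast
  let ?I = "indefinite_integral \<psi>"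
  have P: "has_primitive \<psi> ?I" by (rule has_primitive_indefinite_integral[OF li])
  obtain R where R: "R > 0" "\<And>x. \<bar>x\<bar> \<ge> R \<Longrightarrow> \<psi> x = 0" using test_functionD[OF \<psi>] by metis
  define \<phi> where "\<phi> = (\<lambda>x. ?I x - ?I (-R))"
  have D: "DERIV \<phi> x :> \<psi> x" for x
  proof -
    have "((\<lambda>u. integral {x-1..u} \<psi>) has_vector_derivative \<psi> x) (at x within {x-1..x+1})"
      by (rule integral_has_vector_derivative) (auto intro: test_function_continuous[OF \<psi>])
    then have "((\<lambda>u. integral {x-1..u} \<psi>) has_vector_derivative \<psi> x) (at x)"
      by (subst (asm) at_within_interior) auto
    then have "DERIV (\<lambda>u. integral {x-1..u} \<psi>) x :> \<psi> x"
      by (simp add: has_real_derivative_iff_has_vector_derivative)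
    then have "DERIV (\<lambda>u. integral {x-1..u} \<psi> + (?I (x-1) - ?I (-R))) x :> \<psi> x"
      by (auto intro!: derivative_eq_intros)
    moreover have "\<forall>\<^sub>F u in nhds x. integral {x-1..u} \<psi> + (?I (x-1) - ?I (-R)) = \<phi> u"
      using eventually_nhds_in_open[of "{x-1<..}" x]
      by (auto elim!: eventually_mono simp: \<phi>_def has_primitiveD(3)[OF P, symmetric])
    ultimately show ?thesis by (subst (asm) DERIV_cong_ev[OF refl _ refl]) auto
  qed
  then have d: "deriv \<phi> = \<psi>" by (intro ext DERIV_imp_deriv)
  have int0: "integral {a..b} \<psi> = 0" if "b \<le> -R \<or> a \<ge> R" for a b
    using that R by (intro integral_unique has_integral_is_0) (auto simp: abs_if)
  have "\<phi> x = 0" if "\<bar>x\<bar> \<ge> R" for x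
  proof (cases "x \<ge> R")
    case False
    then have "x \<le> -R" using that by auto
    then show ?thesis using has_primitiveD(3)[OF P, of x "-R"] int0[of "-R" x] by (simp add: \<phi>_def)
  next
    case True
    have "\<phi> x = (?I x - ?I R) + (?I R - ?I (-R))" by (simp add: \<phi>_def)
    also have "\<dots> = integral {R..x} \<psi> + integral {-R..R} \<psi>"
      using True R has_primitiveD(3)[OF P] by simp
    also have "integral {-R..R} \<psi> = (\<integral>x. \<psi> x \<partial>lebesgue)"
      using R li by (intro lebesgue_integral_compact_support(2)[symmetric]) (auto simp: locally_integrable_def abs_le_iff not_le)
    finally show ?thesis using 0 int0[of x R] by simp
  qed
  moreover have "differentiable_times n \<phi>" for n
    using \<psi> D d unfolding test_function_iff by (cases n) (auto simp: real_differentiable_def)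
  ultimately show ?thesis using d by (intro that[of \<phi>]) (auto simp: test_function_iff)
qed

lemma test_function_lincomb:
  "test_function f \<Longrightarrow> test_function g \<Longrightarrow> test_function (\<lambda>x. f x + c * g x)"
  unfolding test_function_iff
proof (elim conjE exE, intro conjI allI)
  fix R R' :: real and n
  assume "\<forall>n. differentiable_times n f" "\<forall>n. differentiable_times n g"
  then show "differentiable_times n (\<lambda>x. f x + c * g x)"
    by (intro differentiable_times_add differentiable_times_mult differentiable_times_const) auto
  assume "\<forall>x. R \<le> \<bar>x\<bar> \<longrightarrow> f x = 0" "\<forall>x. R' \<le> \<bar>x\<bar> \<longrightarrow> g x = 0"
  then show "\<exists>R. \<forall>x. R \<le> \<bar>x\<bar> \<longrightarrow> f x + c * g x = 0"
    by (intro exI[of _ "max R R'"]) auto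
qed

text \<open>
  Subtracting a primitive of \<open>h\<close> reduces the claim to a function \<open>z\<close> with weak derivative zero.
  Every test function is, up to a multiple of a fixed one, the derivative of a test function, so
  that \<open>z\<close> integrates test functions as a constant does.
\<close>

lemma du_Bois_Reymond:
  fixes f :: "real \<Rightarrow> 'b::euclidean_space"
  assumes f: "locally_integrable f" and h: "locally_integrable h"
    and weak: "\<And>\<phi>. test_function \<phi> \<Longrightarrow>
      (\<integral>x. deriv \<phi> x *\<^sub>R f x \<partial>lebesgue) = - (\<integral>x. \<phi> x *\<^sub>R h x \<partial>lebesgue)"
  obtains F where "has_primitive h F" "AE x in lebesgue. f x = F x"
proof -
  define H where "H = indefinite_integral h"
  have H: "has_primitive h H" unfolding H_def by (rule has_primitive_indefinite_integral[OF h])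
  have cont_li: "locally_integrable g" if "continuous_on UNIV g" for g :: "real \<Rightarrow> 'b"
    unfolding locally_integrable_def
    by (meson absolutely_integrable_continuous_real continuous_on_subset subset_UNIV that)
  have li_add: "locally_integrable (\<lambda>x. u x + v x)" if "locally_integrable u" "locally_integrable v" for u v :: "real \<Rightarrow> 'b"
    using that unfolding locally_integrable_def by (auto intro: set_integral_add)
  have li_diff: "locally_integrable (\<lambda>x. u x - v x)" if "locally_integrable u" "locally_integrable v" for u v :: "real \<Rightarrow> 'b"
    using that unfolding locally_integrable_def by (auto intro: set_integral_diff)
  have Hli: "locally_integrable H" by (intro cont_li has_primitive_continuous[OF H])
  define z where "z = (\<lambda>x. f x - H x)"
  have z: "locally_integrable z" unfolding z_def by (intro li_diff f Hli)
  have z0: "(\<integral>x. deriv \<phi> x *\<^sub>R z x \<partial>lebesgue) = 0" if "test_function \<phi>" for \<phi>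
  proof -
    have "(\<integral>x. deriv \<phi> x *\<^sub>R z x \<partial>lebesgue) = (\<integral>x. deriv \<phi> x *\<^sub>R f x - deriv \<phi> x *\<^sub>R H x \<partial>lebesgue)"
      by (simp add: z_def scaleR_diff_right)
    also have "\<dots> = (\<integral>x. deriv \<phi> x *\<^sub>R f x \<partial>lebesgue) - (\<integral>x. deriv \<phi> x *\<^sub>R H x \<partial>lebesgue)"
      by (intro Bochner_Integration.integral_diff test_function_integrable test_function_deriv that f Hli)
    finally show ?thesis by (simp add: weak[OF that] test_function_integration_by_parts[OF that H])
  qed
  have int: "integrable lebesgue \<psi>" if "test_function \<psi>" for \<psi>
  proof -
    have "locally_integrable (\<lambda>x. 1::real)" unfolding locally_integrable_def by auto
    from test_function_integrable[OF that this] show ?thesis by simp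
  qed
  define \<rho> where "\<rho> = bump 0 1 1"
  have \<rho>: "test_function \<rho>" unfolding \<rho>_def by (rule test_function_bump)
  have "(\<integral>x. \<rho> x \<partial>lebesgue) \<noteq> 0"
  proof
    assume "(\<integral>x. \<rho> x \<partial>lebesgue) = 0"
    then have "AE x in lebesgue. \<rho> x = 0"
      using integral_nonneg_eq_0_iff_AE[OF int[OF \<rho>]] bump_bounds by (auto simp: \<rho>_def)
    then have "AE x in lebesgue. x \<notin> {0<..<1::real}"
      by eventually_elim (auto simp: \<rho>_def bump_def flat_exp_def)
    then have "{0<..<1::real} \<in> null_sets lebesgue"
      by (subst AE_iff_null_sets) auto
    then have "emeasure lebesgue {0<..<1::real} = 0" by auto
    then show False by simp
  qed
  then have r: "(\<integral>x. \<rho> x \<partial>lebesgue) \<noteq> 0" .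
  define c where "c = (\<integral>x. \<rho> x *\<^sub>R z x \<partial>lebesgue) /\<^sub>R (\<integral>x. \<rho> x \<partial>lebesgue)"
  have "(\<integral>x. \<psi> x *\<^sub>R (z x - c) \<partial>lebesgue) = 0" if \<psi>: "test_function \<psi>" for \<psi>
  proof -
    define s where "s = (\<integral>x. \<psi> x \<partial>lebesgue) / (\<integral>x. \<rho> x \<partial>lebesgue)"
    have t: "test_function (\<lambda>x. \<psi> x + (- s) * \<rho> x)" by (intro test_function_lincomb \<psi> \<rho>)
    have "(\<integral>x. \<psi> x + (- s) * \<rho> x \<partial>lebesgue) = 0"
      using r int[OF \<psi>] int[OF \<rho>] by (simp add: s_def)
    from test_function_primitive[OF t this] obtain \<phi> where
      \<phi>: "test_function \<phi>" "deriv \<phi> = (\<lambda>x. \<psi> x + (- s) * \<rho> x)" .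
    have "0 = (\<integral>x. (\<psi> x + (- s) * \<rho> x) *\<^sub>R z x \<partial>lebesgue)"
      using z0[OF \<phi>(1)] by (simp add: \<phi>(2))
    also have "\<dots> = (\<integral>x. \<psi> x *\<^sub>R z x - s *\<^sub>R (\<rho> x *\<^sub>R z x) \<partial>lebesgue)"
      by (intro Bochner_Integration.integral_cong) (auto simp: algebra_simps)
    also have "\<dots> = (\<integral>x. \<psi> x *\<^sub>R z x \<partial>lebesgue) - s *\<^sub>R (\<integral>x. \<rho> x *\<^sub>R z x \<partial>lebesgue)"
      using test_function_integrable[OF \<psi> z] test_function_integrable[OF \<rho> z]
      by (subst Bochner_Integration.integral_diff) (auto simp del: scaleR_scaleR)
    also have "s *\<^sub>R (\<integral>x. \<rho> x *\<^sub>R z x \<partial>lebesgue) = (\<integral>x. \<psi> x \<partial>lebesgue) *\<^sub>R c"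
      by (simp add: s_def c_def divide_inverse)
    finally have "(\<integral>x. \<psi> x *\<^sub>R z x \<partial>lebesgue) = (\<integral>x. \<psi> x \<partial>lebesgue) *\<^sub>R c" by simp
    moreover have "(\<integral>x. \<psi> x *\<^sub>R (z x - c) \<partial>lebesgue) = (\<integral>x. \<psi> x *\<^sub>R z x \<partial>lebesgue) - (\<integral>x. \<psi> x *\<^sub>R c \<partial>lebesgue)"
      unfolding scaleR_diff_right
      by (intro Bochner_Integration.integral_diff test_function_integrable \<psi> z integrable_scaleR_left int)
    ultimately show ?thesis using int[OF \<psi>] by simp
  qed
  then have "AE x in lebesgue. z x - c = 0"
    by (intro AE_0_if_test_integrals_0 li_diff z cont_li) auto
  then have "AE x in lebesgue. f x = c + H x"
    by eventually_elim (simp add: z_def algebra_simps)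
  then show ?thesis using has_primitive_shift[OF H] that by blast
qed

section \<open>Schur's test and Laplace's method\<close>

text \<open>
  Cauchy-Schwarz with the kernel split into two square roots bounds the square of the inner
  integral by \<open>\<alpha>\<close> times the integral of \<open>k * g\<^sup>2\<close>; Fubini then brings in the column
  integrals.
\<close>

lemma schur_test:
  fixes k :: "real \<Rightarrow> real \<Rightarrow> real" and g :: "real \<Rightarrow> real" and \<alpha> \<beta> :: ennreal
  assumes [measurable]: "(\<lambda>(x, t). k x t) \<in> borel_measurable (lborel \<Otimes>\<^sub>M lborel)"
      "g \<in> borel_measurable lborel"
    and nonneg: "\<And>x t. 0 \<le> k x t" "\<And>t. 0 \<le> g t"
    and row: "\<And>x. (\<integral>\<^sup>+t. k x t \<partial>lborel) \<le> \<alpha>"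
    and col: "\<And>t. (\<integral>\<^sup>+x. k x t \<partial>lborel) \<le> \<beta>"
  shows "(\<integral>\<^sup>+x. (\<integral>\<^sup>+t. ennreal (k x t * g t) \<partial>lborel)\<^sup>2 \<partial>lborel)
    \<le> \<alpha> * \<beta> * (\<integral>\<^sup>+t. ennreal ((g t)\<^sup>2) \<partial>lborel)"
proof -
  have "(\<integral>\<^sup>+t. ennreal (k x t * g t) \<partial>lborel)\<^sup>2 \<le> \<alpha> * (\<integral>\<^sup>+t. ennreal (k x t * (g t)\<^sup>2) \<partial>lborel)" for x
  proof -
    have "(\<integral>\<^sup>+t. ennreal (k x t * g t) \<partial>lborel)\<^sup>2 =
        (\<integral>\<^sup>+t. ennreal (sqrt (k x t)) * ennreal (sqrt (k x t) * g t) \<partial>lborel)\<^sup>2"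
      by (intro arg_cong[where f = "\<lambda>x. x\<^sup>2"] nn_integral_cong)
         (auto simp: ennreal_mult[symmetric] nonneg mult.assoc[symmetric])
    also have "\<dots> \<le> (\<integral>\<^sup>+t. (ennreal (sqrt (k x t)))\<^sup>2 \<partial>lborel) * (\<integral>\<^sup>+t. (ennreal (sqrt (k x t) * g t))\<^sup>2 \<partial>lborel)"
      by (rule Cauchy_Schwarz_nn_integral) measurable
    also have "(\<integral>\<^sup>+t. (ennreal (sqrt (k x t)))\<^sup>2 \<partial>lborel) = (\<integral>\<^sup>+t. k x t \<partial>lborel)"
      by (intro nn_integral_cong) (simp add: ennreal_power nonneg)
    also have "(\<integral>\<^sup>+t. (ennreal (sqrt (k x t) * g t))\<^sup>2 \<partial>lborel) = (\<integral>\<^sup>+t. ennreal (k x t * (g t)\<^sup>2) \<partial>lborel)"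
      by (intro nn_integral_cong) (simp add: ennreal_power nonneg power_mult_distrib)
    finally show ?thesis
      using row[of x] by (meson mult_right_mono order_trans zero_le)
  qed
  then have "(\<integral>\<^sup>+x. (\<integral>\<^sup>+t. ennreal (k x t * g t) \<partial>lborel)\<^sup>2 \<partial>lborel)
      \<le> (\<integral>\<^sup>+x. \<alpha> * (\<integral>\<^sup>+t. ennreal (k x t * (g t)\<^sup>2) \<partial>lborel) \<partial>lborel)"
    by (intro nn_integral_mono)
  also have "\<dots> = \<alpha> * (\<integral>\<^sup>+x. (\<integral>\<^sup>+t. ennreal (k x t * (g t)\<^sup>2) \<partial>lborel) \<partial>lborel)"
    by (intro nn_integral_cmult) measurable
  also have "(\<integral>\<^sup>+x. (\<integral>\<^sup>+t. ennreal (k x t * (g t)\<^sup>2) \<partial>lborel) \<partial>lborel) =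
      (\<integral>\<^sup>+t. (\<integral>\<^sup>+x. ennreal (k x t * (g t)\<^sup>2) \<partial>lborel) \<partial>lborel)"
    by (rule lborel_pair.Fubini') measurable
  also have "\<dots> = (\<integral>\<^sup>+t. (\<integral>\<^sup>+x. k x t \<partial>lborel) * ennreal ((g t)\<^sup>2) \<partial>lborel)"
    by (intro nn_integral_cong) (auto simp: ennreal_mult nonneg intro!: nn_integral_multc)
  also have "\<dots> \<le> (\<integral>\<^sup>+t. \<beta> * ennreal ((g t)\<^sup>2) \<partial>lborel)"
    by (intro nn_integral_mono mult_right_mono col) auto
  also have "\<dots> = \<beta> * (\<integral>\<^sup>+t. ennreal ((g t)\<^sup>2) \<partial>lborel)"
    by (intro nn_integral_cmult) measurable
  finally show ?thesis
    by (simp add: mult.assoc mult_left_mono)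
qed

lemma nn_integral_gaussian:
  fixes b :: real
  assumes "b > 0"
  shows "(\<integral>\<^sup>+t. ennreal (exp (- b * (t - c)\<^sup>2)) \<partial>lborel) = ennreal (sqrt (pi / b))"
proof -
  define \<sigma> where "\<sigma> = sqrt (1 / (2 * b))"
  have \<sigma>: "\<sigma> > 0" "\<sigma>\<^sup>2 = 1 / (2 * b)" using assms by (auto simp: \<sigma>_def)
  have eq: "exp (- b * (t - c)\<^sup>2) = sqrt (pi / b) * normal_density c \<sigma> t" for t
  proof -
    have "2 * \<sigma>\<^sup>2 = 1 / b" "2 * pi * \<sigma>\<^sup>2 = pi / b" using assms \<sigma> by (auto simp: field_simps)
    then show ?thesis using assms by (simp add: normal_density_def mult.commute)
  qed
  have "(\<integral>\<^sup>+t. ennreal (exp (- b * (t - c)\<^sup>2)) \<partial>lborel) = ennreal (\<integral>t. sqrt (pi / b) * normal_density c \<sigma> t \<partial>lborel)"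
    unfolding eq by (intro nn_integral_eq_integral) (use \<sigma> assms in auto)
  also have "(\<integral>t. sqrt (pi / b) * normal_density c \<sigma> t \<partial>lborel) = sqrt (pi / b)"
    using \<sigma> by simp
  finally show ?thesis .
qed

lemma nn_integral_exp_decay_right:
  fixes r :: real
  assumes "r > 0"
  shows "(\<integral>\<^sup>+t. ennreal (exp (- r * (t - c))) * indicator {c..} t \<partial>lborel) = ennreal (1 / r)"
proof -
  have lim: "((\<lambda>t. - (exp (- r * (t - c)) / r)) \<longlongrightarrow> - (0 / r)) at_top"
  proof (intro tendsto_intros)
    have "filterlim (\<lambda>t. - r * (t - c)) at_bot at_top"
      using assms by real_asymp
    then show "((\<lambda>t. exp (- r * (t - c))) \<longlongrightarrow> 0) at_top"
      by (rule filterlim_compose[OF exp_at_bot])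
  qed (use assms in auto)
  have "(\<integral>\<^sup>+t. ennreal (exp (- r * (t - c))) * indicator {c..} t \<partial>lborel)
      = ennreal (- (0 / r) - - (exp (- r * (c - c)) / r))"
    by (rule nn_integral_FTC_atLeast[OF _ _ _ lim])
       (use assms in \<open>auto intro!: derivative_eq_intros simp: field_simps\<close>)
  then show ?thesis by simp
qed

lemma nn_integral_exp_decay_left:
  fixes r :: real
  assumes "r > 0"
  shows "(\<integral>\<^sup>+t. ennreal (exp (- r * (c - t))) * indicator {..c} t \<partial>lborel) = ennreal (1 / r)"
proof -
  have "(\<integral>\<^sup>+t. ennreal (exp (- r * (c - t))) * indicator {..c} t \<partial>lborel)
     = (\<integral>\<^sup>+t. ennreal (exp (- r * (c - (0 + -1 * t)))) * indicator {..c} (0 + -1 * t) \<partial>lborel)"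
    by (subst nn_integral_real_affine[of _ "-1" 0]) auto
  also have "\<dots> = (\<integral>\<^sup>+t. ennreal (exp (- r * (t - (- c)))) * indicator {- c..} t \<partial>lborel)"
    by (intro nn_integral_cong) (auto simp: indicator_def algebra_simps)
  finally show ?thesis using nn_integral_exp_decay_right[OF assms, of "- c"] by simp
qed

text \<open>
  Near \<open>X\<close> the exponent lies below a parabola and farther away below two straight lines, so that
  the integral is at most a full Gaussian plus two exponential tails.
\<close>

lemma laplace_upper_bound:
  fixes F :: "real \<Rightarrow> real"
  assumes pos: "a > 0" "b > 0" "r > 0"
    and near: "\<And>s. \<bar>s\<bar> \<le> \<delta> \<Longrightarrow> F (X + s) \<le> F X - b * s\<^sup>2"
    and left: "\<And>t. 0 \<le> t \<Longrightarrow> t \<le> X - \<delta> \<Longrightarrow> F t \<le> F X - r * (X - \<delta> - t)"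
    and right: "\<And>t. X + \<delta> \<le> t \<Longrightarrow> F t \<le> F X - r * (t - (X + \<delta>))"
  shows "(\<integral>\<^sup>+t. ennreal (exp (a * F t)) * indicator {0..} t \<partial>lborel)
    \<le> ennreal (exp (a * F X) * (sqrt (pi / (a * b)) + 2 / (a * r)))"
proof -
  let ?G = "\<lambda>t. ennreal (exp (- (a * b) * (t - X)\<^sup>2))"
  let ?L = "\<lambda>t. ennreal (exp (- (a * r) * (X - \<delta> - t))) * indicator {..X - \<delta>} t"
  let ?R = "\<lambda>t. ennreal (exp (- (a * r) * (t - (X + \<delta>)))) * indicator {X + \<delta>..} t"
  have "(\<integral>\<^sup>+t. ennreal (exp (a * F t)) * indicator {0..} t \<partial>lborel)
      \<le> (\<integral>\<^sup>+t. ennreal (exp (a * F X)) * (?G t + ?L t + ?R t) \<partial>lborel)"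
  proof (rule nn_integral_mono)
    fix t
    have split: "exp (a * F t) \<le> exp (a * F X) * exp e" if "F t \<le> F X + e / a" for e
    proof -
      have "a * F t \<le> a * F X + e" using that pos by (simp add: field_simps)
      then show ?thesis by (simp flip: exp_add)
    qed
    consider "t < 0" | "0 \<le> t" "t \<le> X - \<delta>" | "\<bar>t - X\<bar> \<le> \<delta>" | "X + \<delta> \<le> t" by linarith
    then show "ennreal (exp (a * F t)) * indicator {0..} t \<le> ennreal (exp (a * F X)) * (?G t + ?L t + ?R t)"
    proof cases
      case 2
      then have "ennreal (exp (a * F t)) * indicator {0..} t \<le> ennreal (exp (a * F X)) * ?L t"
        using left[OF 2] pos by (auto simp flip: ennreal_mult intro!: ennreal_leI split)
      also have "\<dots> \<le> ennreal (exp (a * F X)) * (?G t + ?L t + ?R t)"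
        by (intro mult_left_mono) (auto intro: add_increasing2 add_increasing)
      finally show ?thesis .
    next
      case 3
      have "ennreal (exp (a * F t)) * indicator {0..} t \<le> ennreal (exp (a * F t))"
        by (auto simp: indicator_def)
      also have "\<dots> \<le> ennreal (exp (a * F X)) * ?G t"
        using near[OF 3] pos by (auto simp flip: ennreal_mult intro!: ennreal_leI split)
      also have "\<dots> \<le> ennreal (exp (a * F X)) * (?G t + ?L t + ?R t)"
        by (intro mult_left_mono) (auto intro: add_increasing2 add_increasing simp: add.assoc)
      finally show ?thesis .
    next
      case 4
      have "ennreal (exp (a * F t)) * indicator {0..} t \<le> ennreal (exp (a * F t))"
        by (auto simp: indicator_def)
      also have "\<dots> \<le> ennreal (exp (a * F X)) * ?R t"
        using right[OF 4] 4 pos by (auto simp flip: ennreal_mult intro!: ennreal_leI split)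
      also have "\<dots> \<le> ennreal (exp (a * F X)) * (?G t + ?L t + ?R t)"
        by (intro mult_left_mono) (auto intro: add_increasing2 add_increasing)
      finally show ?thesis .
    qed simp
  qed
  also have "\<dots> = ennreal (exp (a * F X)) * (\<integral>\<^sup>+t. (?G t + ?L t + ?R t) \<partial>lborel)"
    by (rule nn_integral_cmult) measurable
  also have "(\<integral>\<^sup>+t. (?G t + ?L t + ?R t) \<partial>lborel)
      = (\<integral>\<^sup>+t. ?G t \<partial>lborel) + (\<integral>\<^sup>+t. ?L t \<partial>lborel) + (\<integral>\<^sup>+t. ?R t \<partial>lborel)"
    by (subst nn_integral_add; (subst nn_integral_add)?) simp_all
  also have "\<dots> = ennreal (sqrt (pi / (a * b)) + 2 / (a * r))"
    using nn_integral_gaussian[of "a * b" X] nn_integral_exp_decay_left[of "a * r" "X - \<delta>"]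
      nn_integral_exp_decay_right[of "a * r" "X + \<delta>"] pos
    by (simp flip: ennreal_plus add: add.assoc)
  finally show ?thesis using pos by (simp add: ennreal_mult)
qed

text \<open>
  The part of the Gaussian outside the window is dominated by exponential tails; this is the
  amount subtracted. For a narrow window the left-hand side is negative and the statement is
  trivial.
\<close>

lemma laplace_lower_bound:
  fixes F :: "real \<Rightarrow> real"
  assumes pos: "a > 0" "b > 0" "\<delta> > 0" "\<delta> \<le> X" and [measurable]: "F \<in> borel_measurable borel"
    and near: "\<And>s. \<bar>s\<bar> \<le> \<delta> \<Longrightarrow> F X - b * s\<^sup>2 \<le> F (X + s)"
  shows "ennreal (exp (a * F X) * (sqrt (pi / (a * b)) - 2 / (a * b * \<delta>)))
    \<le> (\<integral>\<^sup>+t. ennreal (exp (a * F t)) * indicator {0..} t \<partial>lborel)"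
proof -
  let ?I = "\<integral>\<^sup>+t. ennreal (exp (a * F t)) * indicator {0..} t \<partial>lborel"
  let ?E = "exp (a * F X)"
  let ?r = "a * b * \<delta>"
  let ?N = "\<lambda>t. ennreal (exp (a * F t)) * indicator {0..} t"
  let ?L = "\<lambda>t. ennreal (exp (- ?r * (X - \<delta> - t))) * indicator {..X - \<delta>} t"
  let ?R = "\<lambda>t. ennreal (exp (- ?r * (t - (X + \<delta>)))) * indicator {X + \<delta>..} t"
  have r: "?r > 0" using pos by simp
  have "ennreal (?E * sqrt (pi / (a * b))) = (\<integral>\<^sup>+t. ennreal ?E * ennreal (exp (- (a * b) * (t - X)\<^sup>2)) \<partial>lborel)"
    using pos nn_integral_gaussian[of "a * b" X] by (subst nn_integral_cmult) (auto simp: ennreal_mult)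
  also have "\<dots> \<le> (\<integral>\<^sup>+t. ?N t + (ennreal ?E * ?L t + ennreal ?E * ?R t) \<partial>lborel)"
  proof (rule nn_integral_mono)
    fix t
    have tail: "- (a * b) * (t - X)\<^sup>2 \<le> - ?r * (\<bar>t - X\<bar> - \<delta>)" if "\<delta> \<le> \<bar>t - X\<bar>"
    proof -
      have "\<delta> * (\<bar>t - X\<bar> - \<delta>) \<le> \<bar>t - X\<bar> * \<bar>t - X\<bar>" using that pos by (intro mult_mono) auto
      then have "\<delta> * (\<bar>t - X\<bar> - \<delta>) \<le> (t - X)\<^sup>2" by (simp add: power2_eq_square)
      then show ?thesis using pos by (simp add: mult.assoc)
    qed
    consider "t \<le> X - \<delta>" | "\<bar>t - X\<bar> \<le> \<delta>" | "X + \<delta> \<le> t" by linarith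
    then show "ennreal ?E * ennreal (exp (- (a * b) * (t - X)\<^sup>2)) \<le> ?N t + (ennreal ?E * ?L t + ennreal ?E * ?R t)"
    proof cases
      case 1
      then have d: "\<bar>t - X\<bar> - \<delta> = X - \<delta> - t" and "\<delta> \<le> \<bar>t - X\<bar>" using pos by auto
      from tail[OF this(2)] have "- (a * b) * (t - X)\<^sup>2 \<le> - ?r * (X - \<delta> - t)" unfolding d .
      then have "ennreal ?E * ennreal (exp (- (a * b) * (t - X)\<^sup>2)) \<le> ennreal ?E * ?L t"
        using 1 by (auto intro!: mult_left_mono ennreal_leI)
      also have "\<dots> \<le> ?N t + (ennreal ?E * ?L t + ennreal ?E * ?R t)"
        by (metis add_increasing add_increasing2 order_refl zero_le)
      finally show ?thesis .
    next
      case 2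
      have "a * F X - a * b * (t - X)\<^sup>2 \<le> a * F t"
        using mult_left_mono[OF near[OF 2], of a] pos by (simp add: algebra_simps)
      then have "?E * exp (- (a * b) * (t - X)\<^sup>2) \<le> exp (a * F t)"
        by (simp flip: exp_add)
      then have "ennreal ?E * ennreal (exp (- (a * b) * (t - X)\<^sup>2)) \<le> ?N t"
        using 2 pos by (auto simp flip: ennreal_mult intro!: ennreal_leI)
      then show ?thesis by (auto intro: add_increasing2 add_increasing)
    next
      case 3
      then have d: "\<bar>t - X\<bar> - \<delta> = t - (X + \<delta>)" and "\<delta> \<le> \<bar>t - X\<bar>" using pos by auto
      from tail[OF this(2)] have "- (a * b) * (t - X)\<^sup>2 \<le> - ?r * (t - (X + \<delta>))" unfolding d .
      then have "ennreal ?E * ennreal (exp (- (a * b) * (t - X)\<^sup>2)) \<le> ennreal ?E * ?R t"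
        using 3 by (auto intro!: mult_left_mono ennreal_leI)
      also have "\<dots> \<le> ?N t + (ennreal ?E * ?L t + ennreal ?E * ?R t)"
        by (metis add_increasing add_increasing2 order_refl zero_le)
      finally show ?thesis .
    qed
  qed
  also have "\<dots> = ?I + (ennreal ?E * ennreal (1 / ?r) + ennreal ?E * ennreal (1 / ?r))"
    using nn_integral_exp_decay_left[OF r, of "X - \<delta>"] nn_integral_exp_decay_right[OF r, of "X + \<delta>"]
    by (simp add: nn_integral_add nn_integral_cmult)
  also have "\<dots> = ?I + ennreal (?E * (1 / ?r) + ?E * (1 / ?r))"
    using r by (simp only: ennreal_mult[symmetric] ennreal_plus[symmetric]
        exp_ge_zero less_imp_le[OF divide_pos_pos[OF zero_less_one r]] mult_nonneg_nonneg)
  also have "?E * (1 / ?r) + ?E * (1 / ?r) = ?E * (2 / ?r)"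
    unfolding distrib_left[symmetric] add_divide_distrib[symmetric] by simp
  finally show ?thesis
    using r by (simp add: right_diff_distrib ennreal_minus[symmetric] ennreal_minus_le_iff add.commute)
qed

section \<open>Confining potentials and their turning points\<close>

text \<open>
  The properties of the potential in the form in which they are used: \<open>w\<close> is a version without
  exceptional null sets, \<open>w'\<close> and \<open>w''\<close> are its derivatives beyond \<open>Y\<close>, and \<open>mono\<close> compares a
  point beyond \<open>Y\<close> with all points closer to the origin, where \<open>w\<close> itself need not be monotone.
\<close>

locale confining_potential =
  fixes w w' w'' :: "real \<Rightarrow> real" and Y \<nu> C :: real
  assumes Y: "1 \<le> Y" and C: "0 < C" and nu: "-1 \<le> \<nu>"
    and measurable_w: "w \<in> borel_measurable lebesgue"
    and nonneg: "0 \<le> w x"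
    and even: "w (- x) = w x"
    and mono: "\<bar>x\<bar> \<le> y \<Longrightarrow> Y \<le> y \<Longrightarrow> w x \<le> w y"
    and at_top: "filterlim w at_top at_top"
    and DERIV_w: "Y < x \<Longrightarrow> DERIV w x :> w' x"
    and DERIV_w': "Y < x \<Longrightarrow> DERIV w' x :> w'' x"
    and w'_pos: "Y < x \<Longrightarrow> 0 < w' x"
    and w'_le: "Y < x \<Longrightarrow> w' x \<le> C * w x * x powr \<nu>"
    and w''_le: "Y < x \<Longrightarrow> \<bar>w'' x\<bar> \<le> C * w' x * x powr \<nu>"
    and Upsilon: "((\<lambda>x. x powr \<nu> * w' x powr (-1/2)) \<longlongrightarrow> 0) at_top"
begin

lemma locally_bounded_w: "locally_bounded w"
  unfolding locally_bounded_def
proof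
  fix R :: real
  show "\<exists>M. \<forall>x. \<bar>x\<bar> \<le> R \<longrightarrow> norm (w x) \<le> M"
    using mono[of _ "max R Y"] nonneg by (intro exI[of _ "w (max R Y)"]) auto
qed

lemma locally_bounded_diff_w: "locally_bounded (\<lambda>t. lam - w t)"
  unfolding locally_bounded_def
proof
  fix R :: real
  obtain M where "\<And>t. \<bar>t\<bar> \<le> R \<Longrightarrow> norm (w t) \<le> M"
    using locally_boundedD[OF locally_bounded_w] by blast
  then show "\<exists>M. \<forall>x. \<bar>x\<bar> \<le> R \<longrightarrow> norm (lam - w x) \<le> M"
    by (intro exI[of _ "\<bar>lam\<bar> + M"]) (force intro: order_trans[OF abs_triangle_ineq4])
qed

lemma locally_integrable_w: "locally_integrable w"
  unfolding locally_integrable_def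
proof (intro allI)
  fix x y :: real
  obtain M where M: "\<And>t. \<bar>t\<bar> \<le> max \<bar>x\<bar> \<bar>y\<bar> \<Longrightarrow> norm (w t) \<le> M"
    using locally_boundedD[OF locally_bounded_w] by blast
  show "w absolutely_integrable_on {x..y}"
  proof (rule measurable_bounded_by_integrable_imp_absolutely_integrable)
    show "w \<in> borel_measurable (lebesgue_on {x..y})"
      using measurable_w by (rule measurable_restrict_space1)
    show "norm (w t) \<le> M" if "t \<in> {x..y}" for t
      using that by (intro M) auto
  qed auto
qed

text \<open>
  This is \<open>f\<^sub>\<lambda>\<close>, for arguments of either sign.
\<close>

definition F :: "real \<Rightarrow> real \<Rightarrow> real" where
  "F lam x = lam * x - indefinite_integral w x"

lemma has_primitive_F: "has_primitive (\<lambda>t. lam - w t) (F lam)"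
proof -
  note P = has_primitive_indefinite_integral[OF locally_integrable_w]
  show ?thesis unfolding has_primitive_def
  proof (intro allI impI conjI)
    fix x y :: real assume xy: "x \<le> y"
    show "(\<lambda>t. lam - w t) absolutely_integrable_on {x..y}"
      using has_primitiveD(1)[OF P xy] by (intro set_integral_diff) auto
    have "((\<lambda>t. lam - w t) has_integral (y - x) * lam - (indefinite_integral w y - indefinite_integral w x)) {x..y}"
      using has_integral_diff[OF has_integral_const_real[of lam x y] has_primitiveD(4)[OF P xy]] xy by simp
    then show "F lam y - F lam x = integral {x..y} (\<lambda>t. lam - w t)"
      by (simp add: F_def integral_unique algebra_simps)
  qed
qed

lemma continuous_F: "continuous_on S (F lam)"
  by (rule has_primitive_continuous[OF has_primitive_F])

lemma measurable_F[measurable]: "F lam \<in> borel_measurable borel"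
  by (intro borel_measurable_continuous_onI continuous_F)

lemma F_0[simp]: "F lam 0 = 0"
  by (simp add: F_def indefinite_integral_def)

lemma F_minus: "F lam (- x) = - F lam x"
proof -
  have "integral {a..b} w = integral {-b..-a} w" for a b
    using Henstock_Kurzweil_Integration.integral_reflect_real[of b a w] by (simp add: even)
  from this[of 0 x] this[of x 0] show ?thesis
    by (simp add: F_def indefinite_integral_def)
qed

lemma F_upper:
  assumes "x \<le> y" "\<And>t. x \<le> t \<Longrightarrow> t \<le> y \<Longrightarrow> lam - w t \<le> c"
  shows "F lam y - F lam x \<le> c * (y - x)"
proof -
  have "F lam y - F lam x \<le> integral {x..y} (\<lambda>_. c)"
    unfolding has_primitiveD(3)[OF has_primitive_F assms(1)]
    using assms has_primitiveD(2)[OF has_primitive_F assms(1)] by (intro integral_le) auto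
  then show ?thesis using assms(1) by (simp add: mult.commute)
qed

lemma F_lower:
  assumes "x \<le> y" "\<And>t. x \<le> t \<Longrightarrow> t \<le> y \<Longrightarrow> c \<le> lam - w t"
  shows "c * (y - x) \<le> F lam y - F lam x"
proof -
  have "integral {x..y} (\<lambda>_. c) \<le> F lam y - F lam x"
    unfolding has_primitiveD(3)[OF has_primitive_F assms(1)]
    using assms has_primitiveD(2)[OF has_primitive_F assms(1)] by (intro integral_le) auto
  then show ?thesis using assms(1) by (simp add: mult.commute)
qed

lemma isCont_w: "Y < x \<Longrightarrow> isCont w x"
  using DERIV_isCont[OF DERIV_w] .

lemma DERIV_F:
  assumes "Y < x"
  shows "DERIV (F lam) x :> lam - w x"
proof -
  let ?a = "(x + Y) / 2"
  have a: "Y < ?a" "?a < x" using assms by auto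
  have "((\<lambda>u. integral {?a..u} (\<lambda>t. lam - w t)) has_vector_derivative (lam - w x)) (at x within {?a..x+1})"
    using a isCont_w by (intro integral_has_vector_derivative continuous_intros)
      (auto intro!: continuous_at_imp_continuous_on)
  then have "((\<lambda>u. integral {?a..u} (\<lambda>t. lam - w t)) has_vector_derivative (lam - w x)) (at x)"
    using a by (subst (asm) at_within_interior) auto
  then have "DERIV (\<lambda>u. integral {?a..u} (\<lambda>t. lam - w t)) x :> lam - w x"
    by (simp add: has_real_derivative_iff_has_vector_derivative)
  then have "DERIV (\<lambda>u. F lam ?a + integral {?a..u} (\<lambda>t. lam - w t)) x :> lam - w x"
    by (auto intro!: derivative_eq_intros)
  moreover have "\<forall>\<^sub>F u in nhds x. F lam ?a + integral {?a..u} (\<lambda>t. lam - w t) = F lam u"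
    using eventually_nhds_in_open[of "{?a<..}" x] a
    by (auto elim!: eventually_mono simp: has_primitiveD(3)[OF has_primitive_F, symmetric])
  ultimately show ?thesis by (subst (asm) DERIV_cong_ev[OF refl _ refl]) auto
qed

lemma DERIV_F_neg:
  assumes "x < - Y"
  shows "DERIV (F lam) x :> lam - w x"
proof -
  have "DERIV (\<lambda>x. - F lam (- x)) x :> lam - w x"
    using assms DERIV_F[of "-x" lam] even[of x]
    by (auto intro!: derivative_eq_intros DERIV_chain2[where g = uminus and f = "F lam"])
  then show ?thesis by (simp add: F_minus)
qed

lemma strict_mono_w: "Y < x \<Longrightarrow> x < y \<Longrightarrow> w x < w y"
proof (rule DERIV_pos_imp_increasing[of x y w])
  fix t assume "Y < x" "x \<le> t"
  then show "\<exists>D. DERIV w t :> D \<and> 0 < D"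
    using DERIV_w[of t] w'_pos[of t] by auto
qed

text \<open>
  The turning point \<open>x\<^sub>\<lambda>\<close>.
\<close>

definition X :: "real \<Rightarrow> real" where
  "X lam = (THE x. Y < x \<and> w x = lam)"

lemma X_solves:
  assumes "w z < lam" "Y < z"
  shows "z < X lam" "w (X lam) = lam" "Y < x \<Longrightarrow> w x = lam \<Longrightarrow> x = X lam"
proof -
  obtain b where b: "b > z" "w b \<ge> lam"
  proof -
    obtain N where "\<And>n. n \<ge> N \<Longrightarrow> lam \<le> w n"
      using at_top unfolding filterlim_at_top eventually_at_top_linorder by blast
    then show ?thesis by (intro that[of "max N (z + 1)"]) auto
  qed
  have "\<exists>x\<ge>z. x \<le> b \<and> w x = lam"
    using assms b by (intro IVT) (auto intro!: isCont_w)
  then obtain x0 where x0: "z < x0" "w x0 = lam" using assms(1) by (metis less_eq_real_def less_irrefl)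
  have uniq: "x = y" if "Y < x" "Y < y" "w x = lam" "w y = lam" for x y
    using that strict_mono_w[of x y] strict_mono_w[of y x] by (metis less_irrefl linorder_neqE_linordered_idom)
  have "X lam = x0"
    unfolding X_def using x0 assms uniq by (intro the_equality) auto
  with x0 assms uniq show "z < X lam" "w (X lam) = lam" "Y < x \<Longrightarrow> w x = lam \<Longrightarrow> x = X lam"
    by auto
qed

lemma filterlim_X: "filterlim X at_top at_top"
  unfolding filterlim_at_top
proof
  fix Z :: real
  have "\<forall>\<^sub>F lam in at_top. w (max Z (Y + 1)) < lam" by (rule eventually_gt_at_top)
  then show "\<forall>\<^sub>F lam in at_top. Z \<le> X lam"
    by eventually_elim (use X_solves(1)[of "max Z (Y + 1)"] in force)
qed

lemma eventually_X: "\<forall>\<^sub>F lam in at_top. Y + 1 < X lam \<and> w (X lam) = lam \<and> 0 < lam"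
  using eventually_gt_at_top[of "w (Y + 1)"]
proof eventually_elim
  case (elim lam)
  then show ?case using X_solves[of "Y + 1" lam] nonneg[of "Y + 1"] by auto
qed

text \<open>
  The logarithmic derivative of \<open>w'\<close> is at most a constant times \<open>x powr \<nu>\<close> on the interval
  from \<open>x / 2\<close> to \<open>3 * x / 2\<close>, so \<open>ln (w' y)\<close> differs from \<open>ln (w' x)\<close> by at most a constant
  times \<open>\<theta>\<close>. The assumption \<open>-1 \<le> \<nu>\<close> keeps the window inside that interval.
\<close>

lemma slow_variation:
  assumes \<kappa>: "0 < \<kappa>" "\<kappa> < 1"
  obtains \<theta> where "0 < \<theta>" "\<theta> \<le> 1/2"
    "\<And>x y. 2 * Y < x \<Longrightarrow> \<bar>y - x\<bar> \<le> \<theta> * x powr (- \<nu>) \<Longrightarrow>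
       x / 2 \<le> y \<and> \<kappa> * w' x \<le> w' y \<and> w' y \<le> w' x / \<kappa>"
proof -
  define K where "K = C * 2 powr \<bar>\<nu>\<bar>"
  have K: "K > 0" using C by (simp add: K_def)
  \<comment> \<open>The change of \<open>ln w'\<close> is at most \<open>K * \<theta> \<le> - ln \<kappa>\<close>; \<open>\<theta> \<le> 1/2\<close> keeps \<open>y\<close> above \<open>x / 2\<close>.\<close>
  define \<theta> where "\<theta> = min (1/2) (- ln \<kappa> / K)"
  have \<theta>: "\<theta> > 0" "\<theta> \<le> 1/2" "K * \<theta> \<le> - ln \<kappa>"
    using K \<kappa> by (auto simp: \<theta>_def min_def field_simps)
  have main: "x / 2 \<le> y \<and> \<kappa> * w' x \<le> w' y \<and> w' y \<le> w' x / \<kappa>"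
    if x: "2 * Y < x" and y: "\<bar>y - x\<bar> \<le> \<theta> * x powr (- \<nu>)" for x y
  proof -
    have x1: "1 < x" using x Y by auto
    have "x powr (- \<nu>) \<le> x powr 1" using x1 nu by (intro powr_mono) auto
    then have "\<theta> * x powr (- \<nu>) \<le> (1/2) * x"
      using \<theta> x1 by (intro mult_mono) auto
    then have near: "x / 2 \<le> z \<and> z \<le> 3 * x / 2" if "\<bar>z - x\<bar> \<le> \<bar>y - x\<bar>" for z
      using that y by (auto simp: abs_le_iff)
    have zY: "Y < z" if "\<bar>z - x\<bar> \<le> \<bar>y - x\<bar>" for z using near[OF that] x by auto
    have D: "DERIV (\<lambda>z. ln (w' z)) z :> w'' z / w' z" if "\<bar>z - x\<bar> \<le> \<bar>y - x\<bar>" for z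
      using DERIV_w'[OF zY[OF that]] w'_pos[OF zY[OF that]] by (auto intro!: derivative_eq_intros)
    have B: "\<bar>w'' z / w' z\<bar> \<le> K * x powr \<nu>" if "\<bar>z - x\<bar> \<le> \<bar>y - x\<bar>" for z
    proof -
      note zY = zY[OF that] and nz = near[OF that]
      have "\<bar>w'' z / w' z\<bar> \<le> C * z powr \<nu>"
        using w''_le[OF zY] w'_pos[OF zY] by (simp add: abs_div field_simps)
      also have "C * z powr \<nu> = C * (x powr \<nu> * (z / x) powr \<nu>)"
        using x1 nz by (simp add: powr_divide)
      also have "\<dots> \<le> C * (x powr \<nu> * 2 powr \<bar>\<nu>\<bar>)"
      proof (intro mult_left_mono)
        show "(z / x) powr \<nu> \<le> 2 powr \<bar>\<nu>\<bar>"
      proof (cases "\<nu> \<ge> 0")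
        case True
        then show ?thesis using nz x1 by (auto intro!: powr_mono2 simp: field_simps)
      next
        case False
        then have "(z / x) powr \<nu> = (x / z) powr (- \<nu>)"
          using x1 nz by (simp add: powr_minus powr_divide field_simps)
        also have "\<dots> \<le> 2 powr (- \<nu>)"
          using nz x1 False by (intro powr_mono2) (auto simp: field_simps)
        finally show ?thesis using False by simp
      qed
      qed (use C in auto)
      finally show ?thesis by (simp add: K_def mult_ac)
    qed
    have "\<bar>ln (w' y) - ln (w' x)\<bar> \<le> K * x powr \<nu> * \<bar>y - x\<bar>"
    proof -
      have "norm (ln (w' y) - ln (w' x)) \<le> K * x powr \<nu> * norm (y - x)"
        by (rule field_differentiable_bound[where S = "cball x \<bar>y - x\<bar>" and f' = "\<lambda>z. w'' z / w' z"])
           (use D B in \<open>auto simp: dist_real_def abs_minus_commute intro: has_field_derivative_at_within\<close>)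
      then show ?thesis by simp
    qed
    also have "\<dots> \<le> K * x powr \<nu> * (\<theta> * x powr (- \<nu>))"
      using y K by (intro mult_left_mono) auto
    also have "\<dots> = K * \<theta>" using x1 by (simp add: powr_minus field_simps)
    also have "\<dots> \<le> - ln \<kappa>" by (rule \<theta>)
    finally have "\<bar>ln (w' y) - ln (w' x)\<bar> \<le> - ln \<kappa>" .
    moreover have p: "w' x > 0" "w' y > 0" using w'_pos zY[of x] zY[of y] by auto
    ultimately have "ln (\<kappa> * w' x) \<le> ln (w' y)" "ln (w' y) \<le> ln (w' x / \<kappa>)"
      using \<kappa> by (auto simp: ln_mult ln_div)
    then show ?thesis using p \<kappa> near[of y] by simp
  qed
  show ?thesis by (rule that[of \<theta>]) (use \<theta> main in auto)
qed

end

section \<open>The peak of the phase at the turning point\<close>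

context confining_potential
begin

text \<open>
  Half the width of the window around the turning point on which \<open>w'\<close> is almost constant.
\<close>

definition width :: "real \<Rightarrow> real \<Rightarrow> real" where
  "width \<theta> lam = \<theta> * X lam powr (- \<nu>)"

text \<open>
  On the window of half width \<open>d\<close> the phase lies between the parabolas with curvatures
  \<open>w' / \<kappa>\<close> and \<open>\<kappa> * w'\<close>; outside the window, to the right of the origin, it is at
  least as steep as the slope \<open>\<kappa> * w' * d\<close> that the flatter parabola has at the end of
  the window.
\<close>

definition parabolic_peak :: "real \<Rightarrow> real \<Rightarrow> real \<Rightarrow> bool" where
  "parabolic_peak \<kappa> d lam \<longleftrightarrow> 0 < d \<and> d \<le> X lam / 2 \<and>
     (\<forall>s. \<bar>s\<bar> \<le> d \<longrightarrow> F lam (X lam) - w' (X lam) / (2 * \<kappa>) * s\<^sup>2 \<le> F lam (X lam + s) \<and>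
        F lam (X lam + s) \<le> F lam (X lam) - \<kappa> * w' (X lam) / 2 * s\<^sup>2) \<and>
     (\<forall>t. 0 \<le> t \<longrightarrow> t \<le> X lam - d \<longrightarrow> \<kappa> * w' (X lam) * d \<le> lam - w t) \<and>
     (\<forall>t. X lam + d \<le> t \<longrightarrow> lam - w t \<le> - (\<kappa> * w' (X lam) * d))"

text \<open>
  Integrate the bounds on \<open>w'\<close> twice, starting from \<open>w x = lam\<close> and from the critical point of
  the phase. Outside the window monotonicity of the potential takes over.
\<close>

lemma parabolic_peak_exists:
  assumes \<kappa>: "0 < \<kappa>" "\<kappa> < 1"
  obtains \<theta> where "0 < \<theta>"
    "\<And>lam. 2 * Y < X lam \<Longrightarrow> w (X lam) = lam \<Longrightarrow> parabolic_peak \<kappa> (width \<theta> lam) lam"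
proof -
  obtain \<theta> where \<theta>: "0 < \<theta>" "\<theta> \<le> 1/2"
    "\<And>x y. 2 * Y < x \<Longrightarrow> \<bar>y - x\<bar> \<le> \<theta> * x powr (- \<nu>) \<Longrightarrow>
       x / 2 \<le> y \<and> \<kappa> * w' x \<le> w' y \<and> w' y \<le> w' x / \<kappa>"
    using slow_variation[OF \<kappa>] by blast
  show ?thesis
  proof (rule that[OF \<theta>(1)])
    fix lam assume X2: "2 * Y < X lam" and wX: "w (X lam) = lam"
    define x where "x = X lam"
    define m where "m = w' x"
    define d where "d = width \<theta> lam"
    have x: "2 * Y < x" "w x = lam" "1 < x" using X2 wX Y by (auto simp: x_def)
    have m: "0 < m" using w'_pos[of x] x Y by (auto simp: m_def)
    have "x powr (- \<nu>) \<le> x powr 1" using x nu by (intro powr_mono) auto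
    then have "\<theta> * x powr (- \<nu>) \<le> (1/2) * x" using \<theta> x by (intro mult_mono) auto
    then have d: "0 < d" "d \<le> x / 2" using \<theta> x by (auto simp: d_def width_def x_def)
    have near: "Y < x + s \<and> \<kappa> * m \<le> w' (x + s) \<and> w' (x + s) \<le> m / \<kappa>" if "\<bar>s\<bar> \<le> d" for s
      using \<theta>(3)[of x "x + s"] that x by (auto simp: m_def d_def width_def x_def)
    have Dw: "DERIV (\<lambda>s. w (x + s)) s :> w' (x + s)" if "\<bar>s\<bar> \<le> d" for s
      using DERIV_w[of "s + x"] near[OF that] DERIV_shift[of w "w' (s + x)" s x] by (simp add: add.commute)
    have DF: "DERIV (\<lambda>s. F lam (x + s)) s :> lam - w (x + s)" if "\<bar>s\<bar> \<le> d" for s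
      using DERIV_F[of "s + x" lam] near[OF that] DERIV_shift[of "F lam" "lam - w (s + x)" s x]
      by (simp add: add.commute)
    have Dlow: "DERIV (\<lambda>s. w (x + s) - \<kappa> * m * s) s :> w' (x + s) - \<kappa> * m"
      and Dupp: "DERIV (\<lambda>s. m / \<kappa> * s - w (x + s)) s :> m / \<kappa> - w' (x + s)" if "\<bar>s\<bar> \<le> d" for s
      using Dw[OF that] \<kappa> by (auto intro!: derivative_eq_intros)
    have nonneg_slopes: "0 \<le> w' (x + s) - \<kappa> * m" "0 \<le> m / \<kappa> - w' (x + s)" if "\<bar>s\<bar> \<le> d" for s
      using near[OF that] by auto
    \<comment> \<open>The two bounds on \<open>w\<close> change places between the right and the left of the turning point, because \<open>s\<close> changes sign.\<close>
    have up: "\<kappa> * m * s \<le> w (x + s) - lam \<and> w (x + s) - lam \<le> m / \<kappa> * s" if "0 \<le> s" "s \<le> d" for s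
    proof -
      have "w (x + 0) - \<kappa> * m * 0 \<le> w (x + s) - \<kappa> * m * s"
        by (rule DERIV_nonneg_imp_nondecreasing[OF that(1), where f = "\<lambda>s. w (x + s) - \<kappa> * m * s"])
           (intro exI conjI, rule Dlow, (use that in linarith), rule nonneg_slopes(1), use that in linarith)
      moreover have "m / \<kappa> * 0 - w (x + 0) \<le> m / \<kappa> * s - w (x + s)"
        by (rule DERIV_nonneg_imp_nondecreasing[OF that(1), where f = "\<lambda>s. m / \<kappa> * s - w (x + s)"])
           (intro exI conjI, rule Dupp, (use that in linarith), rule nonneg_slopes(2), use that in linarith)
      ultimately show ?thesis using x by simp
    qed
    have down: "m / \<kappa> * s \<le> w (x + s) - lam \<and> w (x + s) - lam \<le> \<kappa> * m * s" if "s \<le> 0" "- d \<le> s" for s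
    proof -
      have "w (x + s) - \<kappa> * m * s \<le> w (x + 0) - \<kappa> * m * 0"
        by (rule DERIV_nonneg_imp_nondecreasing[OF that(1), where f = "\<lambda>s. w (x + s) - \<kappa> * m * s"])
           (intro exI conjI, rule Dlow, (use that in linarith), rule nonneg_slopes(1), use that in linarith)
      moreover have "m / \<kappa> * s - w (x + s) \<le> m / \<kappa> * 0 - w (x + 0)"
        by (rule DERIV_nonneg_imp_nondecreasing[OF that(1), where f = "\<lambda>s. m / \<kappa> * s - w (x + s)"])
           (intro exI conjI, rule Dupp, (use that in linarith), rule nonneg_slopes(2), use that in linarith)
      ultimately show ?thesis using x by simp
    qed
    have peak: "F lam x - m / (2 * \<kappa>) * s\<^sup>2 \<le> F lam (x + s) \<and>
         F lam (x + s) \<le> F lam x - \<kappa> * m / 2 * s\<^sup>2" if "\<bar>s\<bar> \<le> d" for s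
    proof -
      let ?u = "\<lambda>s. F lam (x + s) + \<kappa> * m / 2 * s\<^sup>2"
      let ?v = "\<lambda>s. F lam (x + s) + m / (2 * \<kappa>) * s\<^sup>2"
      have Du: "DERIV ?u s :> (lam - w (x + s)) + \<kappa> * m * s" if "\<bar>s\<bar> \<le> d" for s
        using DF[OF that] by (auto intro!: derivative_eq_intros)
      have Dv: "DERIV ?v s :> (lam - w (x + s)) + m / \<kappa> * s" if "\<bar>s\<bar> \<le> d" for s
        using DF[OF that] \<kappa> by (auto intro!: derivative_eq_intros simp: field_simps)
      show ?thesis
      proof (cases "0 \<le> s")
        case True
        have "?u s \<le> ?u 0"
        proof (rule DERIV_nonpos_imp_nonincreasing[OF True])
          fix z assume z: "0 \<le> z" "z \<le> s"
          then show "\<exists>y. DERIV ?u z :> y \<and> y \<le> 0"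
            using up[of z] Du[of z] True that by (intro exI[of _ "(lam - w (x + z)) + \<kappa> * m * z"]) auto
        qed
        moreover have "?v 0 \<le> ?v s"
        proof (rule DERIV_nonneg_imp_nondecreasing[OF True])
          fix z assume z: "0 \<le> z" "z \<le> s"
          then show "\<exists>y. DERIV ?v z :> y \<and> 0 \<le> y"
            using up[of z] Dv[of z] True that by (intro exI[of _ "(lam - w (x + z)) + m / \<kappa> * z"]) auto
        qed
        ultimately show ?thesis by simp
      next
        case False
        then have s: "s \<le> 0" by simp
        have "?u s \<le> ?u 0"
        proof (rule DERIV_nonneg_imp_nondecreasing[OF s])
          fix z assume z: "s \<le> z" "z \<le> 0"
          then show "\<exists>y. DERIV ?u z :> y \<and> 0 \<le> y"
            using down[of z] Du[of z] s that by (intro exI[of _ "(lam - w (x + z)) + \<kappa> * m * z"]) auto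
        qed
        moreover have "?v 0 \<le> ?v s"
        proof (rule DERIV_nonpos_imp_nonincreasing[OF s])
          fix z assume z: "s \<le> z" "z \<le> 0"
          then show "\<exists>y. DERIV ?v z :> y \<and> y \<le> 0"
            using down[of z] Dv[of z] s that by (intro exI[of _ "(lam - w (x + z)) + m / \<kappa> * z"]) auto
        qed
        ultimately show ?thesis by simp
      qed
    qed
    have left: "\<kappa> * m * d \<le> lam - w t" if "0 \<le> t" "t \<le> x - d" for t
    proof -
      have "w t \<le> w (x - d)" using that d x by (intro mono) auto
      then show ?thesis using down[of "- d"] d by (auto simp: algebra_simps)
    qed
    have right: "lam - w t \<le> - (\<kappa> * m * d)" if "x + d \<le> t" for t
    proof -
      have "w (x + d) \<le> w t" using that d x Y by (intro mono) auto
      then show ?thesis using up[of d] d by auto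
    qed
    show "parabolic_peak \<kappa> (width \<theta> lam) lam"
      unfolding parabolic_peak_def
      unfolding x_def[symmetric] d_def[symmetric] m_def[symmetric]
      using d peak left right by blast
  qed
qed

definition peak_integral :: "real \<Rightarrow> real \<Rightarrow> ennreal" where
  "peak_integral a lam = (\<integral>\<^sup>+t. ennreal (exp (a * F lam t)) * indicator {0..} t \<partial>lborel)"

text \<open>
  This is where \<open>\<Upsilon>\<^sub>1 \<longlongrightarrow> 0\<close> enters: the expression is
  \<open>\<theta> / \<Upsilon>\<^sub>1\<close> at the turning point. It compares the window with the width
  \<open>w' powr (-1/2)\<close> of the Gaussian.
\<close>

lemma filterlim_width:
  assumes "0 < \<theta>"
  shows "filterlim (\<lambda>lam. sqrt (w' (X lam)) * width \<theta> lam) at_top at_top"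
proof -
  have "((\<lambda>lam. X lam powr \<nu> * w' (X lam) powr (-1/2)) \<longlongrightarrow> 0) at_top"
    by (rule filterlim_compose[OF Upsilon filterlim_X])
  moreover have pos: "\<forall>\<^sub>F lam in at_top. 0 < X lam powr \<nu> * w' (X lam) powr (-1/2)"
    using eventually_X
  proof eventually_elim
    case (elim lam)
    then have "0 < w' (X lam)" "0 < X lam" using w'_pos[of "X lam"] Y by auto
    then show ?case by simp
  qed
  ultimately have "filterlim (\<lambda>lam. inverse (X lam powr \<nu> * w' (X lam) powr (-1/2))) at_top at_top"
    by (intro filterlim_inverse_at_top)
  then have "filterlim (\<lambda>lam. \<theta> * inverse (X lam powr \<nu> * w' (X lam) powr (-1/2))) at_top at_top"
    by (rule filterlim_tendsto_pos_mult_at_top[OF tendsto_const assms])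
  moreover have "\<forall>\<^sub>F lam in at_top. \<theta> * inverse (X lam powr \<nu> * w' (X lam) powr (-1/2)) = sqrt (w' (X lam)) * width \<theta> lam"
    using eventually_X
  proof eventually_elim
    case (elim lam)
    then have "0 < w' (X lam)" using w'_pos Y by auto
    then show ?case by (simp add: width_def powr_minus powr_half_sqrt)
  qed
  ultimately show ?thesis by (subst (asm) filterlim_cong[OF refl refl]) auto
qed

lemma eventually_X_gt: "\<forall>\<^sub>F lam in at_top. 2 * Y < X lam \<and> w (X lam) = lam \<and> 0 < w' (X lam)"
proof -
  have "\<forall>\<^sub>F lam in at_top. 2 * Y < X lam"
    using filterlim_X by (simp add: filterlim_at_top_dense)
  with eventually_X show ?thesis
    by eventually_elim (use w'_pos Y in auto)
qed

context
  fixes lam \<kappa> d assumes \<kappa>: "0 < \<kappa>" "\<kappa> < 1" and X_gt: "2 * Y < X lam" and w_X: "w (X lam) = lam"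
    and peak: "parabolic_peak \<kappa> d lam"
begin

lemma peak_integral_upper:
  assumes a: "0 < a"
  shows "peak_integral a lam \<le> ennreal (exp (a * F lam (X lam)) / sqrt (w' (X lam)) *
        (sqrt (2 * pi / a / \<kappa>) + 2 / (a * \<kappa> * (sqrt (w' (X lam)) * d))))"
proof -
  define x where "x = X lam"
  define m where "m = w' x"
  have m: "0 < m" using w'_pos[of x] X_gt Y by (auto simp: m_def x_def)
  note p = peak[unfolded parabolic_peak_def, folded x_def, folded m_def]
  let ?r = "\<kappa> * m * d"
  have bound: "peak_integral a lam \<le> ennreal (exp (a * F lam x) * (sqrt (pi / (a * (\<kappa> * m / 2))) + 2 / (a * ?r)))"
    unfolding peak_integral_def
  proof (rule laplace_upper_bound[where \<delta> = d])
    show "F lam (x + s) \<le> F lam x - \<kappa> * m / 2 * s\<^sup>2" if "\<bar>s\<bar> \<le> d" for s using p that by blast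
    have nonneg: "0 \<le> \<kappa> * m / 2 * s\<^sup>2" for s using \<kappa> m by simp
    fix t assume t: "0 \<le> t" "t \<le> x - d"
    have "?r * (x - d - t) \<le> F lam (x - d) - F lam t"
      using p t by (intro F_lower) auto
    moreover have "F lam (x + - d) \<le> F lam x - \<kappa> * m / 2 * (- d)\<^sup>2"
      using p by (metis abs_minus_cancel abs_of_pos order_refl)
    ultimately show "F lam t \<le> F lam x - ?r * (x - d - t)" using nonneg[of "- d"] by simp
  next
    fix t assume t: "x + d \<le> t"
    have "F lam t - F lam (x + d) \<le> - ?r * (t - (x + d))"
      using p t by (intro F_upper) auto
    moreover have "F lam (x + d) \<le> F lam x - \<kappa> * m / 2 * d\<^sup>2"
      using p by (metis abs_of_pos order_refl)
    moreover have "0 \<le> \<kappa> * m / 2 * d\<^sup>2" using \<kappa> m by simp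
    ultimately show "F lam t \<le> F lam x - ?r * (t - (x + d))" by simp
  qed (use a \<kappa> m p in auto)
  have "sqrt (pi / (a * (\<kappa> * m / 2))) = sqrt (2 * pi / a / \<kappa>) / sqrt m"
    by (simp add: real_sqrt_divide[symmetric] mult_ac)
  moreover have "a * ?r = a * \<kappa> * (sqrt m * d) * sqrt m"
  proof -
    have "a * (\<kappa> * (sqrt m * sqrt m) * d) = a * \<kappa> * (sqrt m * d) * sqrt m" by (simp only: mult_ac)
    then show ?thesis using m by simp
  qed
  moreover have "E * (A / s + B / (D * s)) = E / s * (A + B / D)" for E A B D s :: real
    by (simp add: distrib_left)
  ultimately have "exp (a * F lam x) * (sqrt (pi / (a * (\<kappa> * m / 2))) + 2 / (a * ?r))
     = exp (a * F lam x) / sqrt m * (sqrt (2 * pi / a / \<kappa>) + 2 / (a * \<kappa> * (sqrt m * d)))"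
    by (simp only:)
  with bound show ?thesis by (simp add: x_def m_def)
qed

lemma peak_integral_lower:
  assumes a: "0 < a"
  shows "ennreal (exp (a * F lam (X lam)) / sqrt (w' (X lam)) *
        (sqrt (2 * pi / a * \<kappa>) - 4 * \<kappa> / (a * (sqrt (w' (X lam)) * d)))) \<le> peak_integral a lam"
proof -
  define x where "x = X lam"
  define m where "m = w' x"
  have m: "0 < m" using w'_pos[of x] X_gt Y by (auto simp: m_def x_def)
  have x: "0 < x" using X_gt Y by (auto simp: x_def)
  note p = peak[unfolded parabolic_peak_def, folded x_def, folded m_def]
  let ?b = "m / (2 * \<kappa>)"
  have bound: "ennreal (exp (a * F lam x) * (sqrt (pi / (a * ?b)) - 2 / (a * ?b * d))) \<le> peak_integral a lam"
    unfolding peak_integral_def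
    by (rule laplace_lower_bound) (use a \<kappa> m p x in auto)
  have "sqrt (pi / (a * ?b)) = sqrt (2 * pi / a * \<kappa>) / sqrt m"
    by (simp add: real_sqrt_divide[symmetric] mult_ac)
  moreover have "2 / (a * ?b * d) = 4 * \<kappa> / (a * (sqrt m * d) * sqrt m)"
  proof -
    have "a * (sqrt m * d) * sqrt m = a * (sqrt m * sqrt m) * d" by (simp only: mult_ac)
    also have "\<dots> = a * m * d" using m by simp
    finally show ?thesis using \<kappa> m by simp
  qed
  moreover have "E * (A / s - B / (D * s)) = E / s * (A - B / D)" for E A B D s :: real
    by (simp add: right_diff_distrib)
  ultimately have "exp (a * F lam x) * (sqrt (pi / (a * ?b)) - 2 / (a * ?b * d))
     = exp (a * F lam x) / sqrt m * (sqrt (2 * pi / a * \<kappa>) - 4 * \<kappa> / (a * (sqrt m * d)))"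
    by (simp only:)
  with bound show ?thesis by (simp add: x_def m_def)
qed

text \<open>
  To the left of the window the slope is at least \<open>\<kappa> * w' * d\<close>, over a length that is at
  least \<open>d\<close>.
\<close>

lemma F_peak_bound: "\<kappa> * (sqrt (w' (X lam)) * d)\<^sup>2 \<le> F lam (X lam)"
proof -
  define x where "x = X lam"
  define m where "m = w' x"
  have m: "0 < m" using w'_pos[of x] X_gt Y by (auto simp: m_def x_def)
  note p = peak[unfolded parabolic_peak_def, folded x_def, folded m_def]
  have "\<kappa> * m * d * (x - d - 0) \<le> F lam (x - d) - F lam 0"
    using p by (intro F_lower) auto
  moreover have "0 * (x - (x - d)) \<le> F lam x - F lam (x - d)"
  proof (rule F_lower)
    fix t assume t: "x - d \<le> t" "t \<le> x"
    have "w t \<le> w x" using t p X_gt Y by (intro mono) (auto simp: x_def)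
    then show "0 \<le> lam - w t" using w_X by (simp add: x_def)
  qed (use p in auto)
  moreover have "\<kappa> * m * d * d \<le> \<kappa> * m * d * (x - d - 0)"
    using p m \<kappa> by (intro mult_left_mono) auto
  moreover have "\<kappa> * (sqrt m * d)\<^sup>2 = \<kappa> * m * d * d"
    using m by (simp add: power_mult_distrib power2_eq_square)
  moreover have "F lam 0 = 0" by simp
  ultimately have "\<kappa> * (sqrt m * d)\<^sup>2 \<le> F lam x" by linarith
  then show ?thesis by (simp only: x_def m_def)
qed

end

lemma filterlim_F_peak: "filterlim (\<lambda>lam. F lam (X lam)) at_top at_top"
proof -
  have half: "(0::real) < 1/2" "1/2 < (1::real)" by auto
  obtain \<theta> where \<theta>: "0 < \<theta>"
    "\<And>lam. 2 * Y < X lam \<Longrightarrow> w (X lam) = lam \<Longrightarrow> parabolic_peak (1/2) (width \<theta> lam) lam"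
    using parabolic_peak_exists[OF half] by blast
  have "filterlim (\<lambda>lam. 1/2 * ((sqrt (w' (X lam)) * width \<theta> lam)\<^sup>2)) at_top at_top"
    by (intro filterlim_tendsto_pos_mult_at_top[OF tendsto_const] filterlim_pow_at_top filterlim_width \<theta>) auto
  moreover have "\<forall>\<^sub>F lam in at_top. 1/2 * (sqrt (w' (X lam)) * width \<theta> lam)\<^sup>2 \<le> F lam (X lam)"
    using eventually_X_gt by eventually_elim (use F_peak_bound[OF half _ _ \<theta>(2)] in blast)
  ultimately show ?thesis by (rule filterlim_at_top_mono)
qed

end

lemma tendsto_if_eventually_near:
  fixes f :: "'a \<Rightarrow> real"
  assumes "\<And>e. 0 < e \<Longrightarrow> \<forall>\<^sub>F x in G. l - e < f x" "\<And>e. 0 < e \<Longrightarrow> \<forall>\<^sub>F x in G. f x < l + e"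
  shows "(f \<longlongrightarrow> l) G"
proof (rule order_tendstoI)
  fix a assume "a < l"
  then show "\<forall>\<^sub>F x in G. a < f x" using assms(1)[of "l - a"] by simp
next
  fix a assume "l < a"
  then show "\<forall>\<^sub>F x in G. f x < a" using assms(2)[of "a - l"] by simp
qed

context confining_potential
begin

lemma sqrt_times_near_1:
  fixes c e :: real
  assumes "0 < c" "0 < e"
  obtains \<kappa> where "0 < \<kappa>" "\<kappa> < 1" "sqrt (c / \<kappa>) < sqrt c + e" "sqrt c - e < sqrt (c * \<kappa>)"
proof -
  have t: "((\<lambda>\<kappa>. sqrt (c / \<kappa>)) \<longlongrightarrow> sqrt (c / 1)) (at_left 1)" "((\<lambda>\<kappa>. sqrt (c * \<kappa>)) \<longlongrightarrow> sqrt (c * 1)) (at_left 1)"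
    by (intro tendsto_intros; simp)+
  have "\<forall>\<^sub>F \<kappa> in at_left 1. sqrt (c / \<kappa>) < sqrt c + e" "\<forall>\<^sub>F \<kappa> in at_left 1. sqrt c - e < sqrt (c * \<kappa>)"
    using order_tendstoD(2)[OF t(1), of "sqrt c + e"] order_tendstoD(1)[OF t(2), of "sqrt c - e"] assms by auto
  moreover have "\<forall>\<^sub>F \<kappa> in at_left (1::real). 0 < \<kappa> \<and> \<kappa> < 1"
    by (rule eventually_at_leftI[of 0]) auto
  ultimately have "\<forall>\<^sub>F \<kappa> in at_left 1. 0 < \<kappa> \<and> \<kappa> < 1 \<and> sqrt (c / \<kappa>) < sqrt c + e \<and> sqrt c - e < sqrt (c * \<kappa>)"
    by eventually_elim auto
  from eventually_happens[OF this] show ?thesis using that by auto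
qed

text \<open>
  For every \<open>\<kappa> < 1\<close> the upper and the lower bound of Laplace's method hold eventually,
  with corrections that vanish because the window becomes wide; \<open>\<kappa>\<close> is then taken close
  to \<open>1\<close>.
\<close>

lemma peak_integral_tendsto:
  assumes a: "0 < a"
  shows "((\<lambda>lam. sqrt (w' (X lam)) * exp (- a * F lam (X lam)) * enn2real (peak_integral a lam)) \<longlongrightarrow> sqrt (2 * pi / a)) at_top"
    and "\<forall>\<^sub>F lam in at_top. peak_integral a lam < \<infinity>"
proof -
  let ?c = "2 * pi / a"
  let ?R = "\<lambda>lam. sqrt (w' (X lam)) * exp (- a * F lam (X lam)) * enn2real (peak_integral a lam)"
  have main: "\<forall>\<^sub>F lam in at_top. peak_integral a lam < \<infinity> \<and> ?R lam < sqrt ?c + e \<and> sqrt ?c - e < ?R lam" if e: "0 < e" for e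
  proof -
    obtain \<kappa> where \<kappa>: "0 < \<kappa>" "\<kappa> < 1" "sqrt (?c / \<kappa>) < sqrt ?c + e" "sqrt ?c - e < sqrt (?c * \<kappa>)"
      using sqrt_times_near_1[of ?c e] a e by auto
    obtain \<theta> where \<theta>: "0 < \<theta>" and peak: "\<And>lam. 2 * Y < X lam \<Longrightarrow> w (X lam) = lam \<Longrightarrow> parabolic_peak \<kappa> (width \<theta> lam) lam"
      using parabolic_peak_exists[OF \<kappa>(1,2)] by blast
    let ?\<tau> = "\<lambda>lam. sqrt (w' (X lam)) * width \<theta> lam"
    note W = filterlim_width[OF \<theta>]
    let ?U = "\<lambda>lam. sqrt (?c / \<kappa>) + 2 / (a * \<kappa>) * inverse (?\<tau> lam)"
    let ?L = "\<lambda>lam. sqrt (?c * \<kappa>) - 4 * \<kappa> / a * inverse (?\<tau> lam)"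
    have t: "(?U \<longlongrightarrow> sqrt (?c / \<kappa>) + 2 / (a * \<kappa>) * 0) at_top" "(?L \<longlongrightarrow> sqrt (?c * \<kappa>) - 4 * \<kappa> / a * 0) at_top"
      by (intro tendsto_intros tendsto_inverse_0_at_top W)+
    have "\<forall>\<^sub>F lam in at_top. ?U lam < sqrt ?c + e"
      by (rule order_tendstoD(2)[OF t(1)]) (use \<kappa> in simp)
    moreover have "\<forall>\<^sub>F lam in at_top. sqrt ?c - e < ?L lam"
      by (rule order_tendstoD(1)[OF t(2)]) (use \<kappa> in simp)
    moreover have "\<forall>\<^sub>F lam in at_top. 0 < ?\<tau> lam"
      using W by (simp add: filterlim_at_top_dense)
    ultimately show ?thesis using eventually_X_gt
    proof eventually_elim
      case (elim lam)
      define U where "U = ?U lam"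
      define L where "L = ?L lam"
      let ?E = "exp (a * F lam (X lam)) / sqrt (w' (X lam))"
      have E: "0 < ?E" using elim by simp
      have cancel: "sqrt (w' (X lam)) * exp (- a * F lam (X lam)) * (?E * z) = z" for z
        using elim by (simp add: exp_minus)
      have "0 < inverse (?\<tau> lam)" using elim by (simp only: positive_imp_inverse_positive)
      then have U0: "0 \<le> U"
        unfolding U_def using a \<kappa> by (intro add_nonneg_nonneg mult_nonneg_nonneg less_imp_le) auto
      note pk = \<kappa>(1,2) conjunct1[OF elim(4)] conjunct1[OF conjunct2[OF elim(4)]] peak
      have "peak_integral a lam \<le> ennreal (?E * (sqrt (?c / \<kappa>) + 2 / (a * \<kappa> * ?\<tau> lam)))"
        by (rule peak_integral_upper[OF _ _ _ _ _ a]) (use pk in blast)+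
      then have up: "peak_integral a lam \<le> ennreal (?E * U)"
        by (simp add: U_def divide_inverse mult.assoc)
      then have fin: "peak_integral a lam < \<infinity>" by (simp add: le_less_trans)
      have "enn2real (peak_integral a lam) \<le> ?E * U" using up U0 by (intro enn2real_leI mult_nonneg_nonneg less_imp_le[OF E]) auto
      then have "?R lam \<le> sqrt (w' (X lam)) * exp (- a * F lam (X lam)) * (?E * U)"
        using elim by (intro mult_left_mono) auto
      then have R_le: "?R lam \<le> U" unfolding cancel .
      have "ennreal (?E * (sqrt (?c * \<kappa>) - 4 * \<kappa> / (a * ?\<tau> lam))) \<le> peak_integral a lam"
        by (rule peak_integral_lower[OF _ _ _ _ _ a]) (use pk in blast)+
      then have "ennreal (?E * L) \<le> ennreal (enn2real (peak_integral a lam))"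
        using fin by (simp add: L_def divide_inverse mult.assoc)
      then have "?E * L \<le> enn2real (peak_integral a lam)" by (subst (asm) ennreal_le_iff) auto
      then have "sqrt (w' (X lam)) * exp (- a * F lam (X lam)) * (?E * L) \<le> ?R lam"
        using elim by (intro mult_left_mono) auto
      then have "L \<le> ?R lam" unfolding cancel .
      then show ?case using elim(1,2) R_le fin unfolding U_def L_def by linarith
    qed
  qed
  show "\<forall>\<^sub>F lam in at_top. peak_integral a lam < \<infinity>"
    using main[OF zero_less_one] by eventually_elim simp
  show "(?R \<longlongrightarrow> sqrt ?c) at_top"
  proof (rule tendsto_if_eventually_near)
    fix e :: real assume "0 < e"
    from main[OF this] show "\<forall>\<^sub>F lam in at_top. ?R lam < sqrt ?c + e" "\<forall>\<^sub>F lam in at_top. sqrt ?c - e < ?R lam"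
      by (eventually_elim, simp)+
  qed
qed

section \<open>The kernel on the positive half line\<close>

definition forward_kernel :: "real \<Rightarrow> real \<Rightarrow> real \<Rightarrow> real" where
  "forward_kernel lam x t = (if 0 \<le> x \<and> x < t then exp (F lam t - F lam x) else 0)"

lemma forward_kernel_nonneg: "0 \<le> forward_kernel lam x t"
  by (simp add: forward_kernel_def)

lemma measurable_forward_kernel[measurable]:
  "(\<lambda>(x, t). forward_kernel lam x t) \<in> borel_measurable (lborel \<Otimes>\<^sub>M lborel)"
  unfolding forward_kernel_def by measurable

context
  fixes lam assumes X_gt: "2 * Y < X lam" and w_X: "w (X lam) = lam"
begin

lemma X_pos: "0 < X lam" "Y < X lam" using X_gt Y by auto

lemma w_le_lam: "\<bar>t\<bar> \<le> X lam \<Longrightarrow> w t \<le> lam"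
  using mono[of t "X lam"] X_pos w_X by simp

lemma w_ge_lam: "X lam \<le> t \<Longrightarrow> lam \<le> w t"
  using mono[of "X lam" t] X_pos w_X by simp

lemma F_nonneg: "0 \<le> x \<Longrightarrow> x \<le> X lam \<Longrightarrow> 0 \<le> F lam x"
  using F_lower[of 0 x 0 lam] w_le_lam by simp

lemma F_le_peak: "0 \<le> x \<Longrightarrow> F lam x \<le> F lam (X lam)"
  using F_lower[of x "X lam" 0 lam] F_upper[of "X lam" x lam 0] w_le_lam w_ge_lam
  by (cases "x \<le> X lam") auto

text \<open>
  To the right of the turning point the phase is concave, so it falls fastest farthest out.
\<close>

lemma F_increment_le_peak_increment:
  assumes "X lam \<le> x" "0 \<le> s"
  shows "F lam (x + s) - F lam x \<le> F lam (X lam + s) - F lam (X lam)"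
proof -
  let ?D = "\<lambda>s. F lam (X lam + s) - F lam (x + s)"
  have "?D 0 \<le> ?D s"
  proof (rule DERIV_nonneg_imp_nondecreasing[OF assms(2)])
    fix r assume r: "0 \<le> r" "r \<le> s"
    have "DERIV ?D r :> (lam - w (r + X lam)) - (lam - w (r + x))"
      using r assms X_pos DERIV_F[of "r + X lam" lam] DERIV_F[of "r + x" lam]
        DERIV_shift[of "F lam" "lam - w (r + X lam)" r "X lam"] DERIV_shift[of "F lam" "lam - w (r + x)" r x]
      by (intro DERIV_diff) (auto simp: add.commute)
    moreover have "w (r + X lam) \<le> w (r + x)"
      using r assms X_pos by (intro mono) auto
    ultimately show "\<exists>y. DERIV ?D r :> y \<and> 0 \<le> y" by force
  qed
  then show ?thesis by simp
qed

text \<open>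
  For \<open>x\<close> before the turning point \<open>F x\<close> is nonnegative and can be dropped; beyond it the
  integrand is compared with its translate that starts at the turning point.
\<close>

lemma forward_kernel_row: "(\<integral>\<^sup>+t. ennreal (forward_kernel lam x t) \<partial>lborel) \<le> peak_integral 1 lam"
proof -
  consider "x < 0" | "0 \<le> x" "x \<le> X lam" | "X lam < x" by linarith
  then show ?thesis
  proof cases
    case 1 then show ?thesis by (simp add: forward_kernel_def)
  next
    case 2
    then show ?thesis unfolding peak_integral_def
      using F_nonneg[OF 2]
      by (intro nn_integral_mono) (auto simp: forward_kernel_def indicator_def intro!: ennreal_leI)
  next
    case 3
    have "(\<integral>\<^sup>+t. ennreal (forward_kernel lam x t) \<partial>lborel) = (\<integral>\<^sup>+s. ennreal (forward_kernel lam x (x + 1 * s)) \<partial>lborel)"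
      by (subst nn_integral_real_affine[of _ 1 x]) auto
    also have "\<dots> \<le> (\<integral>\<^sup>+s. ennreal (exp (1 * F lam (X lam + 1 * s))) * indicator {0..} (X lam + 1 * s) \<partial>lborel)"
    proof (intro nn_integral_mono)
      fix s
      show "ennreal (forward_kernel lam x (x + 1 * s)) \<le> ennreal (exp (1 * F lam (X lam + 1 * s))) * indicator {0..} (X lam + 1 * s)"
        using F_increment_le_peak_increment[of x s] 3 F_nonneg[of "X lam"] X_pos
        by (auto simp: forward_kernel_def indicator_def intro!: ennreal_leI)
    qed
    also have "\<dots> = peak_integral 1 lam"
      unfolding peak_integral_def by (subst (2) nn_integral_real_affine[of _ 1 "X lam"]) auto
    finally show ?thesis .
  qed
qed

text \<open>
  The variable \<open>x\<close> runs through three zones. On the first, \<open>F x \<ge> r * x\<close> gives an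
  exponential integral; the second is the left half of the window, where \<open>F\<close> has grown to at
  least \<open>r * X lam / 2\<close>, so that \<open>exp (- F)\<close> times the length \<open>d\<close> is small; on the third, beyond
  the turning point, concavity gives back the row integral.
\<close>

lemma forward_kernel_column:
  assumes r: "0 < r" and d: "0 < d" "d \<le> X lam / 2"
    and slope: "\<And>t. 0 \<le> t \<Longrightarrow> t \<le> X lam - d \<Longrightarrow> r \<le> lam - w t"
  shows "(\<integral>\<^sup>+x. ennreal (forward_kernel lam x t) \<partial>lborel)
    \<le> ennreal (exp (F lam (X lam)) * (2 / r)) + peak_integral 1 lam"
proof -
  let ?x = "X lam"
  let ?E = "exp (F lam ?x)"
  let ?A = "\<lambda>x. ennreal ?E * (ennreal (exp (- r * (x - 0))) * indicator {0..} x)"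
  let ?B = "\<lambda>x. ennreal (?E * (2 / (r * ?x))) * indicator {?x - d..?x} x"
  let ?C = "\<lambda>x. ennreal (exp (1 * F lam ((?x + t) + (-1) * x))) * indicator {0..} ((?x + t) + (-1) * x)"
  have F_slope: "r * x \<le> F lam x" if "0 \<le> x" "x \<le> ?x - d" for x
    using F_lower[of 0 x r lam] slope that by simp
  have "(\<integral>\<^sup>+x. ennreal (forward_kernel lam x t) \<partial>lborel) \<le> (\<integral>\<^sup>+x. ?A x + ?B x + ?C x \<partial>lborel)"
  proof (rule nn_integral_mono)
    fix x
    consider "\<not> (0 \<le> x \<and> x < t)" | "0 \<le> x" "x < t" "x \<le> ?x - d" | "0 \<le> x" "x < t" "?x - d < x" "x \<le> ?x"
      | "0 \<le> x" "x < t" "?x < x" by linarith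
    then show "ennreal (forward_kernel lam x t) \<le> ?A x + ?B x + ?C x"
    proof cases
      case 1
      then have "forward_kernel lam x t = 0" by (auto simp: forward_kernel_def)
      then show ?thesis by simp
    next
      case 2
      have "exp (F lam t - F lam x) \<le> ?E * exp (- r * (x - 0))"
        using F_slope[of x] F_le_peak[of t] 2 by (simp flip: exp_add)
      then have "ennreal (forward_kernel lam x t) \<le> ?A x"
        using 2 by (auto simp: forward_kernel_def ennreal_mult[symmetric] intro!: ennreal_leI)
      then show ?thesis by (metis add_increasing2 zero_le)
    next
      case 3
      have "r * (?x / 2) \<le> r * (?x - d)" using r d by (intro mult_left_mono) auto
      also have "\<dots> \<le> F lam (?x - d)" using d X_pos by (intro F_slope) auto
      also have "\<dots> \<le> F lam x"
        using F_lower[of "?x - d" x 0 lam] w_le_lam 3 d X_pos by auto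
      finally have y: "r * ?x / 2 \<le> F lam x" by simp
      have "exp (- F lam x) \<le> 2 / (r * ?x)"
      proof -
        have "0 < r * ?x / 2" using r X_pos by simp
        moreover have "r * ?x / 2 \<le> exp (F lam x)" using y exp_ge_add_one_self[of "F lam x"] by linarith
        ultimately have "inverse (exp (F lam x)) \<le> inverse (r * ?x / 2)" by (intro le_imp_inverse_le)
        then show ?thesis by (simp add: exp_minus)
      qed
      then have "exp (F lam t) * exp (- F lam x) \<le> ?E * (2 / (r * ?x))"
        using F_le_peak[of t] 3 by (intro mult_mono) auto
      then have "ennreal (forward_kernel lam x t) \<le> ?B x"
        using 3 by (auto simp: forward_kernel_def exp_diff exp_minus divide_inverse intro!: ennreal_leI)
      then show ?thesis by (metis add_increasing add_increasing2 zero_le)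
    next
      case 4
      have "F lam t - F lam x \<le> F lam (?x + (t - x))"
        using F_increment_le_peak_increment[of x "t - x"] 4 F_nonneg[of ?x] X_pos by simp
      then have "ennreal (forward_kernel lam x t) \<le> ?C x"
        using 4 X_pos by (auto simp: forward_kernel_def algebra_simps intro!: ennreal_leI)
      then show ?thesis by (metis add_increasing zero_le)
    qed
  qed
  also have "\<dots> = (\<integral>\<^sup>+x. ?A x \<partial>lborel) + (\<integral>\<^sup>+x. ?B x \<partial>lborel) + (\<integral>\<^sup>+x. ?C x \<partial>lborel)"
    by (subst nn_integral_add; (subst nn_integral_add)?) simp_all
  also have "(\<integral>\<^sup>+x. ?A x \<partial>lborel) = ennreal ?E * ennreal (1 / r)"
    using nn_integral_exp_decay_right[OF r, of 0] by (subst nn_integral_cmult) auto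
  also have "(\<integral>\<^sup>+x. ?B x \<partial>lborel) = ennreal (?E * (2 / (r * ?x))) * ennreal d"
    using d by (subst nn_integral_cmult_indicator) auto
  also have "(\<integral>\<^sup>+x. ?C x \<partial>lborel) = peak_integral 1 lam"
    unfolding peak_integral_def by (subst (2) nn_integral_real_affine[of _ "-1" "?x + t"]) auto
  also have "ennreal ?E * ennreal (1 / r) + ennreal (?E * (2 / (r * ?x))) * ennreal d \<le> ennreal (?E * (2 / r))"
  proof -
    have "(2 / (r * ?x)) * d \<le> (2 / (r * ?x)) * (?x / 2)"
      using d r X_pos by (intro mult_left_mono) auto
    also have "\<dots> = 1 / r" using X_pos by simp
    finally have "?E * ((2 / (r * ?x)) * d) \<le> ?E * (1 / r)" by (intro mult_left_mono) auto
    moreover have "?E * (2 / r) = ?E * (1 / r) + ?E * (1 / r)"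
      by (simp add: add_divide_distrib[symmetric])
    ultimately have "?E * (1 / r) + ?E * (2 / (r * ?x)) * d \<le> ?E * (2 / r)"
      unfolding mult.assoc by (simp only: add_le_cancel_left)
    moreover have "ennreal ?E * ennreal (1 / r) + ennreal (?E * (2 / (r * ?x))) * ennreal d
        = ennreal (?E * (1 / r) + ?E * (2 / (r * ?x)) * d)"
      using r d X_pos by (simp add: ennreal_mult[symmetric] ennreal_plus[symmetric] del: ennreal_plus)
    ultimately show ?thesis by (simp add: ennreal_leI)
  qed
  finally show ?thesis by (simp add: add_right_mono)
qed

end

text \<open>
  Rows and columns are of order \<open>exp F\<close> over \<open>sqrt w'\<close> at the peak. The rank-one piece is of
  order \<open>exp (2 * F)\<close> over \<open>sqrt w'\<close>, so the bound is negligible in comparison. A fixed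
  \<open>\<kappa>\<close> is good enough here.
\<close>

lemma forward_kernel_schur_bound:
  obtains K where "0 < K" "\<forall>\<^sub>F lam in at_top. \<exists>\<alpha> \<beta>. 0 \<le> \<alpha> \<and> 0 \<le> \<beta> \<and>
    \<alpha> * \<beta> \<le> K * (exp (2 * F lam (X lam)) / w' (X lam)) \<and>
    (\<forall>x. (\<integral>\<^sup>+t. ennreal (forward_kernel lam x t) \<partial>lborel) \<le> ennreal \<alpha>) \<and>
    (\<forall>t. (\<integral>\<^sup>+x. ennreal (forward_kernel lam x t) \<partial>lborel) \<le> ennreal \<beta>)"
proof -
  have half: "(0::real) < 1/2" "1/2 < (1::real)" by auto
  obtain \<theta> where \<theta>: "0 < \<theta>" and peak: "\<And>lam. 2 * Y < X lam \<Longrightarrow> w (X lam) = lam \<Longrightarrow> parabolic_peak (1/2) (width \<theta> lam) lam"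
    using parabolic_peak_exists[OF half] by blast
  define c where "c = sqrt (2 * pi / 1) + 1"
  have c: "0 < c" by (simp add: c_def add_nonneg_pos)
  have "\<forall>\<^sub>F lam in at_top. sqrt (w' (X lam)) * exp (- 1 * F lam (X lam)) * enn2real (peak_integral 1 lam) < c"
    by (rule order_tendstoD(2)[OF peak_integral_tendsto(1)]) (auto simp: c_def)
  moreover have "\<forall>\<^sub>F lam in at_top. peak_integral 1 lam < \<infinity>"
    by (rule peak_integral_tendsto(2)) simp
  moreover have "\<forall>\<^sub>F lam in at_top. 1 < sqrt (w' (X lam)) * width \<theta> lam"
    using filterlim_width[OF \<theta>] by (simp add: filterlim_at_top_dense)
  ultimately have "\<forall>\<^sub>F lam in at_top. \<exists>\<alpha> \<beta>. 0 \<le> \<alpha> \<and> 0 \<le> \<beta> \<and>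
    \<alpha> * \<beta> \<le> (c * (4 + c)) * (exp (2 * F lam (X lam)) / w' (X lam)) \<and>
    (\<forall>x. (\<integral>\<^sup>+t. ennreal (forward_kernel lam x t) \<partial>lborel) \<le> ennreal \<alpha>) \<and>
    (\<forall>t. (\<integral>\<^sup>+x. ennreal (forward_kernel lam x t) \<partial>lborel) \<le> ennreal \<beta>)"
    using eventually_X_gt
  proof eventually_elim
    case (elim lam)
    then have X2: "2 * Y < X lam" and wX: "w (X lam) = lam" and m: "0 < w' (X lam)" by auto
    note sh = peak[OF X2 wX, unfolded parabolic_peak_def]
    let ?E = "exp (F lam (X lam))"
    let ?s = "sqrt (w' (X lam))"
    define e where "e = enn2real (peak_integral 1 lam)"
    have pe: "peak_integral 1 lam = ennreal e" using elim by (simp add: e_def)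
    let ?r = "1/2 * w' (X lam) * width \<theta> lam"
    have r: "0 < ?r" using m sh by simp
    have s: "0 < ?s" using m by simp
    have e: "0 \<le> e" "e \<le> c * (?E / ?s)"
      using elim s by (auto simp: e_def exp_minus field_simps less_imp_le)
    have "2 / ?r = 4 / (?s * width \<theta> lam) / ?s"
      using m sh by (simp add: field_simps)
    also have "\<dots> \<le> 4 / ?s"
      using s elim by (intro divide_right_mono) (auto simp: divide_le_eq)
    finally have "?E * (2 / ?r) \<le> ?E * (4 / ?s)" by (intro mult_left_mono) auto
    also have "\<dots> = 4 * (?E / ?s)" by simp
    finally have Er: "?E * (2 / ?r) \<le> 4 * (?E / ?s)" .
    show ?case
    proof (intro exI conjI allI)
      show "0 \<le> e" by (rule e)
      show "0 \<le> ?E * (2 / ?r) + e" using e r by simp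
      show "(\<integral>\<^sup>+t. ennreal (forward_kernel lam x t) \<partial>lborel) \<le> ennreal e" for x
        using forward_kernel_row[OF X2 wX] by (simp add: pe)
      show "(\<integral>\<^sup>+x. ennreal (forward_kernel lam x t) \<partial>lborel) \<le> ennreal (?E * (2 / ?r) + e)" for t
        using forward_kernel_column[OF X2 wX r, of "width \<theta> lam" t] sh e r
        by (simp add: pe ennreal_plus)
      have "?E * (2 / ?r) + e \<le> 4 * (?E / ?s) + c * (?E / ?s)"
        using e Er by linarith
      then have "e * (?E * (2 / ?r) + e) \<le> (c * (?E / ?s)) * (4 * (?E / ?s) + c * (?E / ?s))"
        by (intro mult_mono e(2)) (use e r c s in auto)
      also have "\<dots> = (c * (4 + c)) * ((?E / ?s) * (?E / ?s))"
      proof -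
        have "(c * q) * (4 * q + c * q) = (c * (4 + c)) * (q * q)" for q :: real
          by (simp add: algebra_simps)
        then show ?thesis .
      qed
      also have "(?E / ?s) * (?E / ?s) = exp (2 * F lam (X lam)) / w' (X lam)"
        using m by (simp add: exp_add[symmetric])
      finally show "e * (?E * (2 / ?r) + e) \<le> (c * (4 + c)) * (exp (2 * F lam (X lam)) / w' (X lam))" .
    qed
  qed
  then show ?thesis using c by (intro that[of "c * (4 + c)"]) auto
qed

end

section \<open>The integral operator on square integrable functions\<close>

text \<open>
  A substitute for Minkowski's inequality in which the weight \<open>\<eta>\<close> can be chosen afterwards.
\<close>

lemma weighted_square_sum:
  fixes a b :: ennreal and \<eta> :: real
  assumes "0 < \<eta>"
  shows "(a + b)\<^sup>2 \<le> ennreal (1 + \<eta>) * a\<^sup>2 + ennreal (1 + 1 / \<eta>) * b\<^sup>2"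
proof (cases a; cases b)
  fix x y assume *: "0 \<le> x" "a = ennreal x" "0 \<le> y" "b = ennreal y"
  have "0 \<le> (\<eta> * x - y)\<^sup>2 / \<eta>" using assms by simp
  also have "\<dots> = \<eta> * x\<^sup>2 - 2 * x * y + y\<^sup>2 / \<eta>"
    using assms by (simp add: power2_eq_square field_simps)
  finally have "(x + y)\<^sup>2 \<le> (1 + \<eta>) * x\<^sup>2 + (1 + 1 / \<eta>) * y\<^sup>2"
    by (simp add: power2_eq_square algebra_simps)
  then have "ennreal ((x + y)\<^sup>2) \<le> ennreal ((1 + \<eta>) * x\<^sup>2 + (1 + 1 / \<eta>) * y\<^sup>2)"
    by (rule ennreal_leI)
  also have "ennreal ((1 + \<eta>) * x\<^sup>2 + (1 + 1 / \<eta>) * y\<^sup>2) = ennreal (1 + \<eta>) * a\<^sup>2 + ennreal (1 + 1 / \<eta>) * b\<^sup>2"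
    using * assms by (subst ennreal_plus) (auto simp: ennreal_mult ennreal_power)
  finally show ?thesis using *
    by (simp add: ennreal_plus[symmetric] ennreal_power del: ennreal_plus)
qed (use assms in \<open>auto simp: power2_eq_square ennreal_mult_top ennreal_top_mult add_pos_pos\<close>)

context confining_potential
begin

definition resolvent_kernel :: "real \<Rightarrow> real \<Rightarrow> real \<Rightarrow> real" where
  "resolvent_kernel lam x t = (if x < t then exp (F lam t - F lam x) else 0)"

definition resolvent_majorant :: "real \<Rightarrow> (real \<Rightarrow> real) \<Rightarrow> real \<Rightarrow> ennreal" where
  "resolvent_majorant lam g x = (\<integral>\<^sup>+t. ennreal (resolvent_kernel lam x t * g t) \<partial>lborel)"

lemma measurable_resolvent_kernel[measurable]:
  "(\<lambda>(x, t). resolvent_kernel lam x t) \<in> borel_measurable (lborel \<Otimes>\<^sub>M lborel)"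
  unfolding resolvent_kernel_def by measurable

lemma resolvent_kernel_nonneg: "0 \<le> resolvent_kernel lam x t"
  by (simp add: resolvent_kernel_def)

lemma measurable_resolvent_majorant[measurable]:
  assumes [measurable]: "g \<in> borel_measurable lborel"
  shows "resolvent_majorant lam g \<in> borel_measurable lborel"
  unfolding resolvent_majorant_def by measurable

lemma peak_integral_reflect:
  "(\<integral>\<^sup>+x. ennreal (exp (- a * F lam x)) * indicator {..0} x \<partial>lborel) = peak_integral a lam"
proof -
  have "(\<integral>\<^sup>+x. ennreal (exp (- a * F lam x)) * indicator {..0} x \<partial>lborel)
    = (\<integral>\<^sup>+x. ennreal (exp (- a * F lam (0 + (-1) * x))) * indicator {..0} (0 + (-1) * x) \<partial>lborel)"
    by (subst nn_integral_real_affine[of _ "-1" 0]) auto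
  also have "\<dots> = peak_integral a lam"
    unfolding peak_integral_def by (intro nn_integral_cong) (auto simp: F_minus indicator_def)
  finally show ?thesis .
qed

text \<open>
  On \<open>x \<ge> 0\<close> only the forward kernel acts, and only on the right half \<open>gp\<close> of \<open>g\<close>. On
  \<open>x < 0\<close> the operator splits into the rank-one piece acting on \<open>gp\<close>, controlled by
  Cauchy-Schwarz, and the reflected transpose of the forward kernel acting on the left half
  \<open>gm\<close>.
\<close>

lemma resolvent_majorant_L2_bound:
  fixes g :: "real \<Rightarrow> real"
  assumes g[measurable]: "g \<in> borel_measurable lborel" and g0: "\<And>t. 0 \<le> g t"
    and I: "peak_integral 2 lam = ennreal I" "0 < I" and \<sigma>: "0 < \<sigma>" "\<alpha> * \<beta> \<le> ennreal (\<sigma>\<^sup>2)"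
    and row: "\<And>x. (\<integral>\<^sup>+t. ennreal (forward_kernel lam x t) \<partial>lborel) \<le> \<alpha>"
    and col: "\<And>t. (\<integral>\<^sup>+x. ennreal (forward_kernel lam x t) \<partial>lborel) \<le> \<beta>"
  shows "(\<integral>\<^sup>+x. (resolvent_majorant lam g x)\<^sup>2 \<partial>lborel) \<le> ennreal (I\<^sup>2 + I * \<sigma> + \<sigma>\<^sup>2) * (\<integral>\<^sup>+t. ennreal ((g t)\<^sup>2) \<partial>lborel)"
proof -
  define gp where "gp = (\<lambda>t. if 0 < t then g t else 0)"
  define gm where "gm = (\<lambda>t. if 0 < t then 0 else g t)"
  have [measurable]: "gp \<in> borel_measurable lborel" "gm \<in> borel_measurable lborel"
    unfolding gp_def gm_def by measurable
  have gp0: "0 \<le> gp t" and gm0: "0 \<le> gm t" for t by (auto simp: gp_def gm_def g0)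
  define backward_kernel where "backward_kernel = (\<lambda>x t. forward_kernel lam (- t) (- x))"
  have [measurable]: "(\<lambda>(x, t). backward_kernel x t) \<in> borel_measurable (lborel \<Otimes>\<^sub>M lborel)"
    unfolding backward_kernel_def forward_kernel_def by measurable
  let ?N = "\<lambda>g. \<integral>\<^sup>+t. ennreal ((g t)\<^sup>2) \<partial>lborel"
  let ?S = "ennreal (\<sigma>\<^sup>2)"
  have reflect: "(\<integral>\<^sup>+t. f (- t) \<partial>lborel) = (\<integral>\<^sup>+t. f t \<partial>lborel)"
    if [measurable]: "f \<in> borel_measurable borel" for f :: "real \<Rightarrow> ennreal"
    using nn_integral_real_affine[OF that, of "-1" 0] by simp
  have fwd: "(\<integral>\<^sup>+x. (\<integral>\<^sup>+t. ennreal (forward_kernel lam x t * gp t) \<partial>lborel)\<^sup>2 \<partial>lborel) \<le> ?S * ?N gp"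
  proof -
    have "(\<integral>\<^sup>+x. (\<integral>\<^sup>+t. ennreal (forward_kernel lam x t * gp t) \<partial>lborel)\<^sup>2 \<partial>lborel) \<le> \<alpha> * \<beta> * ?N gp"
      by (rule schur_test) (auto intro: forward_kernel_nonneg gp0 row col)
    also have "\<dots> \<le> ?S * ?N gp" by (intro mult_right_mono \<sigma>) auto
    finally show ?thesis .
  qed
  have bwd: "(\<integral>\<^sup>+x. (\<integral>\<^sup>+t. ennreal (backward_kernel x t * gm t) \<partial>lborel)\<^sup>2 \<partial>lborel) \<le> ?S * ?N gm"
  proof -
    have "(\<integral>\<^sup>+x. (\<integral>\<^sup>+t. ennreal (backward_kernel x t * gm t) \<partial>lborel)\<^sup>2 \<partial>lborel) \<le> \<beta> * \<alpha> * ?N gm"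
    proof (rule schur_test)
      show "(\<integral>\<^sup>+t. ennreal (backward_kernel x t) \<partial>lborel) \<le> \<beta>" for x
        using col[of "- x"] reflect[of "\<lambda>t. ennreal (forward_kernel lam t (- x))"]
        by (simp add: backward_kernel_def)
      show "(\<integral>\<^sup>+x. ennreal (backward_kernel x t) \<partial>lborel) \<le> \<alpha>" for t
        using row[of "- t"] reflect[of "\<lambda>x. ennreal (forward_kernel lam (- t) x)"]
        by (simp add: backward_kernel_def)
    qed (auto simp: backward_kernel_def intro: forward_kernel_nonneg gm0)
    also have "\<dots> \<le> ?S * ?N gm" using \<sigma>(2) by (intro mult_right_mono) (auto simp: mult.commute)
    finally show ?thesis .
  qed
  define G where "G = (\<integral>\<^sup>+t. ennreal (exp (F lam t) * gp t) \<partial>lborel)"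
  have G: "G\<^sup>2 \<le> ennreal I * ?N gp"
  proof -
    have "G\<^sup>2 = (\<integral>\<^sup>+t. (ennreal (exp (F lam t)) * indicator {0..} t) * ennreal (gp t) \<partial>lborel)\<^sup>2"
      unfolding G_def
      by (intro arg_cong[where f = "\<lambda>x. x\<^sup>2"] nn_integral_cong) (auto simp: gp_def indicator_def ennreal_mult g0)
    also have "\<dots> \<le> (\<integral>\<^sup>+t. (ennreal (exp (F lam t)) * indicator {0..} t)\<^sup>2 \<partial>lborel) * (\<integral>\<^sup>+t. (ennreal (gp t))\<^sup>2 \<partial>lborel)"
      by (rule Cauchy_Schwarz_nn_integral) measurable
    also have "(\<integral>\<^sup>+t. (ennreal (exp (F lam t)) * indicator {0..} t)\<^sup>2 \<partial>lborel) = ennreal I"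
      unfolding I(1)[symmetric] peak_integral_def
      by (intro nn_integral_cong) (auto simp: indicator_def ennreal_power exp_double[symmetric])
    also have "(\<integral>\<^sup>+t. (ennreal (gp t))\<^sup>2 \<partial>lborel) = ?N gp"
      by (intro nn_integral_cong) (simp add: ennreal_power gp0)
    finally show ?thesis .
  qed
  \<comment> \<open>This weight makes both cross terms equal to \<open>I * \<sigma>\<close>.\<close>
  define \<eta> where "\<eta> = \<sigma> / I"
  have \<eta>: "0 < \<eta>" using I \<sigma> by (simp add: \<eta>_def)
  have pointwise: "(resolvent_majorant lam g x)\<^sup>2 \<le>
      (\<integral>\<^sup>+t. ennreal (forward_kernel lam x t * gp t) \<partial>lborel)\<^sup>2 +
      (ennreal (1 + \<eta>) * G\<^sup>2 * (ennreal (exp (- 2 * F lam x)) * indicator {..0} x) +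
       ennreal (1 + 1 / \<eta>) * (\<integral>\<^sup>+t. ennreal (backward_kernel x t * gm t) \<partial>lborel)\<^sup>2)" for x
  proof (cases "0 \<le> x")
    case True
    then have "resolvent_majorant lam g x = (\<integral>\<^sup>+t. ennreal (forward_kernel lam x t * gp t) \<partial>lborel)"
      unfolding resolvent_majorant_def
      by (intro nn_integral_cong) (auto simp: resolvent_kernel_def forward_kernel_def gp_def)
    then show ?thesis by simp
  next
    case False
    have "resolvent_majorant lam g x =
       (\<integral>\<^sup>+t. ennreal (exp (- F lam x)) * ennreal (exp (F lam t) * gp t) + ennreal (backward_kernel x t * gm t) \<partial>lborel)"
      unfolding resolvent_majorant_def
      using False g0
      by (intro nn_integral_cong)
         (auto simp: resolvent_kernel_def backward_kernel_def forward_kernel_def gp_def gm_def F_minus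
           exp_diff exp_minus divide_inverse ennreal_mult[symmetric] mult_ac)
    also have "\<dots> = ennreal (exp (- F lam x)) * G + (\<integral>\<^sup>+t. ennreal (backward_kernel x t * gm t) \<partial>lborel)"
      unfolding G_def by (subst nn_integral_add) (auto intro!: nn_integral_cmult)
    also have "\<dots>\<^sup>2 \<le> ennreal (1 + \<eta>) * (ennreal (exp (- F lam x)) * G)\<^sup>2
        + ennreal (1 + 1 / \<eta>) * (\<integral>\<^sup>+t. ennreal (backward_kernel x t * gm t) \<partial>lborel)\<^sup>2"
      by (rule weighted_square_sum[OF \<eta>])
    also have "(ennreal (exp (- F lam x)) * G)\<^sup>2 = G\<^sup>2 * (ennreal (exp (- 2 * F lam x)) * indicator {..0} x)"
      using False by (simp add: power_mult_distrib ennreal_power exp_double[symmetric] mult.commute)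
    finally show ?thesis by (simp add: mult.assoc add_increasing)
  qed
  have "(\<integral>\<^sup>+x. (resolvent_majorant lam g x)\<^sup>2 \<partial>lborel) \<le>
     (\<integral>\<^sup>+x. (\<integral>\<^sup>+t. ennreal (forward_kernel lam x t * gp t) \<partial>lborel)\<^sup>2 +
      (ennreal (1 + \<eta>) * G\<^sup>2 * (ennreal (exp (- 2 * F lam x)) * indicator {..0} x) +
       ennreal (1 + 1 / \<eta>) * (\<integral>\<^sup>+t. ennreal (backward_kernel x t * gm t) \<partial>lborel)\<^sup>2) \<partial>lborel)"
    by (intro nn_integral_mono pointwise)
  also have "\<dots> = (\<integral>\<^sup>+x. (\<integral>\<^sup>+t. ennreal (forward_kernel lam x t * gp t) \<partial>lborel)\<^sup>2 \<partial>lborel) +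
     (ennreal (1 + \<eta>) * G\<^sup>2 * (\<integral>\<^sup>+x. ennreal (exp (- 2 * F lam x)) * indicator {..0} x \<partial>lborel) +
      ennreal (1 + 1 / \<eta>) * (\<integral>\<^sup>+x. (\<integral>\<^sup>+t. ennreal (backward_kernel x t * gm t) \<partial>lborel)\<^sup>2 \<partial>lborel))"
    by (simp add: nn_integral_add nn_integral_cmult)
  also have "\<dots> \<le> ?S * ?N gp + (ennreal (1 + \<eta>) * (ennreal I * ?N gp) * ennreal I + ennreal (1 + 1 / \<eta>) * (?S * ?N gm))"
    unfolding peak_integral_reflect I(1) by (intro add_mono mult_mono fwd bwd G) auto
  also have "\<dots> = ennreal (\<sigma>\<^sup>2 + (1 + \<eta>) * I\<^sup>2) * ?N gp + ennreal ((1 + 1 / \<eta>) * \<sigma>\<^sup>2) * ?N gm"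
  proof -
    have 1: "ennreal (\<sigma>\<^sup>2 + (1 + \<eta>) * I\<^sup>2) = ?S + ennreal (1 + \<eta>) * (ennreal I * ennreal I)"
      using I \<eta> by (subst ennreal_plus) (auto simp: ennreal_mult power2_eq_square)
    have 2: "ennreal ((1 + 1 / \<eta>) * \<sigma>\<^sup>2) = ennreal (1 + 1 / \<eta>) * ?S"
      using \<eta> by (intro ennreal_mult) auto
    show ?thesis unfolding 1 2 by (simp only: distrib_left distrib_right mult_ac add.assoc)
  qed
  also have "\<dots> \<le> ennreal (I\<^sup>2 + I * \<sigma> + \<sigma>\<^sup>2) * ?N gp + ennreal (I\<^sup>2 + I * \<sigma> + \<sigma>\<^sup>2) * ?N gm"
  proof -
    have "\<sigma>\<^sup>2 + (1 + \<eta>) * I\<^sup>2 \<le> I\<^sup>2 + I * \<sigma> + \<sigma>\<^sup>2"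
      using I by (simp add: \<eta>_def power2_eq_square field_simps)
    moreover have "(1 + 1 / \<eta>) * \<sigma>\<^sup>2 \<le> I\<^sup>2 + I * \<sigma> + \<sigma>\<^sup>2"
      using I \<sigma> by (simp add: \<eta>_def power2_eq_square field_simps)
    ultimately show ?thesis
      by (intro add_mono[OF mult_right_mono[OF ennreal_leI] mult_right_mono[OF ennreal_leI]]) auto
  qed
  also have "\<dots> = ennreal (I\<^sup>2 + I * \<sigma> + \<sigma>\<^sup>2) * (?N gp + ?N gm)"
    by (simp add: distrib_left)
  also have "?N gp + ?N gm = ?N g"
    by (subst nn_integral_add[symmetric]) (auto simp: gp_def gm_def intro!: nn_integral_cong)
  finally show ?thesis .
qed

end

section \<open>The potential times a solution is square integrable\<close>

context confining_potential
begin

text \<open>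
  From \<open>w' \<le> C * w * x powr \<nu>\<close> and \<open>x powr \<nu> = o(sqrt w')\<close> follows \<open>sqrt w' = o(w)\<close>.
\<close>

lemma w'_le_w_squared: "\<forall>\<^sub>F x in at_top. w' x \<le> (w x - lam)\<^sup>2 / 2 \<and> 0 < w x - lam"
proof -
  have "\<forall>\<^sub>F x in at_top. x powr \<nu> * w' x powr (-1/2) < 1 / (4 * C)"
    by (rule order_tendstoD(2)[OF Upsilon]) (use C in simp)
  moreover have "\<forall>\<^sub>F x in at_top. max 1 (2 * lam) \<le> w x"
    by (rule at_top[unfolded filterlim_at_top, rule_format])
  ultimately show ?thesis using eventually_gt_at_top[of Y]
  proof eventually_elim
    case (elim x)
    define u where "u = x powr \<nu>"
    define s where "s = sqrt (w' x)"
    have m: "0 < w' x" using w'_pos elim by simp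
    have s: "0 < s" "s * s = w' x" using m by (auto simp: s_def)
    have "w' x powr (-1/2) = w' x powr (- (1/2))" by simp
    also have "\<dots> = inverse (w' x powr (1/2))" by (rule powr_minus)
    also have "w' x powr (1/2) = s" using m by (simp add: powr_half_sqrt s_def)
    finally have e: "w' x powr (-1/2) = inverse s" .
    have "x powr \<nu> * inverse s < 1 / (4 * C)" using elim(1) unfolding e .
    then have "u / s < 1 / (4 * C)" unfolding u_def divide_inverse .
    then have "u < 1 / (4 * C) * s" using s(1) by (simp add: pos_divide_less_eq)
    then have "C * u \<le> C * (1 / (4 * C) * s)" using C by (intro mult_left_mono) auto
    then have u: "C * u \<le> s / 4" using C by simp
    have w1: "1 \<le> w x" "2 * lam \<le> w x" using elim by auto
    have "s * s \<le> w x * (C * u)"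
      using w'_le[of x] elim by (simp add: s u_def mult_ac)
    also have "\<dots> \<le> w x * (s / 4)" using u w1 by (intro mult_left_mono) auto
    finally have "s * s \<le> (w x / 4) * s" by simp
    then have "s \<le> w x / 4" using mult_le_cancel_right_pos[OF s(1)] by blast
    then have "s * s \<le> (w x / 4) * (w x / 4)" using s by (intro mult_mono) auto
    moreover have "(w x / 2) * (w x / 2) \<le> (w x - lam) * (w x - lam)"
      using w1 by (intro mult_mono) auto
    moreover have "(w x / 4) * (w x / 4) \<le> (w x / 2) * (w x / 2) / 2" by simp
    ultimately have "s * s \<le> (w x - lam) * (w x - lam) / 2" by linarith
    then show ?case using w1 s by (simp add: power2_eq_square)
  qed
qed

lemma F_le_off_left:
  assumes "0 \<le> Z"
  obtains M where "\<And>t. - Z \<le> t \<Longrightarrow> t \<le> 0 \<Longrightarrow> F lam t \<le> M"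
proof -
  have "bounded (F lam ` {-Z..0})"
    by (intro compact_imp_bounded compact_continuous_image continuous_F) auto
  then obtain M where "\<And>y. y \<in> F lam ` {-Z..0} \<Longrightarrow> norm y \<le> M"
    unfolding bounded_iff by blast
  then have "F lam t \<le> M" if "- Z \<le> t" "t \<le> 0" for t using that by fastforce
  then show ?thesis using that by blast
qed

lemma filterlim_F_at_top: "filterlim (F lam) at_bot at_top"
proof -
  have "\<forall>\<^sub>F x in at_top. lam + 1 \<le> w x" using at_top by (simp add: filterlim_at_top)
  then obtain Z where Z: "\<And>x. Z \<le> x \<Longrightarrow> lam + 1 \<le> w x" by (auto simp: eventually_at_top_linorder)
  have "F lam x \<le> (F lam Z + Z) - x" if "Z \<le> x" for x
    using F_upper[of Z x lam "-1"] Z that by force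
  then have "\<forall>\<^sub>F x in at_top. F lam x \<le> (F lam Z + Z) - x"
    by (rule eventually_mono[OF eventually_ge_at_top[of Z]])
  moreover have "filterlim (\<lambda>x. c - x) at_bot at_top" for c :: real
    by real_asymp
  ultimately show ?thesis by (rule filterlim_at_bot_mono[rotated])
qed

text \<open>
  Schur's test for the kernel multiplied by \<open>w x - lam\<close>, which is minus the derivative of \<open>F\<close>.
  Column integrals are therefore increments of \<open>exp (- F)\<close>. On the right \<open>w\<close> increases with \<open>t\<close>,
  so the row integrals are at most those for constant \<open>w\<close>. On the left \<open>w\<close> decreases with \<open>t\<close>,
  and \<open>w' \<le> (w - lam)\<^sup>2 / 2\<close> ensures that \<open>exp F / (w - lam)\<close> still decreases at least
  half as fast as it would for constant \<open>w\<close>.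
\<close>

lemma weighted_resolvent_finite:
  assumes X2: "2 * Y < X lam" and wX: "w (X lam) = lam" and E1: "peak_integral 1 lam < \<infinity>"
    and g[measurable]: "g \<in> borel_measurable lborel" and g0: "\<And>t. 0 \<le> g t"
    and gfin: "(\<integral>\<^sup>+t. ennreal ((g t)\<^sup>2) \<partial>lborel) < \<infinity>"
  obtains Z where "Y < Z"
    "(\<integral>\<^sup>+x. (ennreal \<bar>w x - lam\<bar> * resolvent_majorant lam g x)\<^sup>2 * indicator {x. Z \<le> \<bar>x\<bar>} x \<partial>lborel) < \<infinity>"
proof -
  from w'_le_w_squared[of lam] obtain Z0 where
    Z0: "\<And>x. Z0 \<le> x \<Longrightarrow> w' x \<le> (w x - lam)\<^sup>2 / 2 \<and> 0 < w x - lam"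
    by (auto simp: eventually_at_top_linorder)
  define Z where "Z = max Z0 (max (X lam) Y + 1)"
  have Z: "Y < Z" "X lam < Z" "0 < Z" using Y by (auto simp: Z_def)
  have V: "w' x \<le> (w x - lam)\<^sup>2 / 2" "0 < w x - lam" if "Z \<le> x" for x
    using Z0[of x] that by (auto simp: Z_def)
  have Vneg: "0 < w x - lam" if "x \<le> - Z" for x
    using V(2)[of "- x"] that by (simp add: even)
  \<comment> \<open>\<open>w\<close> is only Lebesgue measurable, but continuous beyond \<open>Z\<close>; cut off there, the weights are Borel measurable.\<close>
  define vr where "vr = (\<lambda>x. if Z \<le> x then w x - lam else 0)"
  define vl where "vl = (\<lambda>x. if x \<le> - Z then w x - lam else 0)"
  have contw: "continuous_on {Z..} w" "continuous_on {..-Z} w"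
  proof -
    show right: "continuous_on {Z..} w"
    proof (rule continuous_at_imp_continuous_on, rule ballI)
      fix x assume "x \<in> {Z..}"
      then show "isCont w x" using isCont_w[of x] Z by simp
    qed
    have "continuous_on {..-Z} (\<lambda>x. w (- x))"
      by (rule continuous_on_compose2[OF right]) (auto intro!: continuous_intros)
    then show "continuous_on {..-Z} w" by (simp add: even)
  qed
  have [measurable]: "vr \<in> borel_measurable borel" "vl \<in> borel_measurable borel"
  proof -
    have "(\<lambda>x. indicator {Z..} x *\<^sub>R (w x - lam)) \<in> borel_measurable borel"
      by (intro borel_measurable_continuous_on_indicator continuous_intros contw) auto
    moreover have "(\<lambda>x. indicator {Z..} x *\<^sub>R (w x - lam)) = vr"
      by (auto simp: vr_def indicator_def)
    ultimately show "vr \<in> borel_measurable borel" by simp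
    have "(\<lambda>x. indicator {..-Z} x *\<^sub>R (w x - lam)) \<in> borel_measurable borel"
      by (intro borel_measurable_continuous_on_indicator continuous_intros contw) auto
    moreover have "(\<lambda>x. indicator {..-Z} x *\<^sub>R (w x - lam)) = vl"
      by (auto simp: vl_def indicator_def)
    ultimately show "vl \<in> borel_measurable borel" by simp
  qed
  have v0: "0 \<le> vr x" "0 \<le> vl x" for x
    using V(2)[of x] Vneg[of x] by (auto simp: vr_def vl_def)
  let ?kr = "\<lambda>x t. vr x * resolvent_kernel lam x t"
  let ?kl = "\<lambda>x t. vl x * resolvent_kernel lam x t"
  have row_r: "(\<integral>\<^sup>+t. ennreal (?kr x t) \<partial>lborel) \<le> 1" for x
  proof (cases "Z \<le> x")
    case True
    define c where "c = w x - lam"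
    have c: "0 < c" using V(2)[OF True] by (simp add: c_def)
    have "(\<integral>\<^sup>+t. ennreal (?kr x t) \<partial>lborel) \<le> (\<integral>\<^sup>+t. ennreal c * (ennreal (exp (- c * (t - x))) * indicator {x..} t) \<partial>lborel)"
    proof (rule nn_integral_mono)
      fix t
      have "F lam t - F lam x \<le> - c * (t - x)" if "x < t"
        using that True Z by (intro F_upper) (auto simp: c_def intro: mono)
      then show "ennreal (?kr x t) \<le> ennreal c * (ennreal (exp (- c * (t - x))) * indicator {x..} t)"
        using c True by (auto simp: vr_def resolvent_kernel_def c_def[symmetric] ennreal_mult[symmetric] intro!: ennreal_leI)
    qed
    also have "\<dots> = ennreal c * ennreal (1 / c)"
      using nn_integral_exp_decay_right[OF c, of x] by (subst nn_integral_cmult) auto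
    also have "\<dots> = 1" using c by (simp flip: ennreal_mult)
    finally show ?thesis .
  qed (simp add: vr_def)
  have DERIV_exp: "DERIV (\<lambda>x. exp (- F lam x)) x :> (w x - lam) * exp (- F lam x)" if "Z \<le> \<bar>x\<bar>" for x
  proof -
    have "DERIV (F lam) x :> lam - w x"
      using that Z DERIV_F[of x lam] DERIV_F_neg[of x lam] by (cases "0 \<le> x") auto
    then show ?thesis by (auto intro!: derivative_eq_intros)
  qed
  have col_r: "(\<integral>\<^sup>+x. ennreal (?kr x t) \<partial>lborel) \<le> 1" for t
  proof (cases "Z \<le> t")
    case True
    have "((\<lambda>x. (w x - lam) * exp (- F lam x)) has_integral (exp (- F lam t) - exp (- F lam Z))) {Z..t}"
      using True DERIV_exp Z
      by (intro fundamental_theorem_of_calculus)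
         (auto simp: has_real_derivative_iff_has_vector_derivative[symmetric] intro: has_field_derivative_at_within)
    then have int: "((\<lambda>x. vr x * exp (- F lam x)) has_integral (exp (- F lam t) - exp (- F lam Z))) {Z..t}"
      by (rule has_integral_eq[rotated]) (auto simp: vr_def)
    have "(\<integral>\<^sup>+x. ennreal (?kr x t) \<partial>lborel) \<le>
       (\<integral>\<^sup>+x. ennreal (exp (F lam t)) * ennreal (indicator {Z..t} x * (vr x * exp (- F lam x))) \<partial>lborel)"
    proof (rule nn_integral_mono)
      fix x
      have "?kr x t \<le> exp (F lam t) * (indicator {Z..t} x * (vr x * exp (- F lam x)))"
      proof (cases "x < t")
        case True
        then show ?thesis
          by (auto simp: vr_def resolvent_kernel_def exp_diff exp_minus divide_inverse mult_ac)
      qed (simp add: resolvent_kernel_def v0)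
      then show "ennreal (?kr x t) \<le> ennreal (exp (F lam t)) * ennreal (indicator {Z..t} x * (vr x * exp (- F lam x)))"
        using v0 by (subst ennreal_mult[symmetric]) (auto intro!: ennreal_leI)
    qed
    also have "\<dots> = ennreal (exp (F lam t)) * (\<integral>\<^sup>+x. ennreal (indicator {Z..t} x * (vr x * exp (- F lam x))) \<partial>lborel)"
      by (rule nn_integral_cmult) measurable
    also have "(\<integral>\<^sup>+x. ennreal (indicator {Z..t} x * (vr x * exp (- F lam x))) \<partial>lborel) = ennreal (exp (- F lam t) - exp (- F lam Z))"
      by (rule nn_integral_has_integral_lebesgue[OF _ int]) (use v0 in auto)
    also have "ennreal (exp (F lam t)) * \<dots> = ennreal (1 - exp (F lam t - F lam Z))"
      by (subst ennreal_mult'[symmetric]) (auto simp: right_diff_distrib exp_minus exp_diff divide_inverse)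
    also have "\<dots> \<le> 1" by (simp add: ennreal_le_1)
    finally show ?thesis .
  next
    case False
    then have z: "?kr x t = 0" for x by (auto simp: vr_def resolvent_kernel_def)
    show ?thesis unfolding z by simp
  qed
  obtain M0 where M0: "\<And>t. - Z \<le> t \<Longrightarrow> t \<le> 0 \<Longrightarrow> F lam t \<le> M0"
    using F_le_off_left[of Z lam] Z by auto
  define M where "M = max M0 (F lam (X lam))"
  have M: "F lam t \<le> M" if "- Z \<le> t" for t
    using M0[of t] F_le_peak[OF X2 wX, of t] that by (cases "t \<le> 0") (auto simp: M_def)
  have col_l: "(\<integral>\<^sup>+x. ennreal (?kl x t) \<partial>lborel) \<le> ennreal (max 1 (exp (M + F lam Z)))" for t
  proof -
    define b where "b = min t (- Z)"
    have lim: "((\<lambda>y. - exp (F lam y)) \<longlongrightarrow> - 0) at_top"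
      by (intro tendsto_minus filterlim_compose[OF exp_at_bot filterlim_F_at_top])
    have "(\<integral>\<^sup>+x. ennreal (vl x * exp (- F lam x)) * indicator {..b} x \<partial>lborel)
       = (\<integral>\<^sup>+y. ennreal (vl (0 + (-1) * y) * exp (- F lam (0 + (-1) * y))) * indicator {..b} (0 + (-1) * y) \<partial>lborel)"
      by (subst nn_integral_real_affine[of _ "-1" 0]) auto
    also have "\<dots> = (\<integral>\<^sup>+y. ennreal (vr y * exp (F lam y)) * indicator {- b..} y \<partial>lborel)"
      by (intro nn_integral_cong) (auto simp: vl_def vr_def F_minus even indicator_def)
    also have "\<dots> = ennreal (- 0 - - exp (F lam (- b)))"
    proof (rule nn_integral_FTC_atLeast[OF _ _ _ lim])
      fix y assume y: "- b \<le> y"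
      then have Zy: "Z \<le> y" by (auto simp: b_def)
      show "DERIV (\<lambda>y. - exp (F lam y)) y :> vr y * exp (F lam y)"
        using DERIV_F[of y lam] Zy Z by (auto intro!: derivative_eq_intros simp: vr_def algebra_simps)
      show "0 \<le> vr y * exp (F lam y)" using v0 by simp
    qed measurable
    also have "\<dots> = ennreal (exp (- F lam b))" by (simp add: F_minus)
    finally have inner: "(\<integral>\<^sup>+x. ennreal (vl x * exp (- F lam x)) * indicator {..b} x \<partial>lborel) = ennreal (exp (- F lam b))" .
    have "(\<integral>\<^sup>+x. ennreal (?kl x t) \<partial>lborel) \<le>
       (\<integral>\<^sup>+x. ennreal (exp (F lam t)) * (ennreal (vl x * exp (- F lam x)) * indicator {..b} x) \<partial>lborel)"
    proof (rule nn_integral_mono)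
      fix x
      have "?kl x t \<le> exp (F lam t) * (vl x * exp (- F lam x))"
        using v0(2)[of x] by (auto simp: resolvent_kernel_def exp_diff exp_minus divide_inverse mult_ac)
      moreover have "?kl x t = 0" if "b < x" using that by (auto simp: vl_def b_def resolvent_kernel_def)
      ultimately show "ennreal (?kl x t) \<le> ennreal (exp (F lam t)) * (ennreal (vl x * exp (- F lam x)) * indicator {..b} x)"
        using v0 by (cases "x \<le> b") (auto simp: ennreal_mult[symmetric] intro!: ennreal_leI simp del: mult_eq_0_iff)
    qed
    also have "\<dots> = ennreal (exp (F lam t)) * ennreal (exp (- F lam b))"
      by (subst nn_integral_cmult) (auto simp: inner)
    also have "\<dots> = ennreal (exp (F lam t - F lam b))"
      by (simp add: ennreal_mult[symmetric] exp_diff exp_minus divide_inverse)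
    also have "\<dots> \<le> ennreal (max 1 (exp (M + F lam Z)))"
    proof (intro ennreal_leI)
      show "exp (F lam t - F lam b) \<le> max 1 (exp (M + F lam Z))"
        using M[of t] by (cases "t \<le> - Z") (auto simp: b_def F_minus intro!: max.coboundedI2)
    qed
    finally show ?thesis .
  qed
  define J where "J = (\<integral>\<^sup>+t. ennreal (exp (F lam t)) * indicator {-Z..} t \<partial>lborel)"
  have "J \<le> (\<integral>\<^sup>+t. ennreal (exp M) * indicator {-Z..0} t + ennreal (exp (1 * F lam t)) * indicator {0..} t \<partial>lborel)"
    unfolding J_def
  proof (rule nn_integral_mono)
    fix t
    show "ennreal (exp (F lam t)) * indicator {-Z..} t \<le> ennreal (exp M) * indicator {-Z..0} t + ennreal (exp (1 * F lam t)) * indicator {0..} t"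
      using M[of t] by (auto simp: indicator_def ennreal_leI add_increasing)
  qed
  also have "\<dots> = ennreal (exp M) * ennreal Z + peak_integral 1 lam"
    using Z unfolding peak_integral_def by (subst nn_integral_add) (auto simp: nn_integral_cmult_indicator)
  also have "\<dots> < \<infinity>" using E1 by (simp add: ennreal_mult_less_top)
  finally have J: "J < \<infinity>" .
  define c where "c = ennreal 2 + ennreal ((w Z - lam) * exp (F lam Z)) * J"
  have c: "c < \<infinity>" using J by (simp add: c_def ennreal_mult_less_top)
  have row_l: "(\<integral>\<^sup>+t. ennreal (?kl x t) \<partial>lborel) \<le> c" for x
  proof (cases "x \<le> - Z")
    case True
    \<comment> \<open>\<open>-2 * \<phi>\<close> would be a primitive of \<open>2 * exp F\<close> if \<open>w\<close> were constant; in general its derivative is still at least \<open>exp F\<close>.\<close>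
    define \<phi> where "\<phi> = (\<lambda>t. exp (F lam t) / (w t - lam))"
    have DERIV_wn: "DERIV w t :> - w' (- t)" if "t \<le> - Z" for t
    proof -
      have "DERIV (\<lambda>t. w (- t)) t :> - w' (- t)"
        using that Z DERIV_w[of "- t"] by (simp add: DERIV_mirror)
      then show ?thesis by (simp add: even)
    qed
    have D\<phi>: "\<exists>D. DERIV \<phi> t :> D \<and> D \<le> - (exp (F lam t) / 2)" if t: "t \<le> - Z" for t
    proof (intro exI conjI)
      let ?v = "w t - lam"
      have v: "0 < ?v" "w' (- t) \<le> ?v\<^sup>2 / 2" using Vneg[OF t] V(1)[of "- t"] t by (auto simp: even)
      show "DERIV \<phi> t :> ((- ?v) * exp (F lam t) * ?v - exp (F lam t) * (- w' (- t))) / (?v * ?v)"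
        unfolding \<phi>_def using DERIV_F_neg[of t lam] DERIV_wn[OF t] t Z v
        by (auto intro!: derivative_eq_intros)
      have "((- ?v) * exp (F lam t) * ?v - exp (F lam t) * (- w' (- t))) / (?v * ?v) =
          exp (F lam t) * (w' (- t) / ?v\<^sup>2 - 1)"
      proof -
        have gen: "((- v) * E * v - E * (- m)) / (v * v) = E * (m / v\<^sup>2 - 1)" if "v \<noteq> 0" for v E m :: real
          using that by (simp add: field_simps power2_eq_square)
        show ?thesis by (rule gen) (use v in simp)
      qed
      also have "\<dots> \<le> exp (F lam t) * (- (1/2))"
        using v by (intro mult_left_mono) (auto simp: field_simps)
      finally show "((- ?v) * exp (F lam t) * ?v - exp (F lam t) * (- w' (- t))) / (?v * ?v) \<le> - (exp (F lam t) / 2)" by simp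
    qed
    have \<phi>pos: "0 < \<phi> t" if "t \<le> - Z" for t using Vneg[OF that] by (simp add: \<phi>_def)
    have dec: "\<phi> (- Z) \<le> \<phi> x"
    proof (rule DERIV_nonpos_imp_nonincreasing[OF True])
      fix t assume "x \<le> t" "t \<le> - Z"
      then show "\<exists>D. DERIV \<phi> t :> D \<and> D \<le> 0"
        using D\<phi>[of t] by (meson exp_ge_zero divide_nonneg_nonneg neg_le_0_iff_le order_trans zero_le_numeral)
    qed
    have area: "(\<integral>\<^sup>+t. ennreal (indicator {x..-Z} t * exp (F lam t)) \<partial>lborel) \<le> ennreal (2 * \<phi> x)"
    proof -
      have prim: "((\<lambda>t. exp (F lam t)) has_integral integral {x..-Z} (\<lambda>t. exp (F lam t))) {x..-Z}"
        by (intro integrable_integral integrable_continuous_real continuous_intros continuous_F)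
      obtain D where D: "\<And>t. t \<le> - Z \<Longrightarrow> DERIV \<phi> t :> D t \<and> D t \<le> - (exp (F lam t) / 2)"
        using D\<phi> by metis
      have fi: "(D has_integral (\<phi> (-Z) - \<phi> x)) {x..-Z}"
        using True D by (intro fundamental_theorem_of_calculus)
         (auto simp: has_real_derivative_iff_has_vector_derivative[symmetric] intro: has_field_derivative_at_within)
      have "integral {x..-Z} (\<lambda>t. exp (F lam t)) \<le> (-2) * (\<phi> (-Z) - \<phi> x)"
        by (rule has_integral_le[OF prim has_integral_mult_right[OF fi, of "-2"]]) (use D in force)
      also have "\<dots> \<le> 2 * \<phi> x" using \<phi>pos[of "-Z"] by simp
      finally have le: "integral {x..-Z} (\<lambda>t. exp (F lam t)) \<le> 2 * \<phi> x" .
      have "(\<integral>\<^sup>+t. ennreal (indicator {x..-Z} t * exp (F lam t)) \<partial>lborel) = ennreal (integral {x..-Z} (\<lambda>t. exp (F lam t)))"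
        by (rule nn_integral_has_integral_lebesgue[OF _ prim]) simp
      then show ?thesis using le by (simp add: ennreal_leI)
    qed
    define p where "p = (w x - lam) * exp (- F lam x)"
    have p: "0 \<le> p" "p * \<phi> x = 1" using Vneg[OF True] by (auto simp: p_def \<phi>_def exp_minus)
    have pZ: "p \<le> (w Z - lam) * exp (F lam Z)"
    proof -
      have "p * \<phi> (- Z) \<le> 1" using mult_left_mono[OF dec p(1)] p(2) by simp
      moreover have "\<phi> (- Z) * ((w Z - lam) * exp (F lam Z)) = 1"
        using V(2)[of Z] by (simp add: \<phi>_def F_minus even exp_minus)
      moreover have "0 \<le> (w Z - lam) * exp (F lam Z)" using V(2)[of Z] by simp
      ultimately show ?thesis by (metis mult.assoc mult.right_neutral mult_left_le_one_le mult_right_mono mult_1)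
    qed
    have "(\<integral>\<^sup>+t. ennreal (?kl x t) \<partial>lborel) \<le> (\<integral>\<^sup>+t. ennreal p * (ennreal (indicator {x..-Z} t * exp (F lam t)) + ennreal (exp (F lam t)) * indicator {-Z..} t) \<partial>lborel)"
    proof (rule nn_integral_mono)
      fix t
      have "ennreal (?kl x t) \<le> ennreal p * ennreal (exp (F lam t))" if "x < t"
        using True that Vneg[OF True]
        by (simp add: vl_def resolvent_kernel_def p_def ennreal_mult[symmetric] exp_diff exp_minus divide_inverse mult_ac)
      moreover have "ennreal (exp (F lam t)) \<le> ennreal (indicator {x..-Z} t * exp (F lam t)) + ennreal (exp (F lam t)) * indicator {-Z..} t" if "x < t"
        using that by (cases "t \<le> - Z") (auto simp: indicator_def)
      ultimately show "ennreal (?kl x t) \<le> ennreal p * (ennreal (indicator {x..-Z} t * exp (F lam t)) + ennreal (exp (F lam t)) * indicator {-Z..} t)"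
      proof (cases "x < t")
        case True
        then have "ennreal (?kl x t) \<le> ennreal p * ennreal (exp (F lam t))" by fact
        also have "\<dots> \<le> ennreal p * (ennreal (indicator {x..-Z} t * exp (F lam t)) + ennreal (exp (F lam t)) * indicator {-Z..} t)"
          by (intro mult_left_mono) (use True in \<open>fact, simp\<close>)
        finally show ?thesis .
      qed (simp add: resolvent_kernel_def)
    qed
    also have "\<dots> = ennreal p * ((\<integral>\<^sup>+t. ennreal (indicator {x..-Z} t * exp (F lam t)) \<partial>lborel) + J)"
      unfolding J_def by (subst nn_integral_cmult) (auto intro!: arg_cong2[where f = "(*)"] nn_integral_add)
    also have "\<dots> \<le> ennreal p * (ennreal (2 * \<phi> x) + J)"
      by (intro mult_left_mono add_mono area) auto
    also have "\<dots> = ennreal 2 + ennreal p * J"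
    proof -
      have "ennreal p * ennreal (2 * \<phi> x) = ennreal (2 * (p * \<phi> x))"
        using p(1) \<phi>pos[OF True] by (simp add: ennreal_mult[symmetric] mult_ac)
      then show ?thesis by (simp add: distrib_left p)
    qed
    also have "\<dots> \<le> c" unfolding c_def by (intro add_mono mult_right_mono ennreal_leI pZ) auto
    finally show ?thesis .
  qed (simp add: vl_def c_def)
  have r: "(\<integral>\<^sup>+x. (\<integral>\<^sup>+t. ennreal (?kr x t * g t) \<partial>lborel)\<^sup>2 \<partial>lborel) < \<infinity>"
  proof -
    have "(\<integral>\<^sup>+x. (\<integral>\<^sup>+t. ennreal (?kr x t * g t) \<partial>lborel)\<^sup>2 \<partial>lborel) \<le> 1 * 1 * (\<integral>\<^sup>+t. ennreal ((g t)\<^sup>2) \<partial>lborel)"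
      by (rule schur_test) (auto intro: row_r col_r v0 g0 resolvent_kernel_nonneg mult_nonneg_nonneg)
    then show ?thesis using gfin by (simp add: le_less_trans)
  qed
  have l: "(\<integral>\<^sup>+x. (\<integral>\<^sup>+t. ennreal (?kl x t * g t) \<partial>lborel)\<^sup>2 \<partial>lborel) < \<infinity>"
  proof -
    have "(\<integral>\<^sup>+x. (\<integral>\<^sup>+t. ennreal (?kl x t * g t) \<partial>lborel)\<^sup>2 \<partial>lborel)
      \<le> c * ennreal (max 1 (exp (M + F lam Z))) * (\<integral>\<^sup>+t. ennreal ((g t)\<^sup>2) \<partial>lborel)"
      by (rule schur_test) (auto intro: row_l col_l v0 g0 resolvent_kernel_nonneg mult_nonneg_nonneg)
    also have "\<dots> < \<infinity>" using gfin c by (simp add: ennreal_mult_less_top)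
    finally show ?thesis .
  qed
  have "(\<integral>\<^sup>+x. (ennreal \<bar>w x - lam\<bar> * resolvent_majorant lam g x)\<^sup>2 * indicator {x. Z \<le> \<bar>x\<bar>} x \<partial>lborel)
    \<le> (\<integral>\<^sup>+x. (\<integral>\<^sup>+t. ennreal (?kr x t * g t) \<partial>lborel)\<^sup>2 + (\<integral>\<^sup>+t. ennreal (?kl x t * g t) \<partial>lborel)\<^sup>2 \<partial>lborel)"
  proof (rule nn_integral_mono)
    fix x
    have *: "(\<integral>\<^sup>+t. ennreal (v * resolvent_kernel lam x t * g t) \<partial>lborel) = ennreal v * resolvent_majorant lam g x"
      if "0 \<le> v" for v
      unfolding resolvent_majorant_def
      using that g0 resolvent_kernel_nonneg
      by (subst nn_integral_cmult[symmetric]) (auto simp: ennreal_mult[symmetric] mult.assoc)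
    consider "Z \<le> x" | "x \<le> - Z" | "\<bar>x\<bar> < Z" by linarith
    then show "(ennreal \<bar>w x - lam\<bar> * resolvent_majorant lam g x)\<^sup>2 * indicator {x. Z \<le> \<bar>x\<bar>} x
      \<le> (\<integral>\<^sup>+t. ennreal (?kr x t * g t) \<partial>lborel)\<^sup>2 + (\<integral>\<^sup>+t. ennreal (?kl x t * g t) \<partial>lborel)\<^sup>2"
    proof cases
      case 1
      then show ?thesis using *[OF v0(1)[of x]] V(2)[OF 1] by (auto simp: vr_def indicator_def)
    next
      case 2
      then show ?thesis using *[OF v0(2)[of x]] Vneg[OF 2] by (auto simp: vl_def indicator_def)
    qed (simp add: indicator_def)
  qed
  also have "\<dots> = (\<integral>\<^sup>+x. (\<integral>\<^sup>+t. ennreal (?kr x t * g t) \<partial>lborel)\<^sup>2 \<partial>lborel) +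
      (\<integral>\<^sup>+x. (\<integral>\<^sup>+t. ennreal (?kl x t * g t) \<partial>lborel)\<^sup>2 \<partial>lborel)"
    by (rule nn_integral_add) measurable
  also have "\<dots> < \<infinity>" using r l by simp
  finally show ?thesis using Z(1) that by blast
qed

end

section \<open>Functions representing elements of the Hilbert space\<close>

lemma l2_eq_rep: "l2_eq (rep_l2 u) (rep_l2 u)"
  by (rule Quotient_rep_reflp[OF Quotient_l2])

lemma square_integrable_rep: "square_integrable (rep_l2 u)"
  using l2_eq_rep by (simp add: l2_eq_def)

lemma abs_rep_l2: "abs_l2 (rep_l2 u) = u"
  by (rule Quotient_abs_rep[OF Quotient_l2])

lemma rep_abs_l2: "square_integrable f \<Longrightarrow> AE x in lebesgue. rep_l2 (abs_l2 f) x = f x"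
  using Quotient_rep_abs[OF Quotient_l2, of f] by (simp add: l2_eq_def)

lemma abs_l2_cong:
  "square_integrable f \<Longrightarrow> square_integrable g \<Longrightarrow> AE x in lebesgue. f x = g x \<Longrightarrow> abs_l2 f = abs_l2 g"
  by (rule Quotient_rel_abs[OF Quotient_l2]) (simp add: l2_eq_def)

lemma l2_eqI: "AE x in lebesgue. rep_l2 u x = rep_l2 v x \<Longrightarrow> u = v"
  using abs_l2_cong[OF square_integrable_rep square_integrable_rep] abs_rep_l2 by metis

lemma square_integrable_cong_AE:
  assumes "square_integrable f" "g \<in> borel_measurable lebesgue" "AE x in lebesgue. f x = g x"
  shows "square_integrable g"
proof -
  have "integrable lebesgue (\<lambda>x. (norm (f x))\<^sup>2) \<longleftrightarrow> integrable lebesgue (\<lambda>x. (norm (g x))\<^sup>2)"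
    using assms by (intro integrable_cong_AE) (auto simp: square_integrable_def)
  then show ?thesis using assms by (simp add: square_integrable_def)
qed

lemma square_integrable_diff:
  "square_integrable f \<Longrightarrow> square_integrable g \<Longrightarrow> square_integrable (\<lambda>x. f x - g x)"
  using square_integrable_add[OF _ square_integrable_scaleR[of g "-1"], of f] by simp

lemma rep_l2_add: "AE x in lebesgue. rep_l2 (u + v) x = rep_l2 u x + rep_l2 v x"
proof -
  have "u + v = abs_l2 (\<lambda>x. rep_l2 u x + rep_l2 v x)"
    using plus_l2.abs_eq[OF l2_eq_rep[of u] l2_eq_rep[of v]] by (simp add: abs_rep_l2)
  then show ?thesis
    using rep_abs_l2[OF square_integrable_add[OF square_integrable_rep square_integrable_rep]] by simp
qed

lemma rep_l2_scaleR: "AE x in lebesgue. rep_l2 (c *\<^sub>R u) x = c *\<^sub>R rep_l2 u x"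
proof -
  have "c *\<^sub>R u = abs_l2 (\<lambda>x. c *\<^sub>R rep_l2 u x)"
    using scaleR_l2.abs_eq[OF l2_eq_rep[of u], of c] by (simp add: abs_rep_l2)
  then show ?thesis
    using rep_abs_l2[OF square_integrable_scaleR[OF square_integrable_rep]] by simp
qed

lemma rep_l2_diff: "AE x in lebesgue. rep_l2 (u - v) x = rep_l2 u x - rep_l2 v x"
  using rep_l2_add[of u "(-1) *\<^sub>R v"] rep_l2_scaleR[of "-1" v]
  by eventually_elim simp

lemma norm_abs_l2:
  assumes "square_integrable f"
  shows "ennreal ((norm (abs_l2 f))\<^sup>2) = (\<integral>\<^sup>+x. ennreal ((norm (f x))\<^sup>2) \<partial>lborel)"
proof -
  have ff: "l2_eq f f" using assms by (simp add: l2_eq_def)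
  have "(norm (abs_l2 f))\<^sup>2 = (\<integral>x. (norm (f x))\<^sup>2 \<partial>lebesgue)"
    unfolding norm_l2.abs_eq[OF ff] by simp
  then have "ennreal ((norm (abs_l2 f))\<^sup>2) = (\<integral>\<^sup>+x. ennreal ((norm (f x))\<^sup>2) \<partial>lebesgue)"
    using assms by (subst nn_integral_eq_integral) (auto simp: square_integrable_def)
  then show ?thesis by (simp add: nn_integral_completion)
qed

lemma square_integrableI:
  assumes "f \<in> borel_measurable lebesgue" "(\<integral>\<^sup>+x. ennreal ((norm (f x))\<^sup>2) \<partial>lborel) < \<infinity>"
  shows "square_integrable f"
  using assms by (auto simp: square_integrable_def integrable_iff_bounded nn_integral_completion)

lemma square_integrable_locally_integrable:
  assumes "square_integrable f"
  shows "locally_integrable f"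
  unfolding locally_integrable_def
proof (intro allI)
  fix x y :: real
  have m: "f \<in> borel_measurable lebesgue" and i: "integrable lebesgue (\<lambda>x. (norm (f x))\<^sup>2)"
    using assms by (auto simp: square_integrable_def)
  have "integrable lebesgue (indicator {x..y} :: real \<Rightarrow> real)"
    by (rule integrable_real_indicator) (auto simp: emeasure_lborel_Icc_eq)
  then have "integrable lebesgue (\<lambda>t. indicator {x..y} t + (norm (f t))\<^sup>2 :: real)"
    by (rule Bochner_Integration.integrable_add) (rule i)
  then show "f absolutely_integrable_on {x..y}"
    unfolding set_integrable_def
  proof (rule Bochner_Integration.integrable_bound)
    have "norm z \<le> 1 + (norm z)\<^sup>2" for z :: complex
      
    proof -
      have "2 * norm z \<le> (norm z)\<^sup>2 + 1" using sum_squares_bound[of "norm z" 1] by simp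
      moreover have "0 \<le> (norm z)\<^sup>2" by simp
      ultimately show ?thesis by linarith
    qed
    then show "AE t in lebesgue. norm (indicator {x..y} t *\<^sub>R f t) \<le> norm (indicator {x..y} t + (norm (f t))\<^sup>2 :: real)"
      by (auto simp: indicator_def intro!: AE_I2)
    show "(\<lambda>t. indicator {x..y} t *\<^sub>R f t) \<in> borel_measurable lebesgue"
      by (intro borel_measurable_scaleR borel_measurable_indicator m) auto
  qed
qed

lemma test_function_measurable: "test_function \<phi> \<Longrightarrow> \<phi> \<in> borel_measurable lebesgue"
  by (rule measurable_completion) (simp add: borel_measurable_continuous_onI test_function_continuous)

text \<open>
  Weak derivatives can be computed with arbitrary representatives.
\<close>

lemma weak_deriv_abs_l2:
  assumes f: "square_integrable f" and h: "square_integrable h"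
  shows "weak_deriv (abs_l2 f) (abs_l2 h) \<longleftrightarrow> (\<forall>\<phi>. test_function \<phi> \<longrightarrow>
     (\<integral>x. deriv \<phi> x *\<^sub>R f x \<partial>lebesgue) = - (\<integral>x. \<phi> x *\<^sub>R h x \<partial>lebesgue))"
proof -
  have *: "(\<integral>x. \<phi> x *\<^sub>R rep_l2 (abs_l2 g) x \<partial>lebesgue) = (\<integral>x. \<phi> x *\<^sub>R g x \<partial>lebesgue)"
    if "test_function \<phi>" "square_integrable g" for \<phi> g
  proof (rule integral_cong_AE)
    have [measurable]: "\<phi> \<in> borel_measurable lebesgue" "g \<in> borel_measurable lebesgue" "rep_l2 (abs_l2 g) \<in> borel_measurable lebesgue"
      using that square_integrable_rep[of "abs_l2 g"] by (auto simp: square_integrable_def test_function_measurable)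
    show "(\<lambda>x. \<phi> x *\<^sub>R rep_l2 (abs_l2 g) x) \<in> borel_measurable lebesgue" "(\<lambda>x. \<phi> x *\<^sub>R g x) \<in> borel_measurable lebesgue"
      by measurable
    show "AE x in lebesgue. \<phi> x *\<^sub>R rep_l2 (abs_l2 g) x = \<phi> x *\<^sub>R g x"
      using rep_abs_l2[OF that(2)] by eventually_elim simp
  qed
  have "(\<integral>x. deriv \<phi> x *\<^sub>R rep_l2 (abs_l2 f) x \<partial>lebesgue) = (\<integral>x. deriv \<phi> x *\<^sub>R f x \<partial>lebesgue)"
    "(\<integral>x. \<phi> x *\<^sub>R rep_l2 (abs_l2 h) x \<partial>lebesgue) = (\<integral>x. \<phi> x *\<^sub>R h x \<partial>lebesgue)" if "test_function \<phi>" for \<phi>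
    by (rule *[OF test_function_deriv[OF that] f], rule *[OF that h])
  then show ?thesis unfolding weak_deriv_def by (simp cong: imp_cong)
qed

lemma weak_deriv_unique:
  assumes "weak_deriv u v" "weak_deriv u v'"
  shows "v = v'"
proof (rule l2_eqI)
  let ?d = "\<lambda>x. rep_l2 v x - rep_l2 v' x"
  note li = square_integrable_locally_integrable[OF square_integrable_rep]
  have "AE x in lebesgue. ?d x = 0"
  proof (rule AE_0_if_test_integrals_0)
    show "locally_integrable ?d"
      by (intro square_integrable_locally_integrable square_integrable_diff square_integrable_rep)
    fix \<psi> assume \<psi>: "test_function \<psi>"
    have "(\<integral>x. \<psi> x *\<^sub>R rep_l2 v x \<partial>lebesgue) = (\<integral>x. \<psi> x *\<^sub>R rep_l2 v' x \<partial>lebesgue)"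
      using assms(1)[unfolded weak_deriv_def, rule_format, OF \<psi>]
        assms(2)[unfolded weak_deriv_def, rule_format, OF \<psi>] by simp
    moreover have "(\<integral>x. \<psi> x *\<^sub>R ?d x \<partial>lebesgue) =
        (\<integral>x. \<psi> x *\<^sub>R rep_l2 v x \<partial>lebesgue) - (\<integral>x. \<psi> x *\<^sub>R rep_l2 v' x \<partial>lebesgue)"
      unfolding scaleR_diff_right
      by (intro Bochner_Integration.integral_diff test_function_integrable \<psi> li)
    ultimately show "(\<integral>x. \<psi> x *\<^sub>R ?d x \<partial>lebesgue) = 0" by simp
  qed
  then show "AE x in lebesgue. rep_l2 v x = rep_l2 v' x" by eventually_elim simp
qed

lemma Dx_eq: "weak_deriv u v \<Longrightarrow> Dx u = v"
  unfolding Dx_def using weak_deriv_unique by blast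

lemma has_primitive_cong_AE:
  assumes "has_primitive h A" "AE x in lebesgue. h x = h' x"
  shows "has_primitive h' A"
proof -
  from assms(2) obtain N where N: "{x. h x \<noteq> h' x} \<subseteq> N" "N \<in> null_sets lebesgue"
    by (auto elim!: AE_E simp: null_setsI)
  then have neg: "negligible N" by (simp add: negligible_iff_null_sets)
  have eq: "h' x = h x" if "x \<notin> N" for x
  proof (rule ccontr)
    assume "h' x \<noteq> h x"
    then have "x \<in> {x. h x \<noteq> h' x}" by simp
    with N(1) that show False by blast
  qed
  show ?thesis unfolding has_primitive_def
  proof (intro allI impI conjI)
    fix x y :: real assume xy: "x \<le> y"
    show "h' absolutely_integrable_on {x..y}"
      using has_primitiveD(1)[OF assms(1) xy] neg eq by (rule absolutely_integrable_spike) auto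
    have "integral {x..y} h = integral {x..y} h'"
      using neg eq by (intro integral_spike) auto
    then show "A y - A x = integral {x..y} h'"
      using has_primitiveD(3)[OF assms(1) xy] by simp
  qed
qed

text \<open>
  Borel representatives make the kernels jointly measurable for Fubini's theorem on the product
  of Borel measures.
\<close>

lemma square_integrable_borel_representative:
  assumes "square_integrable f"
  obtains g where "g \<in> borel_measurable borel" "square_integrable g" "AE x in lebesgue. f x = g x"
proof -
  have [measurable]: "f \<in> borel_measurable lebesgue" using assms by (simp add: square_integrable_def)
  have "(\<lambda>x. Re (f x)) \<in> borel_measurable lebesgue" by measurable
  from completion_ex_borel_measurable_real[OF this] obtain a where
    a[measurable]: "a \<in> borel_measurable lborel" and a_eq: "AE x in lborel. Re (f x) = a x" by auto
  have "(\<lambda>x. Im (f x)) \<in> borel_measurable lebesgue" by measurable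
  from completion_ex_borel_measurable_real[OF this] obtain b where
    b[measurable]: "b \<in> borel_measurable lborel" and b_eq: "AE x in lborel. Im (f x) = b x" by auto
  let ?g = "\<lambda>x. Complex (a x) (b x)"
  have m: "?g \<in> borel_measurable borel"
  proof -
    have "(\<lambda>x. complex_of_real (a x) + \<i> * complex_of_real (b x)) \<in> borel_measurable borel" by measurable
    then show ?thesis by (simp add: complex_eq_iff Complex_eq)
  qed
  have ae: "AE x in lebesgue. f x = ?g x"
    using AE_completion[OF a_eq] AE_completion[OF b_eq] by eventually_elim (simp add: complex_eq_iff)
  moreover have "?g \<in> borel_measurable lebesgue" using measurable_completion[of ?g lborel borel] m by simp
  ultimately show ?thesis using that[of ?g] m square_integrable_cong_AE[OF assms] by blast
qed

context confining_potential
begin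

lemma has_primitive_exp_F: "has_primitive (\<lambda>t. (lam - w t) * exp (F lam t)) (\<lambda>t. exp (F lam t))"
  by (rule has_primitive_exp[OF has_primitive_F locally_bounded_diff_w])

lemma locally_bounded_w_diff: "locally_bounded (\<lambda>t. w t - lam)"
  using locally_bounded_diff_w[of lam] by (simp add: locally_bounded_def abs_minus_commute)

lemma has_primitive_exp_minus_F: "has_primitive (\<lambda>t. (w t - lam) * exp (- F lam t)) (\<lambda>t. exp (- F lam t))"
proof (rule has_primitive_exp)
  show "has_primitive (\<lambda>t. w t - lam) (\<lambda>t. - F lam t)"
    unfolding has_primitive_def
  proof (intro allI impI conjI)
    fix x y :: real assume xy: "x \<le> y"
    have eq: "(\<lambda>t. w t - lam) = (\<lambda>t. - (lam - w t))" by auto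
    show "(\<lambda>t. w t - lam) absolutely_integrable_on {x..y}"
      using absolutely_integrable_scaleR_left[OF has_primitiveD(1)[OF has_primitive_F[of lam] xy], of "-1"] by simp
    show "- F lam y - - F lam x = integral {x..y} (\<lambda>t. w t - lam)"
      using has_primitiveD(3)[OF has_primitive_F[of lam] xy] unfolding eq integral_neg by simp
  qed
qed (rule locally_bounded_w_diff)

lemma locally_bounded_mult_continuous:
  assumes "locally_bounded a" "continuous_on UNIV b"
  shows "locally_bounded (\<lambda>t. a t * b t :: real)"
  unfolding locally_bounded_def
proof
  fix R :: real
  obtain M where M: "M > 0" "\<And>t. \<bar>t\<bar> \<le> R \<Longrightarrow> norm (a t) \<le> M" using locally_boundedD[OF assms(1)] by blast
  have "bounded (b ` {-R..R})"
    using assms(2) by (intro compact_imp_bounded compact_continuous_image) (auto intro: continuous_on_subset)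
  then obtain K where K: "K > 0" "\<And>t. t \<in> {-R..R} \<Longrightarrow> norm (b t) \<le> K" unfolding bounded_pos by auto
  show "\<exists>M. \<forall>x. \<bar>x\<bar> \<le> R \<longrightarrow> norm (a x * b x) \<le> M"
    using M K by (intro exI[of _ "M * K"]) (auto simp: abs_mult abs_le_iff intro!: mult_mono)
qed

text \<open>
  Multiplied by \<open>exp F\<close> a solution becomes constant, by the product rule; \<open>exp (- F)\<close> is at
  least \<open>1\<close> near \<open>+\<infinity>\<close>.
\<close>

lemma homogeneous_solution_0:
  fixes U :: "real \<Rightarrow> complex"
  assumes U: "has_primitive (\<lambda>t. (w t - lam) *\<^sub>R U t) U"
    and fin: "(\<integral>\<^sup>+x. ennreal ((norm (U x))\<^sup>2) \<partial>lborel) < \<infinity>"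
  shows "U x = 0"
proof -
  have lb: "locally_bounded (\<lambda>t. (lam - w t) * exp (F lam t))"
    by (intro locally_bounded_mult_continuous locally_bounded_diff_w continuous_intros continuous_F)
  have "has_primitive (\<lambda>t. ((lam - w t) * exp (F lam t)) *\<^sub>R U t + exp (F lam t) *\<^sub>R ((w t - lam) *\<^sub>R U t))
      (\<lambda>t. exp (F lam t) *\<^sub>R U t)"
    by (rule has_primitive_scaleR[OF has_primitive_exp_F lb U])
  moreover have "(\<lambda>t. ((lam - w t) * exp (F lam t)) *\<^sub>R U t + exp (F lam t) *\<^sub>R ((w t - lam) *\<^sub>R U t)) = (\<lambda>t. 0)"
  proof
    fix t
    have "(a * e) *\<^sub>R z + e *\<^sub>R ((- a) *\<^sub>R z) = 0" for a e :: real and z :: complex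
      by (simp add: mult.commute)
    from this[of "lam - w t" "exp (F lam t)" "U t"]
    show "((lam - w t) * exp (F lam t)) *\<^sub>R U t + exp (F lam t) *\<^sub>R ((w t - lam) *\<^sub>R U t) = 0"
      by (simp only: minus_diff_eq)
  qed
  ultimately have P: "has_primitive (\<lambda>t. 0) (\<lambda>t. exp (F lam t) *\<^sub>R U t)" by simp
  have const: "exp (F lam t) *\<^sub>R U t = U 0" for t
    using has_primitiveD(3)[OF P, of 0 t] has_primitiveD(3)[OF P, of t 0] by (cases "0 \<le> t") auto
  then have Ueq: "U t = exp (- F lam t) *\<^sub>R U 0" for t
  proof -
    have "U t = (exp (- F lam t) * exp (F lam t)) *\<^sub>R U t" by (simp flip: exp_add)
    also have "\<dots> = exp (- F lam t) *\<^sub>R (exp (F lam t) *\<^sub>R U t)" by simp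
    finally show ?thesis by (simp only: const)
  qed
  have "\<forall>\<^sub>F t in at_top. F lam t \<le> 0"
    using filterlim_F_at_top[of lam] unfolding filterlim_at_bot by blast
  then obtain Z where Z: "\<And>t. Z \<le> t \<Longrightarrow> F lam t \<le> 0" by (auto simp: eventually_at_top_linorder)
  have "U 0 = 0"
  proof (rule ccontr)
    assume "U 0 \<noteq> 0"
    then have c: "0 < (norm (U 0))\<^sup>2" by simp
    define J where "J = (\<integral>\<^sup>+x. ennreal ((norm (U x))\<^sup>2) \<partial>lborel)"
    have J: "J = ennreal (enn2real J)" using fin by (simp add: J_def)
    obtain n :: nat where n: "enn2real J < real n * (norm (U 0))\<^sup>2"
      using reals_Archimedean3[OF c] by blast
    have grow: "norm (U 0) \<le> norm (U t)" if "Z \<le> t" for t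
    proof -
      have "1 * norm (U 0) \<le> exp (- F lam t) * norm (U 0)"
        using Z[OF that] by (intro mult_right_mono) auto
      also have "\<dots> = norm (exp (- F lam t) *\<^sub>R U 0)" by simp
      also have "\<dots> = norm (U t)" by (simp only: Ueq[of t])
      finally show ?thesis by simp
    qed
    have "ennreal (real n * (norm (U 0))\<^sup>2) = (\<integral>\<^sup>+x. ennreal ((norm (U 0))\<^sup>2) * indicator {Z..Z + real n} x \<partial>lborel)"
      by (subst nn_integral_cmult_indicator) (auto simp: ennreal_mult[symmetric] mult.commute)
    also have "\<dots> \<le> J"
      unfolding J_def
    proof (rule nn_integral_mono)
      fix t
      show "ennreal ((norm (U 0))\<^sup>2) * indicator {Z..Z + real n} t \<le> ennreal ((norm (U t))\<^sup>2)"
        using grow[of t] by (cases "t \<in> {Z..Z + real n}") (auto intro!: ennreal_leI power_mono)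
    qed
    finally have "real n * (norm (U 0))\<^sup>2 \<le> enn2real J"
      by (subst (asm) J) (simp add: ennreal_le_iff)
    then show False using n by simp
  qed
  then show ?thesis unfolding Ueq[of x] by simp
qed

text \<open>
  Variation of constants, with the constant of integration fixed by decay at \<open>+\<infinity>\<close>.
\<close>

definition resolvent_function :: "real \<Rightarrow> (real \<Rightarrow> complex) \<Rightarrow> real \<Rightarrow> complex" where
  "resolvent_function lam g x = exp (- F lam x) *\<^sub>R (LINT t:{x<..}|lborel. exp (F lam t) *\<^sub>R g t)"

context
  fixes lam c :: real and W :: "real \<Rightarrow> real"
  assumes X_gt: "2 * Y < X lam" and w_X: "w (X lam) = lam" and E1: "peak_integral 1 lam < \<infinity>"
    and bound: "\<And>g. g \<in> borel_measurable lborel \<Longrightarrow> (\<And>t. 0 \<le> g t) \<Longrightarrow>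
      (\<integral>\<^sup>+x. (resolvent_majorant lam g x)\<^sup>2 \<partial>lborel) \<le> ennreal c * (\<integral>\<^sup>+t. ennreal ((g t)\<^sup>2) \<partial>lborel)"
    and c: "0 \<le> c"
    and W_measurable: "W \<in> borel_measurable lebesgue" and W_eq: "AE x in lebesgue. W x = w x"
begin

context
  fixes g :: "real \<Rightarrow> complex"
  assumes g_borel[measurable]: "g \<in> borel_measurable borel" and g_L2: "square_integrable g"
begin

abbreviation "u \<equiv> resolvent_function lam g"
abbreviation "T \<equiv> resolvent_majorant lam (\<lambda>t. norm (g t))"

lemma g_norm_finite: "(\<integral>\<^sup>+t. ennreal ((norm (g t))\<^sup>2) \<partial>lborel) < \<infinity>"
  unfolding norm_abs_l2[OF g_L2, symmetric] by simp

lemma majorant_L2_finite: "(\<integral>\<^sup>+x. (T x)\<^sup>2 \<partial>lborel) < \<infinity>"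
proof -
  have "(\<integral>\<^sup>+x. (T x)\<^sup>2 \<partial>lborel) \<le> ennreal c * (\<integral>\<^sup>+t. ennreal ((norm (g t))\<^sup>2) \<partial>lborel)"
    by (rule bound) auto
  also have "\<dots> < \<infinity>" using g_norm_finite by (simp add: ennreal_mult_less_top)
  finally show ?thesis .
qed

lemma exp_times_majorant: "ennreal (exp (F lam x)) * T x = (\<integral>\<^sup>+t. ennreal (norm (indicator {x<..} t *\<^sub>R (exp (F lam t) *\<^sub>R g t))) \<partial>lborel)"
proof -
  have "ennreal (exp (F lam x)) * T x = (\<integral>\<^sup>+t. ennreal (exp (F lam x)) * ennreal (resolvent_kernel lam x t * norm (g t)) \<partial>lborel)"
    unfolding resolvent_majorant_def by (rule nn_integral_cmult[symmetric]) measurable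
  also have "\<dots> = (\<integral>\<^sup>+t. ennreal (norm (indicator {x<..} t *\<^sub>R (exp (F lam t) *\<^sub>R g t))) \<partial>lborel)"
    by (intro nn_integral_cong) (auto simp: resolvent_kernel_def ennreal_mult[symmetric] exp_diff)
  finally show ?thesis .
qed

text \<open>
  Square integrability gives finiteness almost everywhere. Up to the factor \<open>exp F\<close> the majorant
  decreases in \<open>x\<close>, so an infinite value at one point would persist on a whole half line.
\<close>

lemma majorant_finite: "T x < \<infinity>"
proof (rule ccontr)
  assume "\<not> T x < \<infinity>"
  then have inf: "T x = \<infinity>" by (metis infinity_ennreal_def top.not_eq_extremum)
  have inf': "T y = \<infinity>" if "y \<le> x" for y
  proof -
    have "ennreal (exp (F lam x)) * T x \<le> ennreal (exp (F lam y)) * T y"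
      unfolding exp_times_majorant by (intro nn_integral_mono) (use that in \<open>auto simp: indicator_def intro!: ennreal_leI\<close>)
    then have "ennreal (exp (F lam y)) * T y = \<infinity>"
      by (simp add: inf ennreal_mult_top top_unique)
    then show ?thesis by (auto simp: ennreal_mult_eq_top_iff)
  qed
  have "\<infinity> = \<infinity> * emeasure lborel {x - 1..x}" by (simp add: ennreal_top_mult)
  also have "\<dots> = (\<integral>\<^sup>+y. \<infinity> * indicator {x - 1..x} y \<partial>lborel)"
    by (rule nn_integral_cmult_indicator[symmetric]) simp
  also have "\<dots> \<le> (\<integral>\<^sup>+y. (T y)\<^sup>2 \<partial>lborel)"
    by (intro nn_integral_mono) (auto simp: indicator_def inf' power2_eq_square)
  finally show False using majorant_L2_finite by simp
qed

lemma integrand_integrable: "integrable lborel (\<lambda>t. indicator {x<..} t *\<^sub>R (exp (F lam t) *\<^sub>R g t))"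
proof (rule integrableI_bounded)
  show "(\<integral>\<^sup>+t. ennreal (norm (indicator {x<..} t *\<^sub>R (exp (F lam t) *\<^sub>R g t))) \<partial>lborel) < \<infinity>"
    unfolding exp_times_majorant[symmetric] using majorant_finite[of x] by (simp add: ennreal_mult_less_top)
qed measurable

lemma resolvent_function_le_majorant: "ennreal (norm (u x)) \<le> T x"
proof -
  have "ennreal (norm (LINT t:{x<..}|lborel. exp (F lam t) *\<^sub>R g t)) \<le> ennreal (exp (F lam x)) * T x"
    unfolding exp_times_majorant set_lebesgue_integral_def by (rule integral_norm_bound_ennreal[OF integrand_integrable])
  then have "ennreal (exp (- F lam x)) * ennreal (norm (LINT t:{x<..}|lborel. exp (F lam t) *\<^sub>R g t))
     \<le> ennreal (exp (- F lam x)) * (ennreal (exp (F lam x)) * T x)"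
    by (intro mult_left_mono) auto
  also have "\<dots> = T x"
    by (simp add: mult.assoc[symmetric] ennreal_mult[symmetric] flip: exp_add)
  finally show ?thesis by (simp add: resolvent_function_def ennreal_mult)
qed

lemma measurable_resolvent_function[measurable]: "u \<in> borel_measurable borel"
proof -
  have "(\<lambda>x. \<integral>t. (if x < t then exp (F lam t) *\<^sub>R g t else 0) \<partial>lborel) \<in> borel_measurable borel"
    by measurable
  moreover have "(\<integral>t. (if x < t then exp (F lam t) *\<^sub>R g t else 0) \<partial>lborel) = (LINT t:{x<..}|lborel. exp (F lam t) *\<^sub>R g t)" for x
    unfolding set_lebesgue_integral_def by (intro Bochner_Integration.integral_cong) (auto simp: indicator_def)
  ultimately have [measurable]: "(\<lambda>x. LINT t:{x<..}|lborel. exp (F lam t) *\<^sub>R g t) \<in> borel_measurable borel"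
    by simp
  show ?thesis unfolding resolvent_function_def[abs_def] by measurable
qed

lemma resolvent_function_norm_le: "(\<integral>\<^sup>+x. ennreal ((norm (u x))\<^sup>2) \<partial>lborel) \<le> ennreal c * (\<integral>\<^sup>+t. ennreal ((norm (g t))\<^sup>2) \<partial>lborel)"
proof -
  have "(\<integral>\<^sup>+x. ennreal ((norm (u x))\<^sup>2) \<partial>lborel) \<le> (\<integral>\<^sup>+x. (T x)\<^sup>2 \<partial>lborel)"
    using resolvent_function_le_majorant by (intro nn_integral_mono) (simp add: ennreal_power[symmetric] power_mono)
  also have "\<dots> \<le> ennreal c * (\<integral>\<^sup>+t. ennreal ((norm (g t))\<^sup>2) \<partial>lborel)"
    by (rule bound) auto
  finally show ?thesis .
qed

lemma resolvent_function_lebesgue: "u \<in> borel_measurable lebesgue"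
  using measurable_completion[of u lborel borel] by simp

lemma resolvent_function_L2: "square_integrable u"
proof (rule square_integrableI[OF resolvent_function_lebesgue])
  show "(\<integral>\<^sup>+x. ennreal ((norm (u x))\<^sup>2) \<partial>lborel) < \<infinity>"
    by (rule le_less_trans[OF resolvent_function_norm_le]) (use g_norm_finite in \<open>simp add: ennreal_mult_less_top\<close>)
qed

lemma weighted_resolvent_function_L2: "square_integrable (\<lambda>x. (w x - lam) *\<^sub>R u x)"
proof -
  obtain Z where Z: "Y < Z" and fin:
    "(\<integral>\<^sup>+x. (ennreal \<bar>w x - lam\<bar> * T x)\<^sup>2 * indicator {x. Z \<le> \<bar>x\<bar>} x \<partial>lborel) < \<infinity>"
    using weighted_resolvent_finite[OF X_gt w_X E1, of "\<lambda>t. norm (g t)"] g_norm_finite by auto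
  obtain M where M: "M > 0" "\<And>t. \<bar>t\<bar> \<le> Z \<Longrightarrow> norm (lam - w t) \<le> M"
    using locally_boundedD[OF locally_bounded_diff_w] by blast
  have meas: "(\<lambda>x. (w x - lam) *\<^sub>R u x) \<in> borel_measurable lebesgue"
    using resolvent_function_lebesgue measurable_w by measurable
  have [measurable]: "{x :: real. Z \<le> \<bar>x\<bar>} \<in> sets lebesgue" "{x :: real. \<bar>x\<bar> < Z} \<in> sets lebesgue"
    using measurable_completion by (auto intro!: sets_completionI_sets)
  have far: "square_integrable (\<lambda>x. indicator {x. Z \<le> \<bar>x\<bar>} x *\<^sub>R ((w x - lam) *\<^sub>R u x))"
  proof (rule square_integrableI)
    show "(\<lambda>x. indicator {x. Z \<le> \<bar>x\<bar>} x *\<^sub>R ((w x - lam) *\<^sub>R u x)) \<in> borel_measurable lebesgue"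
      using meas by measurable
    have "(\<integral>\<^sup>+x. ennreal ((norm (indicator {x. Z \<le> \<bar>x\<bar>} x *\<^sub>R ((w x - lam) *\<^sub>R u x)))\<^sup>2) \<partial>lborel)
      \<le> (\<integral>\<^sup>+x. (ennreal \<bar>w x - lam\<bar> * T x)\<^sup>2 * indicator {x. Z \<le> \<bar>x\<bar>} x \<partial>lborel)"
    proof (rule nn_integral_mono)
      fix x
      have "ennreal (norm ((w x - lam) *\<^sub>R u x)) \<le> ennreal \<bar>w x - lam\<bar> * T x"
        using resolvent_function_le_majorant[of x] by (simp add: ennreal_mult mult_left_mono)
      then have "(ennreal (norm ((w x - lam) *\<^sub>R u x)))\<^sup>2 \<le> (ennreal \<bar>w x - lam\<bar> * T x)\<^sup>2"
        by (rule power_mono) simp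
      then show "ennreal ((norm (indicator {x. Z \<le> \<bar>x\<bar>} x *\<^sub>R ((w x - lam) *\<^sub>R u x)))\<^sup>2)
        \<le> (ennreal \<bar>w x - lam\<bar> * T x)\<^sup>2 * indicator {x. Z \<le> \<bar>x\<bar>} x"
        by (simp add: indicator_def ennreal_power)
    qed
    then show "(\<integral>\<^sup>+x. ennreal ((norm (indicator {x. Z \<le> \<bar>x\<bar>} x *\<^sub>R ((w x - lam) *\<^sub>R u x)))\<^sup>2) \<partial>lborel) < \<infinity>"
      using fin by (rule le_less_trans)
  qed
  have near: "square_integrable (\<lambda>x. indicator {x. \<bar>x\<bar> < Z} x *\<^sub>R ((w x - lam) *\<^sub>R u x))"
  proof (rule square_integrableI)
    show "(\<lambda>x. indicator {x. \<bar>x\<bar> < Z} x *\<^sub>R ((w x - lam) *\<^sub>R u x)) \<in> borel_measurable lebesgue"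
      using meas by measurable
    have "(\<integral>\<^sup>+x. ennreal ((norm (indicator {x. \<bar>x\<bar> < Z} x *\<^sub>R ((w x - lam) *\<^sub>R u x)))\<^sup>2) \<partial>lborel)
      \<le> (\<integral>\<^sup>+x. ennreal (M\<^sup>2) * ennreal ((norm (u x))\<^sup>2) \<partial>lborel)"
    proof (rule nn_integral_mono)
      fix x
      have "norm (indicator {x. \<bar>x\<bar> < Z} x *\<^sub>R ((w x - lam) *\<^sub>R u x)) \<le> M * norm (u x)"
        using M(1) M(2)[of x] by (auto simp: indicator_def abs_minus_commute intro!: mult_right_mono)
      then have "(norm (indicator {x. \<bar>x\<bar> < Z} x *\<^sub>R ((w x - lam) *\<^sub>R u x)))\<^sup>2 \<le> (M * norm (u x))\<^sup>2"
        by (rule power_mono) simp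
      then show "ennreal ((norm (indicator {x. \<bar>x\<bar> < Z} x *\<^sub>R ((w x - lam) *\<^sub>R u x)))\<^sup>2) \<le> ennreal (M\<^sup>2) * ennreal ((norm (u x))\<^sup>2)"
        by (simp add: ennreal_mult[symmetric] power_mult_distrib ennreal_leI)
    qed
    also have "\<dots> = ennreal (M\<^sup>2) * ennreal ((norm (abs_l2 u))\<^sup>2)"
      unfolding norm_abs_l2[OF resolvent_function_L2] by (rule nn_integral_cmult) measurable
    also have "\<dots> < \<infinity>" by (simp add: ennreal_mult_less_top)
    finally show "(\<integral>\<^sup>+x. ennreal ((norm (indicator {x. \<bar>x\<bar> < Z} x *\<^sub>R ((w x - lam) *\<^sub>R u x)))\<^sup>2) \<partial>lborel) < \<infinity>" .
  qed
  have "(\<lambda>x. indicator {x. Z \<le> \<bar>x\<bar>} x *\<^sub>R ((w x - lam) *\<^sub>R u x) + indicator {x. \<bar>x\<bar> < Z} x *\<^sub>R ((w x - lam) *\<^sub>R u x)) = (\<lambda>x. (w x - lam) *\<^sub>R u x)"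
    by (auto simp: indicator_def)
  then show ?thesis using square_integrable_add[OF far near] by simp
qed

text \<open>
  The differential equation in integrated form: the product rule for \<open>exp (- F)\<close> and the tail
  integral of \<open>exp F * g\<close>.
\<close>

lemma resolvent_function_primitive: "has_primitive (\<lambda>t. (w t - lam) *\<^sub>R u t - g t) u"
proof -
  define G where "G = (\<lambda>x. LINT t:{x<..}|lborel. exp (F lam t) *\<^sub>R g t)"
  let ?h = "\<lambda>t. exp (F lam t) *\<^sub>R g t"
  have li: "locally_integrable g" by (rule square_integrable_locally_integrable[OF g_L2])
  have abs: "?h absolutely_integrable_on {x..y}" for x y
    using li by (intro absolutely_integrable_continuous_scaleR continuous_intros continuous_F) (auto simp: locally_integrable_def)
  have G: "has_primitive (\<lambda>t. - ?h t) G"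
    unfolding has_primitive_def
  proof (intro allI impI conjI)
    fix x y :: real assume xy: "x \<le> y"
    show "(\<lambda>t. - ?h t) absolutely_integrable_on {x..y}"
      using abs[of x y] unfolding set_integrable_def by auto
    have split: "{x<..} = {x<..y} \<union> {y<..}" using xy by auto
    have i1: "set_integrable lborel {x<..y} ?h"
      by (rule set_integrable_subset[of lborel "{x<..}"]) (use integrand_integrable[of x] in \<open>auto simp: set_integrable_def\<close>)
    have i2: "set_integrable lborel {y<..} ?h"
      using integrand_integrable[of y] by (simp add: set_integrable_def)
    have "G x = (LINT t:{x<..y} \<union> {y<..}|lborel. ?h t)" by (simp only: G_def split)
    also have "\<dots> = (LINT t:{x<..y}|lborel. ?h t) + G y"
      unfolding G_def by (rule set_integral_Un[OF _ i1 i2]) auto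
    also have "(LINT t:{x<..y}|lborel. ?h t) = (LINT t:{x<..y}|lebesgue. ?h t)"
      unfolding set_lebesgue_integral_def by (rule integral_completion[symmetric]) measurable
    also have "\<dots> = integral {x<..y} ?h"
      by (rule set_lebesgue_integral_eq_integral(2)) (rule set_integrable_subset[OF abs[of x y]], auto)
    also have "\<dots> = integral {x..y} ?h"
      by (rule integral_subset_negligible) (auto intro: negligible_subset[of "{x}"])
    finally show "G y - G x = integral {x..y} (\<lambda>t. - ?h t)" by simp
  qed
  have lb: "locally_bounded (\<lambda>t. (w t - lam) * exp (- F lam t))"
    by (intro locally_bounded_mult_continuous locally_bounded_w_diff continuous_intros continuous_F)
  have "has_primitive (\<lambda>t. ((w t - lam) * exp (- F lam t)) *\<^sub>R G t + exp (- F lam t) *\<^sub>R (- ?h t)) (\<lambda>t. exp (- F lam t) *\<^sub>R G t)"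
    by (rule has_primitive_scaleR[OF has_primitive_exp_minus_F lb G])
  moreover have "(\<lambda>t. ((w t - lam) * exp (- F lam t)) *\<^sub>R G t + exp (- F lam t) *\<^sub>R (- ?h t)) = (\<lambda>t. (w t - lam) *\<^sub>R u t - g t)"
  proof
    fix t
    have "exp (- F lam t) *\<^sub>R (- ?h t) = - ((exp (- F lam t) * exp (F lam t)) *\<^sub>R g t)" by simp
    also have "\<dots> = - g t" by (simp flip: exp_add)
    finally show "((w t - lam) * exp (- F lam t)) *\<^sub>R G t + exp (- F lam t) *\<^sub>R (- ?h t) = (w t - lam) *\<^sub>R u t - g t"
      by (simp only: resolvent_function_def G_def) simp
  qed
  moreover have "(\<lambda>t. exp (- F lam t) *\<^sub>R G t) = u" by (auto simp: resolvent_function_def G_def)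
  ultimately show ?thesis by simp
qed

lemma resolvent_function_weak_deriv: "weak_deriv (abs_l2 u) (abs_l2 (\<lambda>x. (w x - lam) *\<^sub>R u x - g x))"
  unfolding weak_deriv_abs_l2[OF resolvent_function_L2 square_integrable_diff[OF weighted_resolvent_function_L2 g_L2]]
  using test_function_integration_by_parts[OF _ resolvent_function_primitive] by blast

lemma potential_times_solution_L2: "square_integrable (\<lambda>x. W x *\<^sub>R rep_l2 (abs_l2 u) x)"
    "AE x in lebesgue. W x *\<^sub>R rep_l2 (abs_l2 u) x = w x *\<^sub>R u x" "square_integrable (\<lambda>x. w x *\<^sub>R u x)"
proof -
  show sq: "square_integrable (\<lambda>x. w x *\<^sub>R u x)"
    using square_integrable_add[OF weighted_resolvent_function_L2 square_integrable_scaleR[OF resolvent_function_L2, of lam]] by (simp add: algebra_simps)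
  show ae: "AE x in lebesgue. W x *\<^sub>R rep_l2 (abs_l2 u) x = w x *\<^sub>R u x"
    using W_eq rep_abs_l2[OF resolvent_function_L2] by eventually_elim simp
  have "rep_l2 (abs_l2 u) \<in> borel_measurable lebesgue"
    using square_integrable_rep by (simp add: square_integrable_def)
  then have "(\<lambda>x. W x *\<^sub>R rep_l2 (abs_l2 u) x) \<in> borel_measurable lebesgue"
    using W_measurable by measurable
  then show "square_integrable (\<lambda>x. W x *\<^sub>R rep_l2 (abs_l2 u) x)"
    using ae by (intro square_integrable_cong_AE[OF sq]) (auto simp: eq_commute)
qed

lemma resolvent_function_solves: "abs_l2 u \<in> airy_dom W" "airy_op W (abs_l2 u) - lam *\<^sub>R abs_l2 u = abs_l2 g"
proof -
  show "abs_l2 u \<in> airy_dom W"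
    using resolvent_function_weak_deriv potential_times_solution_L2(1) by (auto simp: airy_dom_def sobolev_W12_def mult_dom_def)
  let ?v = "\<lambda>x. (w x - lam) *\<^sub>R u x - g x"
  have v: "square_integrable ?v" by (rule square_integrable_diff[OF weighted_resolvent_function_L2 g_L2])
  have M: "mult_op W (abs_l2 u) = abs_l2 (\<lambda>x. w x *\<^sub>R u x)"
    unfolding mult_op_def by (rule abs_l2_cong[OF potential_times_solution_L2(1) potential_times_solution_L2(3) potential_times_solution_L2(2)])
  have "airy_op W (abs_l2 u) - lam *\<^sub>R abs_l2 u = (abs_l2 (\<lambda>x. w x *\<^sub>R u x) - abs_l2 ?v) - lam *\<^sub>R abs_l2 u"
    unfolding airy_op_def Dx_eq[OF resolvent_function_weak_deriv] M by simp
  also have "\<dots> = abs_l2 g"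
  proof (rule l2_eqI)
    show "AE x in lebesgue. rep_l2 ((abs_l2 (\<lambda>x. w x *\<^sub>R u x) - abs_l2 ?v) - lam *\<^sub>R abs_l2 u) x = rep_l2 (abs_l2 g) x"
      using rep_l2_diff[of "abs_l2 (\<lambda>x. w x *\<^sub>R u x) - abs_l2 ?v" "lam *\<^sub>R abs_l2 u"]
        rep_l2_diff[of "abs_l2 (\<lambda>x. w x *\<^sub>R u x)" "abs_l2 ?v"] rep_l2_scaleR[of lam "abs_l2 u"]
        rep_abs_l2[OF potential_times_solution_L2(3)] rep_abs_l2[OF v] rep_abs_l2[OF resolvent_function_L2] rep_abs_l2[OF g_L2]
    proof eventually_elim
      case (elim x)
      show ?case unfolding elim by (simp add: algebra_simps)
    qed
  qed
  finally show "airy_op W (abs_l2 u) - lam *\<^sub>R abs_l2 u = abs_l2 g" .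
qed

end

text \<open>
  The difference of two solutions has a weak derivative equal to \<open>w - lam\<close> times itself, so by
  du Bois-Reymond it agrees with an absolutely continuous solution of the homogeneous equation.
\<close>

lemma airy_injective: "inj_on (\<lambda>u. airy_op W u - lam *\<^sub>R u) (airy_dom W)"
proof (rule inj_onI)
  fix u1 u2 assume dom: "u1 \<in> airy_dom W" "u2 \<in> airy_dom W"
    and eq: "airy_op W u1 - lam *\<^sub>R u1 = airy_op W u2 - lam *\<^sub>R u2"
  obtain v1 v2 where v: "weak_deriv u1 v1" "weak_deriv u2 v2"
    using dom by (auto simp: airy_dom_def sobolev_W12_def)
  have sq: "square_integrable (\<lambda>x. W x *\<^sub>R rep_l2 u1 x)" "square_integrable (\<lambda>x. W x *\<^sub>R rep_l2 u2 x)"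
    using dom by (auto simp: airy_dom_def mult_dom_def)
  let ?f = "\<lambda>x. rep_l2 u1 x - rep_l2 u2 x" and ?h = "\<lambda>x. rep_l2 v1 x - rep_l2 v2 x"
  have "v1 - v2 = (mult_op W u1 - mult_op W u2) - lam *\<^sub>R (u1 - u2)"
    using eq unfolding airy_op_def Dx_eq[OF v(1)] Dx_eq[OF v(2)] by (simp add: algebra_simps)
  then have "AE x in lebesgue. rep_l2 (v1 - v2) x = rep_l2 ((mult_op W u1 - mult_op W u2) - lam *\<^sub>R (u1 - u2)) x"
    by simp
  then have h_eq: "AE x in lebesgue. ?h x = (w x - lam) *\<^sub>R ?f x"
    using rep_l2_diff[of v1 v2] rep_l2_diff[of "mult_op W u1 - mult_op W u2" "lam *\<^sub>R (u1 - u2)"]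
      rep_l2_diff[of "mult_op W u1" "mult_op W u2"] rep_l2_scaleR[of lam "u1 - u2"] rep_l2_diff[of u1 u2]
      rep_abs_l2[OF sq(1), folded mult_op_def] rep_abs_l2[OF sq(2), folded mult_op_def] W_eq
  proof eventually_elim
    case (elim x)
    have "?h x = rep_l2 ((mult_op W u1 - mult_op W u2) - lam *\<^sub>R (u1 - u2)) x"
      using elim(1,2) by metis
    also have "\<dots> = (w x - lam) *\<^sub>R ?f x"
      unfolding elim(3-) by (simp add: algebra_simps)
    finally show ?case .
  qed
  note li = square_integrable_locally_integrable[OF square_integrable_rep]
  have f_L2: "square_integrable ?f" by (intro square_integrable_diff square_integrable_rep)
  have h_L2: "square_integrable ?h" by (intro square_integrable_diff square_integrable_rep)
  obtain U where U: "has_primitive ?h U" "AE x in lebesgue. ?f x = U x"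
  proof (rule du_Bois_Reymond)
    show "locally_integrable ?f" by (rule square_integrable_locally_integrable[OF f_L2])
    show "locally_integrable ?h" by (rule square_integrable_locally_integrable[OF h_L2])
    fix \<phi> assume \<phi>: "test_function \<phi>"
    have "(\<integral>x. deriv \<phi> x *\<^sub>R ?f x \<partial>lebesgue) = (\<integral>x. deriv \<phi> x *\<^sub>R rep_l2 u1 x \<partial>lebesgue) - (\<integral>x. deriv \<phi> x *\<^sub>R rep_l2 u2 x \<partial>lebesgue)"
      unfolding scaleR_diff_right
      by (intro Bochner_Integration.integral_diff test_function_integrable test_function_deriv \<phi> li)
    also have "\<dots> = - ((\<integral>x. \<phi> x *\<^sub>R rep_l2 v1 x \<partial>lebesgue) - (\<integral>x. \<phi> x *\<^sub>R rep_l2 v2 x \<partial>lebesgue))"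
      using v \<phi> by (simp add: weak_deriv_def)
    also have "(\<integral>x. \<phi> x *\<^sub>R rep_l2 v1 x \<partial>lebesgue) - (\<integral>x. \<phi> x *\<^sub>R rep_l2 v2 x \<partial>lebesgue) = (\<integral>x. \<phi> x *\<^sub>R ?h x \<partial>lebesgue)"
      unfolding scaleR_diff_right
      by (intro Bochner_Integration.integral_diff[symmetric] test_function_integrable \<phi> li)
    finally show "(\<integral>x. deriv \<phi> x *\<^sub>R ?f x \<partial>lebesgue) = - (\<integral>x. \<phi> x *\<^sub>R ?h x \<partial>lebesgue)" .
  qed
  have "AE x in lebesgue. ?h x = (w x - lam) *\<^sub>R U x"
    using h_eq U(2) by eventually_elim simp
  from has_primitive_cong_AE[OF U(1) this] have P: "has_primitive (\<lambda>t. (w t - lam) *\<^sub>R U t) U" .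
  have "(\<integral>\<^sup>+x. ennreal ((norm (U x))\<^sup>2) \<partial>lebesgue) = (\<integral>\<^sup>+x. ennreal ((norm (?f x))\<^sup>2) \<partial>lebesgue)"
    using U(2) by (intro nn_integral_cong_AE) (auto elim!: eventually_mono)
  also have "\<dots> < \<infinity>"
    using norm_abs_l2[OF f_L2] by (simp add: nn_integral_completion flip: norm_abs_l2[OF f_L2])
  finally have U0: "U x = 0" for x by (intro homogeneous_solution_0[OF P]) (simp add: nn_integral_completion)
  from U(2) have "AE x in lebesgue. rep_l2 u1 x = rep_l2 u2 x"
    by eventually_elim (simp add: U0)
  then show "u1 = u2" by (rule l2_eqI)
qed

lemma resolvent_abs_l2:
  assumes "g \<in> borel_measurable borel" "square_integrable g"
  shows "resolvent (airy_dom W) (airy_op W) lam (abs_l2 g) = abs_l2 (resolvent_function lam g)"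
  unfolding resolvent_def
  using inv_into_f_f[OF airy_injective resolvent_function_solves(1)[OF assms]] resolvent_function_solves(2)[OF assms] by simp

end

end

section \<open>The norm of the resolvent\<close>

context confining_potential
begin

text \<open>
  The upper bound is the bound on the majorant. For the lower bound take \<open>g = exp F\<close> on the
  right half line: its norm is \<open>sqrt I\<close>, and on the left half line the solution is
  \<open>I * exp (- F)\<close>, of norm \<open>I * sqrt I\<close>.
\<close>

lemma resolvent_norm_bounds:
  fixes lam I \<sigma> \<alpha> \<beta> :: real and W :: "real \<Rightarrow> real"
  assumes X_gt: "2 * Y < X lam" and w_X: "w (X lam) = lam" and E1: "peak_integral 1 lam < \<infinity>"
    and I: "peak_integral 2 lam = ennreal I" "0 < I" and \<sigma>: "0 < \<sigma>" "0 \<le> \<alpha>" "0 \<le> \<beta>" "\<alpha> * \<beta> \<le> \<sigma>\<^sup>2"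
    and row: "\<And>x. (\<integral>\<^sup>+t. ennreal (forward_kernel lam x t) \<partial>lborel) \<le> ennreal \<alpha>"
    and col: "\<And>t. (\<integral>\<^sup>+x. ennreal (forward_kernel lam x t) \<partial>lborel) \<le> ennreal \<beta>"
    and W_measurable: "W \<in> borel_measurable lebesgue" and W_eq: "AE x in lebesgue. W x = w x"
  shows "I \<le> onorm (resolvent (airy_dom W) (airy_op W) lam)"
    "onorm (resolvent (airy_dom W) (airy_op W) lam) \<le> sqrt (I\<^sup>2 + I * \<sigma> + \<sigma>\<^sup>2)"
proof -
  define c where "c = I\<^sup>2 + I * \<sigma> + \<sigma>\<^sup>2"
  have c: "0 \<le> c" using I \<sigma> by (simp add: c_def)
  have \<alpha>\<beta>: "ennreal \<alpha> * ennreal \<beta> \<le> ennreal (\<sigma>\<^sup>2)"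
    using \<sigma> by (simp add: ennreal_mult[symmetric] ennreal_leI)
  note bound = resolvent_majorant_L2_bound[OF _ _ I \<sigma>(1) \<alpha>\<beta> row col, folded c_def]
  let ?R = "resolvent (airy_dom W) (airy_op W) lam"
  have R: "?R (abs_l2 g) = abs_l2 (resolvent_function lam g)" "square_integrable (resolvent_function lam g)"
      "(\<integral>\<^sup>+x. ennreal ((norm (resolvent_function lam g x))\<^sup>2) \<partial>lborel) \<le> ennreal c * (\<integral>\<^sup>+t. ennreal ((norm (g t))\<^sup>2) \<partial>lborel)"
    if "g \<in> borel_measurable borel" "square_integrable g" for g
    by (rule resolvent_abs_l2[OF X_gt w_X E1 bound c W_measurable W_eq that] resolvent_function_L2[OF X_gt w_X E1 bound c W_measurable W_eq that]
       resolvent_function_norm_le[OF X_gt w_X E1 bound c W_measurable W_eq that]; assumption)+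
  have norm_R: "norm (?R v) \<le> norm v * sqrt c" for v
  proof -
    obtain g where g: "g \<in> borel_measurable borel" "square_integrable g" "AE x in lebesgue. rep_l2 v x = g x"
      using square_integrable_borel_representative[OF square_integrable_rep] by blast
    have v: "v = abs_l2 g" using abs_l2_cong[OF square_integrable_rep g(2,3)] by (simp add: abs_rep_l2)
    have "ennreal ((norm (?R v))\<^sup>2) \<le> ennreal c * ennreal ((norm v)\<^sup>2)"
      using R(3)[OF g(1,2)] unfolding v R(1)[OF g(1,2)] norm_abs_l2[OF g(2)] norm_abs_l2[OF R(2)[OF g(1,2)]] .
    then have "(norm (?R v))\<^sup>2 \<le> c * (norm v)\<^sup>2"
      using c by (simp add: ennreal_mult[symmetric] ennreal_le_iff)
    then have "sqrt ((norm (?R v))\<^sup>2) \<le> sqrt (c * (norm v)\<^sup>2)" by (rule real_sqrt_le_mono)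
    then show ?thesis by (simp add: real_sqrt_mult mult.commute)
  qed
  show "onorm ?R \<le> sqrt (I\<^sup>2 + I * \<sigma> + \<sigma>\<^sup>2)"
    unfolding c_def[symmetric] using norm_R c by (intro onorm_bound) (simp_all add: mult.commute)
  define g where "g = (\<lambda>t. complex_of_real (indicator {0..} t * exp (F lam t)))"
  have g[measurable]: "g \<in> borel_measurable borel" unfolding g_def by measurable
  have g_norm: "(\<integral>\<^sup>+t. ennreal ((norm (g t))\<^sup>2) \<partial>lborel) = ennreal I"
    unfolding I(1)[symmetric] peak_integral_def
    by (intro nn_integral_cong) (auto simp: g_def indicator_def exp_double[symmetric] abs_mult)
  have g_L2: "square_integrable g"
    by (rule square_integrableI) (use measurable_completion[of g lborel borel] g_norm in auto)
  have g_eq: "norm (abs_l2 g) = sqrt I"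
  proof -
    have "(norm (abs_l2 g))\<^sup>2 = I" using norm_abs_l2[OF g_L2] I(2) unfolding g_norm by simp
    then show ?thesis by (metis norm_ge_zero real_sqrt_unique)
  qed
  have inner: "(LINT t:{x<..}|lborel. exp (F lam t) *\<^sub>R g t) = complex_of_real I" if "x < 0" for x
  proof -
    have "(\<integral>\<^sup>+t. ennreal (exp (2 * F lam t) * indicator {0..} t) \<partial>lborel) = ennreal I"
      unfolding I(1)[symmetric] peak_integral_def
      by (intro nn_integral_cong) (auto simp: indicator_def)
    then have "has_bochner_integral lborel (\<lambda>t. exp (2 * F lam t) * indicator {0..} t) I"
      using I(2) by (intro has_bochner_integral_nn_integral) auto
    then have "has_bochner_integral lborel (\<lambda>t. complex_of_real (exp (2 * F lam t) * indicator {0..} t)) (complex_of_real I)"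
      by (rule has_bochner_integral_of_real)
    then have "(\<integral>t. complex_of_real (exp (2 * F lam t) * indicator {0..} t) \<partial>lborel) = complex_of_real I"
      by (rule has_bochner_integral_integral_eq)
    moreover have "indicator {x<..} t *\<^sub>R (exp (F lam t) *\<^sub>R g t) = complex_of_real (exp (2 * F lam t) * indicator {0..} t)" for t
      using that by (auto simp: g_def indicator_def exp_double power2_eq_square scaleR_conv_of_real)
    ultimately show ?thesis unfolding set_lebesgue_integral_def by simp
  qed
  have "ennreal (I\<^sup>2 * I) = ennreal (I\<^sup>2) * (\<integral>\<^sup>+x. ennreal (exp (- 2 * F lam x)) * indicator {..0} x \<partial>lborel)"
    unfolding peak_integral_reflect I(1) using I(2) by (simp add: ennreal_mult)
  also have "\<dots> = (\<integral>\<^sup>+x. ennreal (I\<^sup>2) * (ennreal (exp (- 2 * F lam x)) * indicator {..0} x) \<partial>lborel)"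
    by (rule nn_integral_cmult[symmetric]) measurable
  also have "\<dots> \<le> (\<integral>\<^sup>+x. ennreal ((norm (resolvent_function lam g x))\<^sup>2) \<partial>lborel)"
  proof (rule nn_integral_mono_AE)
    have "AE x in lborel. x \<noteq> (0::real)" by (rule AE_lborel_singleton)
    then show "AE x in lborel. ennreal (I\<^sup>2) * (ennreal (exp (- 2 * F lam x)) * indicator {..0} x)
        \<le> ennreal ((norm (resolvent_function lam g x))\<^sup>2)"
    proof eventually_elim
      case (elim x)
      show ?case
      proof (cases "x < 0")
        case True
        have "(norm (resolvent_function lam g x))\<^sup>2 = (exp (- F lam x) * I)\<^sup>2"
          unfolding resolvent_function_def inner[OF True] using I(2) by (simp add: norm_mult)
        also have "\<dots> = I\<^sup>2 * exp (- 2 * F lam x)"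
          by (simp add: power_mult_distrib exp_double[symmetric] mult.commute)
        finally show ?thesis using True by (simp add: ennreal_mult)
      next
        case False
        then show ?thesis using elim by (simp add: indicator_def)
      qed
    qed
  qed
  also have "\<dots> = ennreal ((norm (?R (abs_l2 g)))\<^sup>2)"
    unfolding R(1)[OF g g_L2] norm_abs_l2[OF R(2)[OF g g_L2]] ..
  finally have "I\<^sup>2 * I \<le> (norm (?R (abs_l2 g)))\<^sup>2" by (simp add: ennreal_le_iff)
  then have "sqrt (I\<^sup>2 * I) \<le> sqrt ((norm (?R (abs_l2 g)))\<^sup>2)" by (rule real_sqrt_le_mono)
  then have "I * sqrt I \<le> norm (?R (abs_l2 g))" using I(2) by (simp add: real_sqrt_mult)
  then have "I \<le> norm (?R (abs_l2 g)) / norm (abs_l2 g)"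
    using I(2) by (simp add: g_eq pos_le_divide_eq)
  also have "\<dots> \<le> onorm ?R"
    unfolding onorm_def
  proof (rule cSUP_upper)
    show "bdd_above (range (\<lambda>v. norm (?R v) / norm v))"
    proof (rule bdd_aboveI2)
      fix v
      show "norm (?R v) / norm v \<le> sqrt c"
        using norm_R[of v] c by (cases "norm v = 0") (auto simp: divide_le_eq mult.commute)
    qed
  qed simp
  finally show "I \<le> onorm ?R" .
qed

text \<open>
  Divided by the claimed leading term, \<open>I\<close> tends to \<open>1\<close> and \<open>\<sigma>\<close> to \<open>0\<close>, the latter like
  \<open>exp (- F)\<close> at the peak; both bounds on the norm then tend to \<open>1\<close>.
\<close>

theorem resolvent_norm_asymptotics:
  assumes W_measurable: "W \<in> borel_measurable lebesgue" and W_eq: "AE x in lebesgue. W x = w x"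
  shows "((\<lambda>lam. onorm (resolvent (airy_dom W) (airy_op W) lam) /
     (sqrt pi * w' (X lam) powr (-1/2) * exp (2 * F lam (X lam)))) \<longlongrightarrow> 1) at_top"
proof -
  let ?N = "\<lambda>lam. onorm (resolvent (airy_dom W) (airy_op W) lam)"
  let ?M = "\<lambda>lam. sqrt pi * w' (X lam) powr (-1/2) * exp (2 * F lam (X lam))"
  let ?i = "\<lambda>lam. sqrt (w' (X lam)) * exp (- 2 * F lam (X lam)) * enn2real (peak_integral 2 lam) / sqrt pi"
  obtain K where K: "0 < K" and schur: "\<forall>\<^sub>F lam in at_top. \<exists>\<alpha> \<beta>. 0 \<le> \<alpha> \<and> 0 \<le> \<beta> \<and>
    \<alpha> * \<beta> \<le> K * (exp (2 * F lam (X lam)) / w' (X lam)) \<and>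
    (\<forall>x. (\<integral>\<^sup>+t. ennreal (forward_kernel lam x t) \<partial>lborel) \<le> ennreal \<alpha>) \<and>
    (\<forall>t. (\<integral>\<^sup>+x. ennreal (forward_kernel lam x t) \<partial>lborel) \<le> ennreal \<beta>)"
    using forward_kernel_schur_bound by blast
  let ?s = "\<lambda>lam. sqrt K / sqrt pi * exp (- F lam (X lam))"
  have i: "(?i \<longlongrightarrow> 1) at_top"
  proof -
    have "(?i \<longlongrightarrow> sqrt (2 * pi / 2) / sqrt pi) at_top"
      by (intro tendsto_divide peak_integral_tendsto(1) tendsto_const) auto
    then show ?thesis by simp
  qed
  have s: "(?s \<longlongrightarrow> 0) at_top"
  proof -
    have "((\<lambda>lam. exp (- F lam (X lam))) \<longlongrightarrow> 0) at_top"
      by (rule filterlim_compose[OF exp_at_bot])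
         (simp add: filterlim_uminus_at_top[symmetric] filterlim_F_peak)
    from tendsto_mult[OF tendsto_const this, of "sqrt K / sqrt pi"] show ?thesis by simp
  qed
  have "\<forall>\<^sub>F lam in at_top. 0 < ?i lam" using order_tendstoD(1)[OF i, of 0] by simp
  then have bounds: "\<forall>\<^sub>F lam in at_top. ?i lam \<le> ?N lam / ?M lam \<and>
     ?N lam / ?M lam \<le> sqrt ((?i lam)\<^sup>2 + ?i lam * ?s lam + (?s lam)\<^sup>2)"
    using schur eventually_X_gt peak_integral_tendsto(2)[OF zero_less_one] peak_integral_tendsto(2)[of 2, OF zero_less_numeral]
  proof eventually_elim
    case (elim lam)
    from elim(2) obtain \<alpha> \<beta> where \<alpha>\<beta>: "0 \<le> \<alpha>" "0 \<le> \<beta>" "\<alpha> * \<beta> \<le> K * (exp (2 * F lam (X lam)) / w' (X lam))"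
      and row: "\<And>x. (\<integral>\<^sup>+t. ennreal (forward_kernel lam x t) \<partial>lborel) \<le> ennreal \<alpha>"
      and col: "\<And>t. (\<integral>\<^sup>+x. ennreal (forward_kernel lam x t) \<partial>lborel) \<le> ennreal \<beta>"
      by blast
    from elim(3) have X2: "2 * Y < X lam" and wX: "w (X lam) = lam" and m: "0 < w' (X lam)" by auto
    define m where "m = w' (X lam)"
    define E where "E = exp (F lam (X lam))"
    define I where "I = enn2real (peak_integral 2 lam)"
    define \<sigma> where "\<sigma> = sqrt K * E / sqrt m"
    have m0: "0 < m" "0 < sqrt m" using m by (auto simp: m_def)
    have E0: "0 < E" by (simp add: E_def)
    have M: "?M lam = sqrt pi * E\<^sup>2 / sqrt m"
    proof -
      have "w' (X lam) powr (-1/2) = w' (X lam) powr (- (1/2))" by simp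
      also have "\<dots> = inverse (w' (X lam) powr (1/2))" by (rule powr_minus)
      also have "\<dots> = inverse (sqrt m)" using m by (simp add: powr_half_sqrt m_def)
      finally have p: "w' (X lam) powr (-1/2) = inverse (sqrt m)" .
      have e2: "exp (2 * F lam (X lam)) = E\<^sup>2" by (simp add: E_def exp_double)
      show ?thesis unfolding p e2 by (simp add: divide_inverse mult_ac)
    qed
    have exp2: "exp (- 2 * F lam (X lam)) = inverse (E\<^sup>2)"
      by (simp add: exp_minus exp_double E_def)
    have i_eq: "?i lam = I / ?M lam"
      unfolding M unfolding exp2 I_def[symmetric] m_def[symmetric] using m0 E0 by (simp add: field_simps)
    have M0: "0 < ?M lam" unfolding M using m0 E0 by simp
    have I0: "0 < I" using elim(1) unfolding i_eq using M0 by (simp add: zero_less_divide_iff)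
    have s_eq: "?s lam = \<sigma> / ?M lam"
      unfolding M \<sigma>_def using m0 E0 by (simp add: exp_minus E_def[symmetric] power2_eq_square field_simps)
    have \<sigma>0: "0 < \<sigma>" using K m0 E0 by (simp add: \<sigma>_def)
    have \<sigma>2: "\<alpha> * \<beta> \<le> \<sigma>\<^sup>2"
      using \<alpha>\<beta>(3) K m0 by (simp add: \<sigma>_def E_def m_def[symmetric] power_mult_distrib power_divide exp_double)
    have P2: "peak_integral 2 lam = ennreal I" using elim by (simp add: I_def)
    note b = resolvent_norm_bounds[OF X2 wX elim(4) P2 I0 \<sigma>0 \<alpha>\<beta>(1,2) \<sigma>2 row col W_measurable W_eq]
    have "?N lam / ?M lam \<le> sqrt (I\<^sup>2 + I * \<sigma> + \<sigma>\<^sup>2) / ?M lam"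
      using b(2) M0 by (intro divide_right_mono) auto
    also have "\<dots> = sqrt (I\<^sup>2 + I * \<sigma> + \<sigma>\<^sup>2) / sqrt ((?M lam)\<^sup>2)" using M0 by simp
    also have "\<dots> = sqrt ((I\<^sup>2 + I * \<sigma> + \<sigma>\<^sup>2) / (?M lam)\<^sup>2)" by (simp only: real_sqrt_divide)
    also have "(I\<^sup>2 + I * \<sigma> + \<sigma>\<^sup>2) / (?M lam)\<^sup>2 = (I / ?M lam)\<^sup>2 + (I / ?M lam) * (\<sigma> / ?M lam) + (\<sigma> / ?M lam)\<^sup>2"
      by (simp only: power_divide add_divide_distrib times_divide_times_eq power2_eq_square)
    finally have "?N lam / ?M lam \<le> sqrt ((I / ?M lam)\<^sup>2 + (I / ?M lam) * (\<sigma> / ?M lam) + (\<sigma> / ?M lam)\<^sup>2)" .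
    moreover have "I / ?M lam \<le> ?N lam / ?M lam"
      using b(1) M0 by (intro divide_right_mono) auto
    ultimately show ?case unfolding i_eq s_eq by blast
  qed
  have upper: "((\<lambda>lam. sqrt ((?i lam)\<^sup>2 + ?i lam * ?s lam + (?s lam)\<^sup>2)) \<longlongrightarrow> sqrt (1\<^sup>2 + 1 * 0 + 0\<^sup>2)) at_top"
    by (intro tendsto_intros i s)
  show ?thesis
  proof (rule tendsto_sandwich[OF _ _ i])
    show "\<forall>\<^sub>F lam in at_top. ?i lam \<le> ?N lam / ?M lam" using bounds by eventually_elim blast
    show "\<forall>\<^sub>F lam in at_top. ?N lam / ?M lam \<le> sqrt ((?i lam)\<^sup>2 + ?i lam * ?s lam + (?s lam)\<^sup>2)"
      using bounds by eventually_elim blast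
    show "((\<lambda>lam. sqrt ((?i lam)\<^sup>2 + ?i lam * ?s lam + (?s lam)\<^sup>2)) \<longlongrightarrow> 1) at_top" using upper by simp
  qed
qed

end

text \<open>
  On \<open>[-x0, x0]\<close> the potential is clipped to its essential range, which changes it only on a
  null set. Choosing \<open>Y\<close> so large that \<open>W\<close> has overtaken the essential bound makes the
  comparison property \<open>mono\<close> true for the whole line.
\<close>

lemma confining_potential_of_assumption_W:
  assumes "assumption_W W x0"
  obtains w Y \<nu> C where "confining_potential w (deriv W) (deriv (deriv W)) Y \<nu> C" "x0 < Y"
    "W \<in> borel_measurable lebesgue" "AE x in lebesgue. W x = w x" "\<And>x. x0 < x \<Longrightarrow> w x = W x"
    "\<And>x y. x0 < x \<Longrightarrow> x < y \<Longrightarrow> W x < W y"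
proof -
  from assms have x0: "x0 > 0" and Linf: "Linf_loc W"
    and C1: "W C1_differentiable_on (- {-x0..x0})" "deriv W C1_differentiable_on (- {-x0..x0})"
    and W0: "AE x in lebesgue. W x \<ge> 0" and even: "\<And>x. W (- x) = W x"
    and top: "filterlim W at_top at_top" and pos: "\<And>x. x0 < x \<Longrightarrow> deriv W x > 0"
    unfolding assumption_W_def by auto
  from assms obtain \<nu> C where \<nu>: "-1 \<le> \<nu>" and C: "C > 0"
    and growth: "\<And>x. x0 < x \<Longrightarrow> deriv W x \<le> C * W x * x powr \<nu>"
      "\<And>x. x0 < x \<Longrightarrow> \<bar>deriv (deriv W) x\<bar> \<le> C * deriv W x * x powr \<nu>"
    and ups: "((\<lambda>x. \<bar>x\<bar> powr \<nu> * \<bar>deriv W x\<bar> powr (-1/2)) \<longlongrightarrow> 0) at_infinity"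
    unfolding assumption_W_def by blast
  have W_meas: "W \<in> borel_measurable lebesgue" using Linf by (simp add: Linf_loc_def)
  have D: "DERIV f x :> deriv f x" if f: "f C1_differentiable_on (- {-x0..x0})" and x: "x0 < \<bar>x\<bar>" for f :: "real \<Rightarrow> real" and x
  proof -
    have "x \<in> - {-x0..x0}" using x by (auto simp: abs_if split: if_splits)
    then obtain D where "(f has_vector_derivative D x) (at x)"
      using f unfolding C1_differentiable_on_def by blast
    then have "DERIV f x :> D x" by (simp add: has_real_derivative_iff_has_vector_derivative)
    then show ?thesis by (metis DERIV_imp_deriv)
  qed
  have mono: "W x < W y" if "x0 < x" "x < y" for x y
  proof (rule DERIV_pos_imp_increasing[OF that(2)])
    fix t assume "x \<le> t"
    then show "\<exists>D. DERIV W t :> D \<and> 0 < D" using D[OF C1(1), of t] pos[of t] that x0 by auto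
  qed
  have W_nonneg: "0 \<le> W x" if x: "x0 < x" for x
  proof (rule ccontr)
    assume neg: "\<not> 0 \<le> W x"
    \<comment> \<open>A negative value beyond \<open>x0\<close> would, by monotonicity, be accompanied by an interval of negative values.\<close>
    have "{(x0 + x) / 2<..<x} \<inter> {t. W t \<ge> 0} = {}"
      using mono[of _ x] neg x by force
    then have "AE t in lebesgue. t \<notin> {(x0 + x) / 2<..<x}"
      using W0 by (auto elim!: eventually_mono)
    then have "{(x0 + x) / 2<..<x} \<in> null_sets lebesgue"
      by (subst AE_iff_null_sets) auto
    then have "emeasure lebesgue {(x0 + x) / 2<..<x} = 0" by auto
    then show False using x by simp
  qed
  from Linf obtain M0 where "AE x in lebesgue. x \<in> {-x0..x0} \<longrightarrow> \<bar>W x\<bar> \<le> M0"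
    unfolding Linf_loc_def by (meson compact_Icc)
  then have M: "AE x in lebesgue. x \<in> {-x0..x0} \<longrightarrow> \<bar>W x\<bar> \<le> max 0 M0" (is "AE x in _. _ \<longrightarrow> _ \<le> ?M")
    by eventually_elim auto
  define w where "w = (\<lambda>x. if \<bar>x\<bar> \<le> x0 then max 0 (min ?M (W x)) else W x)"
  have "\<forall>\<^sub>F x in at_top. ?M \<le> W x" by (rule top[unfolded filterlim_at_top, rule_format])
  then obtain Y0 where Y0: "\<And>x. Y0 \<le> x \<Longrightarrow> ?M \<le> W x" by (auto simp: eventually_at_top_linorder)
  define Y where "Y = max Y0 (x0 + 1)"
  have Y: "x0 < Y" "1 \<le> Y" "?M \<le> W x" if "Y \<le> x" for x using Y0[of x] that x0 by (auto simp: Y_def)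
  have w_out: "w x = W x" if "x0 < x" for x using that x0 by (simp add: w_def)
  have near: "\<forall>\<^sub>F y in nhds x. w y = W y" if "Y < x" for x
    using eventually_nhds_in_open[of "{x0<..}" x] that Y(1)[of Y]
    by (auto elim!: eventually_mono simp: w_out)
  have "confining_potential w (deriv W) (deriv (deriv W)) Y \<nu> C"
  proof
    show "1 \<le> Y" using Y(2)[of Y] by simp
    show "0 < C" "-1 \<le> \<nu>" by fact+
    show "w \<in> borel_measurable lebesgue"
    proof -
      have "{x \<in> space lebesgue. \<bar>x\<bar> \<le> x0} = {-x0..x0}" by auto
      then have "{x \<in> space lebesgue. \<bar>x\<bar> \<le> x0} \<in> sets lebesgue" by simp
      moreover have "(\<lambda>x. max 0 (min ?M (W x))) \<in> borel_measurable lebesgue"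
        using W_meas by measurable
      ultimately show ?thesis unfolding w_def using W_meas by (intro measurable_If)
    qed
    show "0 \<le> w x" for x
      using W_nonneg[of "\<bar>x\<bar>"] even[of x] by (auto simp: w_def abs_if split: if_splits)
    show "w (- x) = w x" for x by (simp add: w_def even)
    show "w x \<le> w y" if "\<bar>x\<bar> \<le> y" "Y \<le> y" for x y
    proof (cases "\<bar>x\<bar> \<le> x0")
      case True
      then have "w x \<le> ?M" by (auto simp: w_def)
      also have "\<dots> \<le> w y" using Y(3)[OF that(2)] Y(1)[OF that(2)] that(2) by (simp add: w_out)
      finally show ?thesis .
    next
      case False
      then have "w x = W \<bar>x\<bar>" using even[of x] by (auto simp: w_def abs_if)
      moreover have "w y = W y" using Y(1)[OF that(2)] that(2) by (simp add: w_out)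
      moreover have "W \<bar>x\<bar> \<le> W y" using mono[of "\<bar>x\<bar>" y] that(1) False by (cases "\<bar>x\<bar> = y") auto
      ultimately show ?thesis by simp
    qed
    have "\<forall>\<^sub>F x in at_top. W x = w x"
      using eventually_gt_at_top[of x0] by eventually_elim (simp add: w_out)
    then show "filterlim w at_top at_top" using top by (subst (asm) filterlim_cong[OF refl refl]) auto
    show "DERIV w x :> deriv W x" if "Y < x" for x
      using D[OF C1(1), of x] that Y(1)[of Y] x0 by (subst DERIV_cong_ev[OF refl near[OF that] refl]) auto
    show "DERIV (deriv W) x :> deriv (deriv W) x" if "Y < x" for x
      using D[OF C1(2), of x] that Y(1)[of Y] x0 by auto
    show "0 < deriv W x" if "Y < x" for x using pos that Y(1)[of Y] by simp
    show "deriv W x \<le> C * w x * x powr \<nu>" "\<bar>deriv (deriv W) x\<bar> \<le> C * deriv W x * x powr \<nu>" if "Y < x" for x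
      using growth[of x] that Y(1)[of Y] by (auto simp: w_out)
    have "((\<lambda>x. \<bar>x\<bar> powr \<nu> * \<bar>deriv W x\<bar> powr (-1/2)) \<longlongrightarrow> 0) at_top"
      using ups by (rule filterlim_mono) (auto simp: at_infinity_eq_at_top_bot le_sup_iff)
    moreover have "\<forall>\<^sub>F x in at_top. \<bar>x\<bar> powr \<nu> * \<bar>deriv W x\<bar> powr (-1/2) = x powr \<nu> * deriv W x powr (-1/2)"
      using eventually_gt_at_top[of x0] by eventually_elim (use pos x0 in force)
    ultimately show "((\<lambda>x. x powr \<nu> * deriv W x powr (-1/2)) \<longlongrightarrow> 0) at_top"
      by (rule Lim_transform_eventually)
  qed
  moreover have "AE x in lebesgue. W x = w x"
    using W0 M by eventually_elim (auto simp: w_def abs_le_iff)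
  ultimately show ?thesis
    using that Y(1)[of Y] W_meas w_out mono by blast
qed

theorem theorem4p2:
  fixes W :: "real \<Rightarrow> real" and x0 :: real
  assumes "assumption_W W x0"
  shows "\<exists>r :: real \<Rightarrow> real. r \<in> o[at_top](\<lambda>_. 1) \<and>
    (\<forall>\<^sub>F lam in at_top.
       onorm (resolvent (airy_dom W) (airy_op W) lam) =
         sqrt pi * deriv W (turning_point W x0 lam) powr (-1/2) *
         exp (2 * phase W lam (turning_point W x0 lam)) * (1 + r lam))"
proof -
  obtain w Y \<nu> C where "confining_potential w (deriv W) (deriv (deriv W)) Y \<nu> C" and x0_Y: "x0 < Y"
    and W_meas: "W \<in> borel_measurable lebesgue" and W_eq: "AE x in lebesgue. W x = w x"
    and w_out: "\<And>x. x0 < x \<Longrightarrow> w x = W x" and W_mono: "\<And>x y. x0 < x \<Longrightarrow> x < y \<Longrightarrow> W x < W y"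
    using confining_potential_of_assumption_W[OF assms] by blast
  then interpret confining_potential w "deriv W" "deriv (deriv W)" Y \<nu> C by simp
  let ?N = "\<lambda>lam. onorm (resolvent (airy_dom W) (airy_op W) lam)"
  let ?M = "\<lambda>lam. sqrt pi * deriv W (X lam) powr (-1/2) * exp (2 * F lam (X lam))"
  define r where "r = (\<lambda>lam. ?N lam / ?M lam - 1)"
  have "(r \<longlongrightarrow> 1 - 1) at_top"
    unfolding r_def by (intro tendsto_diff resolvent_norm_asymptotics W_meas W_eq tendsto_const)
  then have small: "r \<in> o[at_top](\<lambda>_. 1)" by (intro smalloI_tendsto) auto
  have phase: "phase W lam x = F lam x" if "0 < x" for lam x
  proof -
    have "phase W lam x = (LINT t:{0<..<x}|lebesgue. lam - W t)"
      using that by (simp add: phase_def interval_lebesgue_integral_def zero_ereal_def)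
    also have "\<dots> = (LINT t:{0<..<x}|lebesgue. lam - w t)"
      unfolding set_lebesgue_integral_def
    proof (rule integral_cong_AE)
      show "(\<lambda>t. indicator {0<..<x} t *\<^sub>R (lam - W t)) \<in> borel_measurable lebesgue"
        "(\<lambda>t. indicator {0<..<x} t *\<^sub>R (lam - w t)) \<in> borel_measurable lebesgue"
        by (intro borel_measurable_scaleR borel_measurable_indicator borel_measurable_diff
              borel_measurable_const W_meas measurable_w; simp)+
      show "AE t in lebesgue. indicator {0<..<x} t *\<^sub>R (lam - W t) = indicator {0<..<x} t *\<^sub>R (lam - w t)"
        using W_eq by eventually_elim simp
    qed
    also have "\<dots> = integral {0<..<x} (\<lambda>t. lam - w t)"
      using has_primitiveD(1)[OF has_primitive_F[of lam], of 0 x] that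
      by (intro set_lebesgue_integral_eq_integral(2)) (rule set_integrable_subset, auto)
    also have "\<dots> = F lam x - F lam 0"
      using has_primitiveD(3)[OF has_primitive_F[of lam], of 0 x] that by (simp add: integral_open_interval_real)
    finally show ?thesis by simp
  qed
  have "\<forall>\<^sub>F lam in at_top. ?N lam =
         sqrt pi * deriv W (turning_point W x0 lam) powr (-1/2) *
         exp (2 * phase W lam (turning_point W x0 lam)) * (1 + r lam)"
    using eventually_X_gt eventually_X
  proof eventually_elim
    case (elim lam)
    have X: "x0 < X lam" "0 < X lam" "W (X lam) = lam"
      using elim x0_Y Y w_out[of "X lam"] by auto
    have "turning_point W x0 lam = X lam"
      unfolding turning_point_def
    proof (rule the_equality)
      show "x = X lam" if "x0 < x \<and> W x = lam" for x
        using W_mono[of x "X lam"] W_mono[of "X lam" x] X that by (cases x "X lam" rule: linorder_cases) auto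
    qed (use X in simp)
    then have eq: "sqrt pi * deriv W (turning_point W x0 lam) powr (-1/2) *
         exp (2 * phase W lam (turning_point W x0 lam)) = ?M lam"
      by (simp add: phase[OF X(2)])
    have "?M lam \<noteq> 0" using elim by simp
    moreover have "N = M * (1 + (N / M - 1))" if "M \<noteq> 0" for N M :: real using that by simp
    ultimately show ?case unfolding eq r_def by blast
  qed
  with small show ?thesis by blast
qed

end
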